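(* Let $\delta>0$ be a constant such that $x\,\partial_{xx}f(x,t)\le0$ for $|x|\le\delta$ and $|t|\le T$. Let $x_t$ be a solution of the SDE $dx_t=\frac1\varepsilon f(x_t,t)\,dt+\frac{\sigma}{\sqrt\varepsilon}\,dW_t$, and let $x^{\det}_t$ be the solution of $\varepsilon\frac{dx^{\det}_t}{dt}=f(x^{\det}_t,t)$ on $[-T,T]$ with $x^{\det}_{-T}-x^\star(-T)\asymp\varepsilon$. Let $c_1>0$ be a constant and assume $c_1^2\sigma\ge a_0\vee\varepsilon^{2/3}$. Choose times $-T\le t_0\le t_1\le T$ with $t_1\in[-c_1\sqrt\sigma,c_1\sqrt\sigma]$, and let $h>2\sigma$ be such that $x^{\det}_s+h\sqrt{\zeta(s)}<\delta$ for all $s\in[t_0,t_1]$. Then, if $c_1$ is sufficiently small and $x_0\in(0,x^{\det}_{t_0}+\frac12h\sqrt{\zeta(t_0)}]$, $$\mathbb P^{t_0,x_0}\{x_s>0\ \ \forall s\in[t_0,t_1]\}\le\frac52\Bigl(\frac{|\bar\alpha(t_1,t_0)|}{\varepsilon}+1\Bigr)e^{-\bar\kappa h^2/\sigma^2}+2\exp\Bigl\{-\bar\kappa\,\frac1{\log(h/\sigma)}\,\frac{\alpha(t_1,-c_1\sqrt\sigma)}{\varepsilon}\Bigr\},$$ where $\bar\kappa$ is a positive constant and $\alpha(t,s)=\int_s^ta(u)\,du$.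
   Context: Conventions. $\varepsilon>0$ is a small parameter, and all assertions are for sufficiently small $\varepsilon$. $a_0=a_0(\varepsilon)>0$ with $a_0\to0$ as $\varepsilon\to0$, and $\sigma=\sigma(\varepsilon)>0$. Constants do not depend on $\varepsilon,a_0,\sigma$. $\vee,\wedge$ denote maximum and minimum. For $\varphi\ge 0$, $\psi\asymp\varphi$ means $c_-\varphi\le\psi\le c_+\varphi$ with constants $c_\pm>0$ independent of $t,\varepsilon$ (hence of $a_0,\sigma$); $\psi\asymp-\varphi$ means $-\psi\asymp\varphi$. $\mathcal O(u)$ denotes a quantity bounded by $K|u|$ for small $u$, with $K$ independent of $\varepsilon,a_0,\sigma$. Symmetric setting. $f:\mathbb R^2\to\mathbb R$ may depend on $\varepsilon$ through $a_0$ only, with all constants and derivative bounds below independent of $\varepsilon$. With $d>0$ a constant and $\mathcal M=[-d,d]\times\mathbb R$: $f\in\mathcal C^4(\mathcal M,\mathbb R)$; $f(x,t+1)=f(x,t)$ and $f(x,t)=-f(-x,t)$ on $\mathcal M$; there is a continuous $x^\star:\mathbb R\to(0,d]$ such that in $\mathcal M$, $f(x,t)=0$ iff $x=0$ or $x=\pm x^\star(t)$; for all $t$, $a(t):=\partial_xf(0,t)>0$ and $a^\star(t):=\partial_xf(x^\star(t),t)<0$; $\partial_{xxx}f(0,0)<0$ and $a(t)=a_0+a_1t^2+\mathcal O(t^3)$ near $t=0$, where $a_1>0$ and $\partial_{xxx}f(0,0)$ are fixed. Then $x^\star$ has a quadratic minimum at a time $t^\star=\mathcal O(a_0)$. $T\in(0,1/2)$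 is a constant such that the derivatives of $a$ and $x^\star$ vanish only once in $[-T,T]$, and $x^\star,a,a^\star$ are bounded away from zero on $[T,1-T]$. Summary: $x^\star(t)\asymp\sqrt{a_0}$ and $a(t)\asymp a_0$ for $|t|\le\sqrt{a_0}$; $x^\star(t)\asymp|t|$ and $a(t)\asymp t^2$ for $\sqrt{a_0}\le|t|\le T$; $x^\star(t)\asymp1$ and $a(t)\asymp1$ for $T\le t\le1-T$; $a^\star(t)\asymp-a(t)$ for all $t$. SDE. $W$ is a standard Wiener process; $f$ satisfies the usual (local) Lipschitz and bounded-growth conditions guaranteeing a pathwise unique strong solution with continuous paths. $\mathbb P^{t_0,x_0}$ is the law of the solution started in $x_0$ at time $t_0$. Notation. $\bar a(t)=\partial_xf(x^{\det}_t,t)$, $\bar\alpha(t,s)=\int_s^t\bar a(u)\,du$, and $$\zeta(t)=\frac1{2|\bar a(-T)|}e^{2\bar\alpha(t,-T)/\varepsilon}+\frac1\varepsilon\int_{-T}^te^{2\bar\alpha(t,s)/\varepsilon}\,ds .$$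
   Formalization: In the last exponent, α(t₁,−c₁√σ) is replaced by α(t₁, t₀∨(−c₁√σ)); this is unchanged if t₀ ≤ −c₁√σ. For later t₀ the printed bound can fail: at t₀ = t₁ = c₁√σ the probability is 1 while the bound can be below 1. *)

theory Defs
  imports "HOL-Probability.Probability"
begin

(* Being C^k on S with one common bound B for the function and all its partial
   derivatives of order at most k. Derivatives are taken within S, so that closed
   strips are covered (one-sided derivatives on the boundary). *)
primrec Ck_bounded :: "nat \<Rightarrow> real \<Rightarrow> (real \<times> real) set \<Rightarrow> (real \<times> real \<Rightarrow> real) \<Rightarrow> bool" where
  "Ck_bounded 0 B S g \<longleftrightarrow> continuous_on S g \<and> (\<forall>p\<in>S. \<bar>g p\<bar> \<le> B)"
| "Ck_bounded (Suc k) B S g \<longleftrightarrow> (\<forall>p\<in>S. \<bar>g p\<bar> \<le> B) \<and>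
     (\<exists>gx gt. (\<forall>p\<in>S. (g has_derivative (\<lambda>v. gx p * fst v + gt p * snd v)) (at p within S)) \<and>
        Ck_bounded k B S gx \<and> Ck_bounded k B S gt)"

(* The partial derivative of g with respect to x on the strip [-d,d] x R,
   one-sided at x = d and x = -d; iterate it for higher derivatives. *)
definition ddx :: "real \<Rightarrow> (real \<Rightarrow> real \<Rightarrow> real) \<Rightarrow> real \<Rightarrow> real \<Rightarrow> real" where
  "ddx d g x t = vector_derivative (\<lambda>y. g y t) (at x within {-d..d})"

definition asymp_between :: "real \<Rightarrow> real \<Rightarrow> real \<Rightarrow> real \<Rightarrow> bool" where
  "asymp_between cm cp \<psi> \<phi> \<longleftrightarrow> cm * \<phi> \<le> \<psi> \<and> \<psi> \<le> cp * \<phi>"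

(* Local Lipschitz condition in x and one-sided linear growth, locally uniformly in
   time. The growth condition is the one admitting drifts such as x - x^3; it is
   implied by the two-sided bound on |f|. *)
definition sde_regular :: "(real \<Rightarrow> real \<Rightarrow> real) \<Rightarrow> bool" where
  "sde_regular g \<longleftrightarrow>
     (\<lambda>(x, t). g x t) \<in> borel_measurable borel \<and>
     (\<forall>R>0. \<exists>L. \<forall>x y t. \<bar>x\<bar> \<le> R \<and> \<bar>y\<bar> \<le> R \<and> \<bar>t\<bar> \<le> R \<longrightarrow> \<bar>g x t - g y t\<bar> \<le> L * \<bar>x - y\<bar>) \<and>
     (\<forall>R>0. \<exists>K. \<forall>x t. \<bar>t\<bar> \<le> R \<longrightarrow> x * g x t \<le> K * (1 + x\<^sup>2))"

(* The drift depends on the small parameter only through the value r of a_0: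
   f r is the drift and xstar r the equilibrium curve for a_0 = r, with r ranging
   over (0, rbar]. Every existentially quantified constant below is chosen
   before r, which is what "independent of epsilon" means. The parameter b is the
   value of the third x-derivative of f at (0,0). *)
locale symmetric_drift =
  fixes f :: "real \<Rightarrow> real \<Rightarrow> real \<Rightarrow> real"
    and xstar :: "real \<Rightarrow> real \<Rightarrow> real"
    and d T a1 b rbar :: real
  assumes d_pos: "0 < d"
    and T_range: "0 < T" "T < 1/2"
    and a1_pos: "0 < a1"
    and b_neg: "b < 0"
    and rbar_pos: "0 < rbar"
    and sde_regular: "\<forall>r\<in>{0<..rbar}. sde_regular (f r)"
    and C4: "\<exists>B. \<forall>r\<in>{0<..rbar}. Ck_bounded 4 B ({-d..d} \<times> UNIV) (\<lambda>(x, t). f r x t)"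
    and periodic: "\<forall>r\<in>{0<..rbar}. \<forall>x\<in>{-d..d}. \<forall>t. f r x (t + 1) = f r x t"
    and odd: "\<forall>r\<in>{0<..rbar}. \<forall>x\<in>{-d..d}. \<forall>t. f r x t = - f r (- x) t"
    and xstar_continuous: "\<forall>r\<in>{0<..rbar}. continuous_on UNIV (xstar r)"
    and xstar_range: "\<forall>r\<in>{0<..rbar}. \<forall>t. 0 < xstar r t \<and> xstar r t \<le> d"
    and zeros: "\<forall>r\<in>{0<..rbar}. \<forall>x\<in>{-d..d}. \<forall>t.
      f r x t = 0 \<longleftrightarrow> x = 0 \<or> x = xstar r t \<or> x = - xstar r t"
    and a_pos: "\<forall>r\<in>{0<..rbar}. \<forall>t. 0 < ddx d (f r) 0 t"
    and astar_neg: "\<forall>r\<in>{0<..rbar}. \<forall>t. ddx d (f r) (xstar r t) t < 0"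
    and third_derivative: "\<forall>r\<in>{0<..rbar}. (ddx d ^^ 3) (f r) 0 0 = b"
    and a_expansion: "\<exists>K. \<exists>\<tau>>0. \<forall>r\<in>{0<..rbar}. \<forall>t. \<bar>t\<bar> \<le> \<tau> \<longrightarrow>
      \<bar>ddx d (f r) 0 t - (r + a1 * t\<^sup>2)\<bar> \<le> K * \<bar>t\<bar> ^ 3"
    and a_critical: "\<forall>r\<in>{0<..rbar}. \<exists>!t. t \<in> {-T..T} \<and> deriv (\<lambda>s. ddx d (f r) 0 s) t = 0"
    and xstar_critical: "\<forall>r\<in>{0<..rbar}. \<exists>!t. t \<in> {-T..T} \<and> deriv (xstar r) t = 0"
    and bounded_away: "\<exists>m>0. \<forall>r\<in>{0<..rbar}. \<forall>t\<in>{T..1 - T}.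
      m \<le> xstar r t \<and> m \<le> ddx d (f r) 0 t \<and> m \<le> \<bar>ddx d (f r) (xstar r t) t\<bar>"
    and asymp_inner: "\<exists>cm>0. \<exists>cp>0. \<forall>r\<in>{0<..rbar}. \<forall>t. \<bar>t\<bar> \<le> sqrt r \<longrightarrow>
      asymp_between cm cp (xstar r t) (sqrt r) \<and> asymp_between cm cp (ddx d (f r) 0 t) r"
    and asymp_middle: "\<exists>cm>0. \<exists>cp>0. \<forall>r\<in>{0<..rbar}. \<forall>t. sqrt r \<le> \<bar>t\<bar> \<and> \<bar>t\<bar> \<le> T \<longrightarrow>
      asymp_between cm cp (xstar r t) \<bar>t\<bar> \<and> asymp_between cm cp (ddx d (f r) 0 t) (t\<^sup>2)"
    and asymp_outer: "\<exists>cm>0. \<exists>cp>0. \<forall>r\<in>{0<..rbar}. \<forall>t\<in>{T..1 - T}.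
      asymp_between cm cp (xstar r t) 1 \<and> asymp_between cm cp (ddx d (f r) 0 t) 1"
    and asymp_astar: "\<exists>cm>0. \<exists>cp>0. \<forall>r\<in>{0<..rbar}. \<forall>t.
      asymp_between cm cp (- ddx d (f r) (xstar r t) t) (ddx d (f r) 0 t)"

(* Standard Wiener process (W_t) for t >= t0, started in 0 at time t0. *)
definition standard_wiener :: "'w measure \<Rightarrow> real \<Rightarrow> (real \<Rightarrow> 'w \<Rightarrow> real) \<Rightarrow> bool" where
  "standard_wiener M t0 W \<longleftrightarrow> prob_space M \<and>
     (\<forall>t\<ge>t0. W t \<in> borel_measurable M) \<and>
     (AE \<omega> in M. W t0 \<omega> = 0) \<and>
     (AE \<omega> in M. continuous_on {t0..} (\<lambda>t. W t \<omega>)) \<and>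
     (\<forall>s t. t0 \<le> s \<and> s < t \<longrightarrow>
        distributed M lborel (\<lambda>\<omega>. W t \<omega> - W s \<omega>) (normal_density 0 (sqrt (t - s)))) \<and>
     (\<forall>(n::nat) u. t0 \<le> u 0 \<and> (\<forall>i<n. u i \<le> u (Suc i)) \<longrightarrow>
        prob_space.indep_vars M (\<lambda>_. borel) (\<lambda>i \<omega>. W (u (Suc i)) \<omega> - W (u i) \<omega>) {..<n})"

(* x solves dx = (1/eps) g(x,t) dt + (sigma/sqrt eps) dW on [t0,t1] with x(t0) = x0.
   The noise is additive, so the stochastic integral is an increment of W. All paths
   are required to be continuous, which makes path events over [t0,t1] measurable. *)
definition sde_solution ::
  "(real \<Rightarrow> real \<Rightarrow> real) \<Rightarrow> real \<Rightarrow> real \<Rightarrow> real \<Rightarrow> real \<Rightarrow> real \<Rightarrow>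
   'w measure \<Rightarrow> (real \<Rightarrow> 'w \<Rightarrow> real) \<Rightarrow> (real \<Rightarrow> 'w \<Rightarrow> real) \<Rightarrow> bool" where
  "sde_solution g \<epsilon> \<sigma> t0 t1 x0 M W x \<longleftrightarrow>
     (\<forall>s\<in>{t0..t1}. x s \<in> borel_measurable M) \<and>
     (\<forall>\<omega>\<in>space M. continuous_on {t0..t1} (\<lambda>s. x s \<omega>)) \<and>
     (AE \<omega> in M. \<forall>s\<in>{t0..t1}.
        set_integrable lborel {t0..s} (\<lambda>u. g (x u \<omega>) u) \<and>
        x s \<omega> = x0 + (1/\<epsilon>) * (LBINT u:{t0..s}. g (x u \<omega>) u) + \<sigma> / sqrt \<epsilon> * (W s \<omega> - W t0 \<omega>))"

(* The requirement that the solution stays in [-d,d] makes the linearisation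
   along xdet meaningful: g is differentiable only on that strip. *)
definition det_solution :: "(real \<Rightarrow> real \<Rightarrow> real) \<Rightarrow> real \<Rightarrow> real \<Rightarrow> real \<Rightarrow> (real \<Rightarrow> real) \<Rightarrow> bool" where
  "det_solution g d T \<epsilon> xdet \<longleftrightarrow>
     (\<forall>t\<in>{-T..T}. xdet t \<in> {-d..d} \<and>
        (xdet has_real_derivative g (xdet t) t / \<epsilon>) (at t within {-T..T}))"

(* alpha(t,s), the integral of a from s to t; only used for s <= t. In the theorem
   the lower limit is max t0 (- c1 * sqrt sigma), which is - c1 * sqrt sigma whenever
   t0 <= - c1 * sqrt sigma. A lower limit before the starting time t0 would be wrong:
   for t0 = t1 = c1 * sqrt sigma the probability is 1, while the bound would be small. *)
definition alpha :: "real \<Rightarrow> (real \<Rightarrow> real \<Rightarrow> real) \<Rightarrow> real \<Rightarrow> real \<Rightarrow> real" where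
  "alpha d g t s = integral {s..t} (\<lambda>u. ddx d g 0 u)"

definition abar :: "real \<Rightarrow> (real \<Rightarrow> real \<Rightarrow> real) \<Rightarrow> (real \<Rightarrow> real) \<Rightarrow> real \<Rightarrow> real" where
  "abar d g xdet t = ddx d g (xdet t) t"

definition alphabar :: "real \<Rightarrow> (real \<Rightarrow> real \<Rightarrow> real) \<Rightarrow> (real \<Rightarrow> real) \<Rightarrow> real \<Rightarrow> real \<Rightarrow> real" where
  "alphabar d g xdet t s = integral {s..t} (abar d g xdet)"

definition zeta :: "real \<Rightarrow> (real \<Rightarrow> real \<Rightarrow> real) \<Rightarrow> real \<Rightarrow> real \<Rightarrow> (real \<Rightarrow> real) \<Rightarrow> real \<Rightarrow> real" where
  "zeta d g T \<epsilon> xdet t =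
     1 / (2 * \<bar>abar d g xdet (- T)\<bar>) * exp (2 * alphabar d g xdet t (- T) / \<epsilon>)
     + 1 / \<epsilon> * integral {- T..t} (\<lambda>s. exp (2 * alphabar d g xdet t s / \<epsilon>))"

end

theory Submission imports Defs begin

text \<open>
A path that stays positive up to time \<open>t1\<close> has to avoid zero during the window
\<open>|t| \<le> s\<close> with \<open>s = c1 sqrt \<sigma>\<close>, in which the noise dominates the well. There the linear growth
rate \<open>a(t)\<close> is at most of order \<open>s\<^sup>2 \<le> \<sigma>\<close>, so on the spatial scale \<open>sqrt \<sigma>\<close> and the time scale
\<open>\<epsilon>/\<sigma>\<close> the linear drift, the cubic drift and the noise are all of order one. In a block of
time of length proportional to \<open>\<epsilon>/\<sigma>\<close> the cubic term brings the path from any height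
below \<open>\<delta>\<close> down to order \<open>sqrt \<sigma>\<close>, and in a second such block a sufficiently deep fall of the Wiener
process carries it through zero. This has a probability bounded away from zero, whatever
happened before, and it depends on the increments of the Wiener process in the two blocks only.
Over \<open>n\<close> pairs of blocks the probability of survival is hence at most \<open>(1 - p)^n\<close>
(\<open>survival_avoids_hits\<close>, \<open>wiener_hit_avoidance\<close>). Since \<open>\<alpha>/\<epsilon>\<close> is at most of order \<open>n\<close>, this gives the
second term of the bound; the factor \<open>1/ln (h/\<sigma>)\<close> is bounded because \<open>h > 2 \<sigma>\<close>.

The drift is controlled only below \<open>\<delta>\<close>, and the first term pays for leaving that region. Inside the
window this has probability of order \<open>exp (-C/\<sigma>)\<close> per block, and as soon as about \<open>1/\<sigma>\<close> pairs
of blocks have been used, survival is that unlikely as well; so at most about \<open>1/\<sigma>\<close> pairs are looked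
at, and \<open>h\<^sup>2/\<sigma>\<^sup>2\<close> is at most of order \<open>1/\<sigma>\<close>, because the variance \<open>\<zeta>(t1)\<close> is at least of order \<open>1/\<sigma>\<close>. Before
the window, concavity gives \<open>f(x,t) \<le> f(xdet,t) + abar (x - xdet)\<close>, so \<open>x - xdet\<close> is dominated by the
linearised equation. The time before the window is cut into chunks on each of
which the linearised flow contracts by a fixed factor; the noise of a chunk then has to exceed
a fixed multiple of \<open>h sqrt \<zeta>\<close> for the path to reach the level \<open>xdet + 3/4 h sqrt \<zeta>\<close>, and the number of
chunks is comparable to \<open>|alphabar(t1,t0)|/\<epsilon> + 1\<close> (\<open>approach_bound\<close>).

Both parts rest on deterministic facts that are uniform in the parameters: \<open>xdet\<close> is
comparable to \<open>|t|\<close> before the window and of order \<open>s\<close> at most inside it, the linearisation satisfies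
\<open>|abar| \<le> C max(-t,s)\<^sup>2\<close>, and \<open>\<zeta> \<ge> C/max(-t,s)\<^sup>2\<close>. The upper bound on \<open>alphabar\<close> comes from
\<open>abar \<le> f(xdet,t)/xdet - c xdet\<^sup>2\<close>, whose first summand is \<open>\<epsilon>\<close> times the logarithmic derivative of
\<open>xdet\<close>: it contributes only the logarithm of a bounded ratio, so that \<open>abar\<close> may well
be positive at some times (\<open>alphabar_upper\<close>).

The remaining constants are harmless. If \<open>P \<le> 1\<close> is bounded by \<open>C L exp (-k y)\<close> with \<open>L \<ge> 1\<close>, then also
by \<open>5/2 L exp (-k' y)\<close> for small \<open>k'\<close> (\<open>absorb_constant\<close>); for the same reason \<open>\<sigma>\<close> may be assumed to be
below any fixed constant.
\<close>

section \<open>Gaussian tails and maximal inequalities\<close>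

lemma nn_integral_normal_density_shift:
  assumes "0 < (\<tau>::real)"
  shows "(\<integral>\<^sup>+x. ennreal (normal_density \<mu> \<tau> x) \<partial>lborel) = 1"
proof -
  have "prob_space (density lborel (normal_density \<mu> \<tau>))"
    using prob_space_normal_density[OF assms] by simp
  then have "emeasure (density lborel (normal_density \<mu> \<tau>)) (space (density lborel (normal_density \<mu> \<tau>))) = 1"
    by (rule prob_space.emeasure_space_1)
  then show ?thesis by (simp add: emeasure_density)
qed

text \<open>For \<open>x > l \<ge> 0\<close> the density at \<open>x\<close> is at most \<open>exp (- l\<^sup>2/(2\<tau>\<^sup>2))\<close> times the density of the same law
centred at \<open>l\<close>, which has total mass one.\<close>

lemma (in prob_space) normal_upper_tail:
  assumes D: "distributed M lborel X (normal_density 0 \<tau>)" and \<tau>: "0 < \<tau>" and l: "0 \<le> l"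
  shows "prob {\<omega>\<in>space M. l < X \<omega>} \<le> exp (- l\<^sup>2 / (2 * \<tau>\<^sup>2))"
proof -
  have "emeasure M (X -` {l<..} \<inter> space M)
      = (\<integral>\<^sup>+x. ennreal (normal_density 0 \<tau> x) * indicator {l<..} x \<partial>lborel)"
    by (rule distributed_emeasure[OF D]) auto
  also have "\<dots> \<le> (\<integral>\<^sup>+x. ennreal (exp (- l\<^sup>2 / (2 * \<tau>\<^sup>2))) * ennreal (normal_density l \<tau> x) \<partial>lborel)"
  proof (rule nn_integral_mono)
    fix x :: real
    have "normal_density 0 \<tau> x \<le> exp (- l\<^sup>2 / (2 * \<tau>\<^sup>2)) * normal_density l \<tau> x" if "l < x"
    proof -
      have "0 \<le> l * (x - l)" using that l by simp
      then have "- x\<^sup>2 \<le> - l\<^sup>2 - (x - l)\<^sup>2" by (simp add: power2_eq_square algebra_simps)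
      then have "- x\<^sup>2 / (2 * \<tau>\<^sup>2) \<le> (- l\<^sup>2 - (x - l)\<^sup>2) / (2 * \<tau>\<^sup>2)"
        by (rule divide_right_mono) simp
      then have "exp (- x\<^sup>2 / (2 * \<tau>\<^sup>2)) \<le> exp (- l\<^sup>2 / (2 * \<tau>\<^sup>2)) * exp (- (x - l)\<^sup>2 / (2 * \<tau>\<^sup>2))"
        by (simp add: exp_add[symmetric] diff_divide_distrib)
      then show ?thesis
        unfolding normal_density_def by (simp add: field_simps divide_right_mono)
    qed
    then show "ennreal (normal_density 0 \<tau> x) * indicator {l<..} x
        \<le> ennreal (exp (- l\<^sup>2 / (2 * \<tau>\<^sup>2))) * ennreal (normal_density l \<tau> x)"
      by (auto split: split_indicator simp: ennreal_mult[symmetric])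
  qed
  also have "\<dots> = ennreal (exp (- l\<^sup>2 / (2 * \<tau>\<^sup>2)))"
    by (subst nn_integral_cmult) (auto simp: nn_integral_normal_density_shift[OF \<tau>])
  finally have "emeasure M (X -` {l<..} \<inter> space M) \<le> ennreal (exp (- l\<^sup>2 / (2 * \<tau>\<^sup>2)))" .
  moreover have "X -` {l<..} \<inter> space M = {\<omega>\<in>space M. l < X \<omega>}" by auto
  ultimately show ?thesis
    by (simp add: emeasure_eq_measure)
qed

text \<open>The interval \<open>[-(q+1)\<tau>, -q\<tau>]\<close> alone carries this mass; \<open>1/3\<close> stands for \<open>1/sqrt (2\<pi>)\<close>.\<close>

lemma (in prob_space) normal_lower_tail:
  assumes D: "distributed M lborel X (normal_density 0 \<tau>)" and \<tau>: "0 < \<tau>" and q: "0 \<le> q"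
  shows "exp (- (q + 1)\<^sup>2 / 2) / 3 \<le> prob {\<omega>\<in>space M. X \<omega> \<le> - q * \<tau>}"
proof -
  let ?I = "{- (q + 1) * \<tau> .. - q * \<tau>}"
  let ?c = "exp (- (q + 1)\<^sup>2 / 2) / (3 * \<tau>)"
  have "ennreal (exp (- (q + 1)\<^sup>2 / 2) / 3) = ennreal ?c * emeasure lborel ?I"
    using \<tau> by (simp add: algebra_simps ennreal_mult[symmetric])
  also have "\<dots> = (\<integral>\<^sup>+x. ennreal ?c * indicator ?I x \<partial>lborel)"
    by (subst nn_integral_cmult_indicator) auto
  also have "\<dots> \<le> (\<integral>\<^sup>+x. ennreal (normal_density 0 \<tau> x) * indicator {..- q * \<tau>} x \<partial>lborel)"
  proof (rule nn_integral_mono)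
    fix x :: real
    have "?c \<le> normal_density 0 \<tau> x" if x: "x \<in> ?I"
    proof -
      have "\<bar>x\<bar> \<le> (q + 1) * \<tau>"
      proof -
        have "0 \<le> q * \<tau>" "- (q * \<tau>) - \<tau> \<le> x" "x \<le> - (q * \<tau>)"
          using x q \<tau> by (auto simp: algebra_simps)
        then show ?thesis using \<tau> by (simp add: abs_le_iff algebra_simps)
      qed
      then have "\<bar>x\<bar>\<^sup>2 \<le> ((q + 1) * \<tau>)\<^sup>2" by (rule power_mono) simp
      then have "x\<^sup>2 / (2 * \<tau>\<^sup>2) \<le> ((q + 1) * \<tau>)\<^sup>2 / (2 * \<tau>\<^sup>2)"
        by (intro divide_right_mono) auto
      also have "\<dots> = (q + 1)\<^sup>2 / 2" using \<tau> by (simp add: power_mult_distrib)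
      finally have e: "exp (- (q + 1)\<^sup>2 / 2) \<le> exp (- x\<^sup>2 / (2 * \<tau>\<^sup>2))" by simp
      have "2 * pi < 9" using pi_less_4 by simp
      then have "sqrt (2 * pi * \<tau>\<^sup>2) \<le> sqrt (9 * \<tau>\<^sup>2)"
        by (intro real_sqrt_le_mono mult_right_mono) auto
      also have "\<dots> = 3 * \<tau>" using \<tau> by (simp add: real_sqrt_mult)
      finally have s: "sqrt (2 * pi * \<tau>\<^sup>2) \<le> 3 * \<tau>" .
      have "0 < sqrt (2 * pi * \<tau>\<^sup>2)" using \<tau> by simp
      then have "1 / (3 * \<tau>) \<le> 1 / sqrt (2 * pi * \<tau>\<^sup>2)" using s
        by (intro divide_left_mono) (use \<tau> in auto)
      then have "1 / (3 * \<tau>) * exp (- (q + 1)\<^sup>2 / 2) \<le> 1 / sqrt (2 * pi * \<tau>\<^sup>2) * exp (- x\<^sup>2 / (2 * \<tau>\<^sup>2))"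
        using e \<tau> by (intro mult_mono) auto
      then show ?thesis unfolding normal_density_def by simp
    qed
    then show "ennreal ?c * indicator ?I x \<le> ennreal (normal_density 0 \<tau> x) * indicator {..- q * \<tau>} x"
      by (auto split: split_indicator intro!: ennreal_leI)
  qed
  also have "\<dots> = emeasure M (X -` {..- q * \<tau>} \<inter> space M)"
    by (rule distributed_emeasure[OF D, symmetric]) auto
  also have "X -` {..- q * \<tau>} \<inter> space M = {\<omega>\<in>space M. X \<omega> \<le> - q * \<tau>}" by auto
  finally show ?thesis by (simp add: emeasure_eq_measure)
qed

lemma (in prob_space) normal_uminus:
  assumes D: "distributed M lborel X (normal_density 0 \<tau>)"
  shows "distributed M lborel (\<lambda>\<omega>. - X \<omega>) (normal_density 0 \<tau>)"
  using distributed_affine[OF D, of "-1" 0] by (simp add: normal_density_def divide_ennreal_def)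

lemma (in prob_space) normal_nonneg_half:
  assumes D: "distributed M lborel X (normal_density 0 \<tau>)"
  shows "1/2 \<le> prob {\<omega>\<in>space M. 0 \<le> X \<omega>}"
proof -
  have X: "X \<in> borel_measurable M" using distributed_measurable[OF D] by simp
  have "emeasure M (X -` {0..} \<inter> space M) = emeasure M ((\<lambda>\<omega>. - X \<omega>) -` {0..} \<inter> space M)"
    by (subst distributed_emeasure[OF D], simp, subst distributed_emeasure[OF normal_uminus[OF D]]) auto
  then have "prob (X -` {0..} \<inter> space M) = prob ((\<lambda>\<omega>. - X \<omega>) -` {0..} \<inter> space M)"
    by (simp add: measure_def)
  moreover have "1 \<le> prob (X -` {0..} \<inter> space M) + prob ((\<lambda>\<omega>. - X \<omega>) -` {0..} \<inter> space M)"
  proof -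
    have "space M = (X -` {0..} \<inter> space M) \<union> ((\<lambda>\<omega>. - X \<omega>) -` {0..} \<inter> space M)" by auto
    then have "prob (space M) \<le> prob (X -` {0..} \<inter> space M) + prob ((\<lambda>\<omega>. - X \<omega>) -` {0..} \<inter> space M)"
      using measure_Un_le[OF measurable_sets[OF X, of "{0..}"] measurable_sets[OF borel_measurable_uminus[OF X], of "{0..}"]] by simp
    then show ?thesis by (simp add: prob_space)
  qed
  moreover have "X -` {0..} \<inter> space M = {\<omega>\<in>space M. 0 \<le> X \<omega>}" by auto
  ultimately show ?thesis by simp
qed

text \<open>Independence of disjoint groups of coordinates in the form used below: past and future of a
random walk, and different time blocks. The predicates see the coordinates through a restriction, which makes
explicit that they depend on one group only.\<close>

lemma (in prob_space) indep_coordinates_product: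
  fixes X :: "nat \<Rightarrow> 'a \<Rightarrow> real"
  assumes ind: "indep_vars (\<lambda>_. borel) X I" and AB: "A \<inter> B = {}" "A \<subseteq> I" "B \<subseteq> I"
    and P: "Measurable.pred (PiM A (\<lambda>_. borel)) P"
    and Q: "Measurable.pred (PiM B (\<lambda>_. borel)) Q"
  shows "prob {\<omega>\<in>space M. P (\<lambda>i\<in>A. X i \<omega>) \<and> Q (\<lambda>i\<in>B. X i \<omega>)}
     = prob {\<omega>\<in>space M. P (\<lambda>i\<in>A. X i \<omega>)} * prob {\<omega>\<in>space M. Q (\<lambda>i\<in>B. X i \<omega>)}"
proof -
  let ?A = "PiM A (\<lambda>_. borel) :: (nat \<Rightarrow> real) measure"
  let ?B = "PiM B (\<lambda>_. borel) :: (nat \<Rightarrow> real) measure"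
  have iv: "indep_var ?A (\<lambda>\<omega>. \<lambda>i\<in>A. X i \<omega>) ?B (\<lambda>\<omega>. \<lambda>i\<in>B. X i \<omega>)"
    using AB by (intro indep_var_restrict[OF ind]) auto
  have sp: "\<And>\<omega>. (\<lambda>i\<in>A. X i \<omega>) \<in> space ?A" "\<And>\<omega>. (\<lambda>i\<in>B. X i \<omega>) \<in> space ?B"
    by (auto simp: space_PiM)
  have "prob ((\<lambda>x. (\<lambda>i\<in>A. X i x, \<lambda>i\<in>B. X i x)) -` ({y\<in>space ?A. P y} \<times> {y\<in>space ?B. Q y}) \<inter> space M)
     = prob ((\<lambda>\<omega>. \<lambda>i\<in>A. X i \<omega>) -` {y\<in>space ?A. P y} \<inter> space M)
       * prob ((\<lambda>\<omega>. \<lambda>i\<in>B. X i \<omega>) -` {y\<in>space ?B. Q y} \<inter> space M)"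
    by (rule indep_varD[OF iv]) (use P Q in \<open>auto simp: pred_def\<close>)
  moreover have "((\<lambda>x. (\<lambda>i\<in>A. X i x, \<lambda>i\<in>B. X i x)) -` ({y\<in>space ?A. P y} \<times> {y\<in>space ?B. Q y}) \<inter> space M)
     = {\<omega>\<in>space M. P (\<lambda>i\<in>A. X i \<omega>) \<and> Q (\<lambda>i\<in>B. X i \<omega>)}"
    "((\<lambda>\<omega>. \<lambda>i\<in>A. X i \<omega>) -` {y\<in>space ?A. P y} \<inter> space M) = {\<omega>\<in>space M. P (\<lambda>i\<in>A. X i \<omega>)}"
    "((\<lambda>\<omega>. \<lambda>i\<in>B. X i \<omega>) -` {y\<in>space ?B. Q y} \<inter> space M) = {\<omega>\<in>space M. Q (\<lambda>i\<in>B. X i \<omega>)}"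
    using sp by auto
  ultimately show ?thesis by simp
qed

text \<open>Split according to the first passage index \<open>i\<close> above \<open>l\<close>. That event is determined by the
first \<open>i\<close> increments, and independently of it the rest of the sum is nonnegative with probability at least
one half, in which case the whole sum exceeds \<open>l\<close>.\<close>

lemma (in prob_space) levy_maximal_inequality:
  fixes X :: "nat \<Rightarrow> 'a \<Rightarrow> real"
  assumes ind: "indep_vars (\<lambda>_. borel) X {..<n}"
    and half: "\<And>i. i \<le> n \<Longrightarrow> 1/2 \<le> prob {\<omega>\<in>space M. 0 \<le> (\<Sum>l=i..<n. X l \<omega>)}"
  shows "prob {\<omega>\<in>space M. \<exists>i\<le>n. l < (\<Sum>k<i. X k \<omega>)} \<le> 2 * prob {\<omega>\<in>space M. l < (\<Sum>k<n. X k \<omega>)}"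
proof -
  have X[measurable]: "X k \<in> borel_measurable M" if "k < n" for k
    using ind that by (auto simp: indep_vars_def)
  define S where "S i \<omega> = (\<Sum>k<i. X k \<omega>)" for i \<omega>
  have S[measurable]: "S i \<in> borel_measurable M" if "i \<le> n" for i
    unfolding S_def using that by (intro borel_measurable_sum) (auto intro!: X)
  define T where "T i = {\<omega>\<in>space M. l < S i \<omega> \<and> (\<forall>j<i. S j \<omega> \<le> l)}" for i
  have T[measurable]: "T i \<in> events" if "i \<le> n" for i
  proof -
    have "{\<omega>\<in>space M. S j \<omega> \<le> l} \<in> events" if "j < i" for j
      using S[of j] that \<open>i \<le> n\<close> by simp
    moreover have "T i = {\<omega>\<in>space M. l < S i \<omega>} \<inter> {\<omega>\<in>space M. \<forall>j\<in>{..<i}. S j \<omega> \<le> l}"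
      unfolding T_def by auto
    moreover have "{\<omega>\<in>space M. \<forall>j\<in>{..<i}. S j \<omega> \<le> l} \<in> events"
      using calculation(1) by (intro sets.sets_Collect_finite_All) auto
    ultimately show ?thesis using S[OF that] by auto
  qed
  have split: "S n \<omega> = S i \<omega> + (\<Sum>l=i..<n. X l \<omega>)" if "i \<le> n" for i \<omega>
    unfolding S_def using sum.atLeastLessThan_concat[of 0 i n "\<lambda>k. X k \<omega>"] that
    by (simp add: atLeast0LessThan)
  have ev: "{\<omega>\<in>space M. \<exists>i\<le>n. l < S i \<omega>} = (\<Union>i\<le>n. T i)"
  proof (intro equalityI subsetI)
    fix \<omega> assume "\<omega> \<in> {\<omega>\<in>space M. \<exists>i\<le>n. l < S i \<omega>}"
    then obtain i where i: "i \<le> n" "l < S i \<omega>" and sp: "\<omega> \<in> space M" by auto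
    define i0 where "i0 = (LEAST i. l < S i \<omega>)"
    have "l < S i0 \<omega>" unfolding i0_def using i(2) by (rule LeastI)
    moreover have "i0 \<le> i" unfolding i0_def using i(2) by (rule Least_le)
    moreover have "\<forall>j<i0. S j \<omega> \<le> l" unfolding i0_def using not_less_Least not_less by blast
    ultimately show "\<omega> \<in> (\<Union>i\<le>n. T i)" using i sp unfolding T_def by (auto intro!: bexI[of _ i0])
  qed (auto simp: T_def)
  have disj: "disjoint_family_on T {..n}"
  unfolding disjoint_family_on_def
  proof (intro ballI impI)
    fix i j :: nat assume "i \<noteq> j"
    then show "T i \<inter> T j = {}" unfolding T_def by (cases "i < j") (auto simp: not_less dest!: le_neq_implies_less)
  qed
  define E where "E i = {\<omega>\<in>space M. 0 \<le> (\<Sum>l=i..<n. X l \<omega>)}" for i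
  have E[measurable]: "E i \<in> events" if "i \<le> n" for i
    unfolding E_def by measurable
  have indep: "prob (T i \<inter> E i) = prob (T i) * prob (E i)" if i: "i \<le> n" for i
  proof -
    let ?P = "\<lambda>y::nat\<Rightarrow>real. l < (\<Sum>k<i. y k) \<and> (\<forall>j\<in>{..<i}. (\<Sum>k<j. y k) \<le> l)"
    let ?Q = "\<lambda>y::nat\<Rightarrow>real. 0 \<le> (\<Sum>l=i..<n. y l)"
    have m: "(\<lambda>y::nat\<Rightarrow>real. \<Sum>k<j. y k) \<in> borel_measurable (PiM {..<i} (\<lambda>_. borel))" if "j \<le> i" for j
      
    proof (rule borel_measurable_sum[where f="\<lambda>k (y::nat\<Rightarrow>real). y k" and S="{..<j}"])
      show "(\<lambda>y::nat\<Rightarrow>real. y k) \<in> borel_measurable (PiM {..<i} (\<lambda>_. borel))" if "k \<in> {..<j}" for k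
        using that \<open>j \<le> i\<close> by (intro measurable_component_singleton) auto
    qed
    have m1: "Measurable.pred (PiM {..<i} (\<lambda>_. borel)) (\<lambda>y::nat\<Rightarrow>real. l < (\<Sum>k<i. y k))"
      unfolding pred_def by (rule borel_measurable_less[OF borel_measurable_const m]) simp
    have m2: "Measurable.pred (PiM {..<i} (\<lambda>_. borel)) (\<lambda>y::nat\<Rightarrow>real. (\<Sum>k<j. y k) \<le> l)" if "j < i" for j
      unfolding pred_def by (rule borel_measurable_le[OF m borel_measurable_const]) (use that in simp)
    have 1: "Measurable.pred (PiM {..<i} (\<lambda>_. borel)) ?P"
      by (intro pred_intros_logic(3) pred_intros_finite(3) m1 m2) auto
    have 2: "Measurable.pred (PiM {i..<n} (\<lambda>_. borel)) ?Q"
      by measurable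
    have r1: "(\<Sum>k<j. (\<lambda>k\<in>{..<i}. X k \<omega>) k) = (\<Sum>k<j. X k \<omega>)" if "j \<le> i" for j \<omega>
      using that by (intro sum.cong) auto
    have rP: "?P (\<lambda>k\<in>{..<i}. X k \<omega>) = ?P (\<lambda>k. X k \<omega>)" for \<omega>
      using r1 by (auto simp del: restrict_apply)
    have rQ: "(\<Sum>k=i..<n. (\<lambda>k\<in>{i..<n}. X k \<omega>) k) = (\<Sum>k=i..<n. X k \<omega>)" for \<omega>
      by (intro sum.cong) auto
    have "T i \<inter> E i = {\<omega>\<in>space M. ?P (\<lambda>k\<in>{..<i}. X k \<omega>) \<and> ?Q (\<lambda>k\<in>{i..<n}. X k \<omega>)}"
      unfolding rP rQ unfolding T_def E_def S_def by auto
    moreover have "T i = {\<omega>\<in>space M. ?P (\<lambda>k\<in>{..<i}. X k \<omega>)}"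
      unfolding rP unfolding T_def S_def by auto
    moreover have "E i = {\<omega>\<in>space M. ?Q (\<lambda>k\<in>{i..<n}. X k \<omega>)}"
      unfolding rQ unfolding E_def by auto
    moreover have "{..<i} \<inter> {i..<n} = {}" "{..<i} \<subseteq> {..<n}" "{i..<n} \<subseteq> {..<n}" using i by auto
    note indep_coordinates_product[OF ind this 1 2]
    ultimately show ?thesis by (simp only:)
  qed
  have "prob (\<Union>i\<le>n. T i) = (\<Sum>i\<le>n. prob (T i))"
    using disj by (intro finite_measure_finite_Union) auto
  also have "\<dots> \<le> (\<Sum>i\<le>n. 2 * prob (T i \<inter> E i))"
  proof (rule sum_mono)
    fix i assume "i \<in> {..n}"
    then have "1/2 \<le> prob (E i)" "prob (T i \<inter> E i) = prob (T i) * prob (E i)"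
      using half[of i] indep unfolding E_def by auto
    then show "prob (T i) \<le> 2 * prob (T i \<inter> E i)"
      using mult_left_mono[of "1/2" "prob (E i)" "prob (T i)"] by simp
  qed
  also have "\<dots> = 2 * (\<Sum>i\<le>n. prob (T i \<inter> E i))" by (simp add: sum_distrib_left)
  also have "(\<Sum>i\<le>n. prob (T i \<inter> E i)) = prob (\<Union>i\<le>n. T i \<inter> E i)"
    using disj by (intro finite_measure_finite_Union[symmetric]) (auto simp: disjoint_family_on_def)
  also have "\<dots> \<le> prob {\<omega>\<in>space M. l < S n \<omega>}"
  proof (rule finite_measure_mono)
    show "(\<Union>i\<le>n. T i \<inter> E i) \<subseteq> {\<omega>\<in>space M. l < S n \<omega>}"
    proof
      fix \<omega> assume "\<omega> \<in> (\<Union>i\<le>n. T i \<inter> E i)"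
      then obtain i where "i \<le> n" "\<omega> \<in> T i" "\<omega> \<in> E i" by auto
      then show "\<omega> \<in> {\<omega>\<in>space M. l < S n \<omega>}" using split[of i \<omega>] unfolding T_def E_def by auto
    qed
  qed simp
  finally show ?thesis using ev unfolding S_def by simp
qed

text \<open>Induction on the number of blocks: avoiding the first \<open>n\<close> events depends on the first
\<open>n b\<close> coordinates only and is therefore independent of the event of the next block.\<close>

lemma (in prob_space) indep_blocks_avoid:
  fixes X :: "nat \<Rightarrow> 'a \<Rightarrow> real" and b n :: nat
  assumes ind: "indep_vars (\<lambda>_. borel) X {..<n * b}" and p: "p \<le> 1"
    and H: "\<And>k. k < n \<Longrightarrow> Measurable.pred (PiM {k * b..<(k + 1) * b} (\<lambda>_. borel)) (H k)"
    and loc: "\<And>k y. k < n \<Longrightarrow> H k (restrict y {k * b..<(k + 1) * b}) = H k y"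
    and Hp: "\<And>k. k < n \<Longrightarrow> p \<le> prob {\<omega>\<in>space M. H k (\<lambda>i. X i \<omega>)}"
  shows "prob {\<omega>\<in>space M. \<forall>k<n. \<not> H k (\<lambda>i. X i \<omega>)} \<le> (1 - p) ^ n"
  using assms
proof (induction n)
  case (Suc n)
  let ?A = "{..<n * b}" and ?B = "{n * b..<(n + 1) * b}"
  have X: "X i \<in> borel_measurable M" if "i < Suc n * b" for i
    using Suc.prems(1) that by (auto simp: indep_vars_def)
  have ind': "indep_vars (\<lambda>_. borel) X ?A"
    by (rule indep_vars_subset[OF Suc.prems(1)]) auto
  have IH: "prob {\<omega>\<in>space M. \<forall>k<n. \<not> H k (\<lambda>i. X i \<omega>)} \<le> (1 - p) ^ n"
    by (rule Suc.IH[OF ind' Suc.prems(2)]) (use Suc.prems(3-5) in \<open>auto simp: less_Suc_eq\<close>)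
  let ?P = "\<lambda>y. \<forall>k\<in>{..<n}. \<not> H k y"
  have mono: "k * b + b \<le> n * b" if "k < n" for k
    using mult_le_mono1[of "Suc k" n b] that by (simp add: add.commute)
  have sub: "{k * b..<(k + 1) * b} \<subseteq> ?A" if "k < n" for k
    using mono[OF that] by auto
  have P1: "Measurable.pred (PiM ?A (\<lambda>_. borel)) (H k)" if k: "k < n" for k
  proof -
    have "(\<lambda>y. H k (restrict y {k * b..<(k + 1) * b})) \<in> measurable (PiM ?A (\<lambda>_. borel)) (count_space UNIV)"
      using measurable_compose[OF measurable_restrict_subset[OF sub[OF k]] Suc.prems(3)[of k]] k by (simp add: restrict_def)
    then show ?thesis using Suc.prems(4)[OF less_SucI[OF k]] by (simp only:)
  qed
  have P: "Measurable.pred (PiM ?A (\<lambda>_. borel)) ?P"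
    by (intro pred_intros_finite(3) pred_intros_logic(2) P1) auto
  have Q: "Measurable.pred (PiM ?B (\<lambda>_. borel)) (H n)" using Suc.prems(3)[of n] by simp
  have Q': "Measurable.pred (PiM ?B (\<lambda>_. borel)) (\<lambda>y. \<not> H n y)" by (rule pred_intros_logic(2)[OF Q])
  have AB: "?A \<inter> ?B = {}" "?A \<subseteq> {..<Suc n * b}" "?B \<subseteq> {..<Suc n * b}" by auto
  have rA: "?P (\<lambda>i\<in>?A. X i \<omega>) = ?P (\<lambda>i. X i \<omega>)" for \<omega>
  proof -
    have "H k (\<lambda>i\<in>?A. X i \<omega>) = H k (\<lambda>i. X i \<omega>)" if k: "k < n" for k
    proof -
      have "restrict (\<lambda>i\<in>?A. X i \<omega>) {k * b..<(k + 1) * b} = restrict (\<lambda>i. X i \<omega>) {k * b..<(k + 1) * b}"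
        using mono[OF k] by (intro restrict_ext) auto
      then show ?thesis
        using Suc.prems(4)[OF less_SucI[OF k]] by metis
    qed
    then show ?thesis by auto
  qed
  have rB: "H n (\<lambda>i\<in>?B. X i \<omega>) = H n (\<lambda>i. X i \<omega>)" for \<omega>
    using Suc.prems(4)[OF lessI] by metis
  have mB: "{\<omega>\<in>space M. H n (\<lambda>i. X i \<omega>)} \<in> events"
  proof -
    have "(\<lambda>\<omega>. \<lambda>i\<in>?B. X i \<omega>) \<in> measurable M (PiM ?B (\<lambda>_. borel))"
      by (intro measurable_restrict X) auto
    from measurable_compose[OF this Q] show ?thesis unfolding rB by (simp add: pred_def)
  qed
  have "{\<omega>\<in>space M. \<not> H n (\<lambda>i. X i \<omega>)} = space M - {\<omega>\<in>space M. H n (\<lambda>i. X i \<omega>)}" by auto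
  then have "prob {\<omega>\<in>space M. \<not> H n (\<lambda>i. X i \<omega>)} = 1 - prob {\<omega>\<in>space M. H n (\<lambda>i. X i \<omega>)}"
    using prob_compl[OF mB] by simp
  then have q: "prob {\<omega>\<in>space M. \<not> H n (\<lambda>i. X i \<omega>)} \<le> 1 - p"
    using Suc.prems(5)[of n] by simp
  have "{\<omega>\<in>space M. \<forall>k<Suc n. \<not> H k (\<lambda>i. X i \<omega>)}
      = {\<omega>\<in>space M. ?P (\<lambda>i\<in>?A. X i \<omega>) \<and> \<not> H n (\<lambda>i\<in>?B. X i \<omega>)}"
    unfolding rA rB by (auto simp: less_Suc_eq)
  then have "prob {\<omega>\<in>space M. \<forall>k<Suc n. \<not> H k (\<lambda>i. X i \<omega>)}
      = prob {\<omega>\<in>space M. ?P (\<lambda>i\<in>?A. X i \<omega>)} * prob {\<omega>\<in>space M. \<not> H n (\<lambda>i\<in>?B. X i \<omega>)}"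
    using indep_coordinates_product[OF Suc.prems(1) AB P Q'] by simp
  also have "\<dots> \<le> (1 - p) ^ n * (1 - p)"
    unfolding rA rB using IH q Suc.prems(2) by (intro mult_mono) (auto simp: Ball_def)
  finally show ?case by (simp add: mult.commute)
qed (simp add: prob_space)

section \<open>The Wiener process on dyadic grids\<close>

text \<open>By this symmetry every one-sided bound for the Wiener process gives the two-sided one.\<close>

lemma standard_wiener_uminus:
  assumes W: "standard_wiener M t0 W"
  shows "standard_wiener M t0 (\<lambda>t \<omega>. - W t \<omega>)"
proof -
  interpret prob_space M using W by (simp add: standard_wiener_def)
  have n: "distributed M lborel (\<lambda>\<omega>. - W t \<omega> - - W s \<omega>) (normal_density 0 (sqrt (t - s)))"
    if "t0 \<le> s" "s < t" for s t
  proof -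
    have "distributed M lborel (\<lambda>\<omega>. - (W t \<omega> - W s \<omega>)) (normal_density 0 (sqrt (t - s)))"
      using W that by (intro normal_uminus) (simp add: standard_wiener_def)
    then show ?thesis by (simp add: algebra_simps)
  qed
  have i: "indep_vars (\<lambda>_. borel) (\<lambda>i \<omega>. - W (u (Suc i)) \<omega> - - W (u i) \<omega>) {..<n}"
    if "t0 \<le> u 0" "\<forall>i<n. u i \<le> u (Suc i)" for n :: nat and u
  proof -
    have "indep_vars (\<lambda>_. borel) (\<lambda>i \<omega>. W (u (Suc i)) \<omega> - W (u i) \<omega>) {..<n}"
      using W that by (simp add: standard_wiener_def)
    then have "indep_vars (\<lambda>_. borel) (\<lambda>i. uminus \<circ> (\<lambda>\<omega>. W (u (Suc i)) \<omega> - W (u i) \<omega>)) {..<n}"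
      by (rule indep_vars_compose) simp
    then show ?thesis by (simp add: comp_def)
  qed
  have z: "AE \<omega> in M. - W t0 \<omega> = 0"
    using W by (simp add: standard_wiener_def)
  have "AE \<omega> in M. continuous_on {t0..} (\<lambda>t. W t \<omega>)"
    using W by (simp add: standard_wiener_def)
  then have c: "AE \<omega> in M. continuous_on {t0..} (\<lambda>t. - W t \<omega>)"
    by (rule AE_mp) (intro AE_I2 impI continuous_on_minus)
  have m: "\<forall>t\<ge>t0. (\<lambda>\<omega>. - W t \<omega>) \<in> borel_measurable M"
    using W by (simp add: standard_wiener_def)
  show ?thesis
    unfolding standard_wiener_def using prob_space_axioms m z c n i by blast
qed

lemma wiener_grid_increments:
  assumes W: "standard_wiener M t0 W" and u: "t0 \<le> u" and h: "0 \<le> h"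
  shows "prob_space.indep_vars M (\<lambda>_. borel)
    (\<lambda>i \<omega>. W (u + h * real (Suc i)) \<omega> - W (u + h * real i) \<omega>) {..<n}"
proof -
  have "t0 \<le> u + h * real (0::nat)" "\<forall>i<n. u + h * real i \<le> u + h * real (Suc i)"
    using u h by (auto simp: algebra_simps)
  moreover have "\<forall>(n::nat) v. t0 \<le> v 0 \<and> (\<forall>i<n. v i \<le> v (Suc i)) \<longrightarrow>
        prob_space.indep_vars M (\<lambda>_. borel) (\<lambda>i \<omega>. W (v (Suc i)) \<omega> - W (v i) \<omega>) {..<n}"
    using W by (simp add: standard_wiener_def)
  ultimately show ?thesis by (drule_tac x=n in spec, drule_tac x="\<lambda>i. u + h * real i" in spec) blast
qed

lemma wiener_grid_upper_max:
  assumes W: "standard_wiener M t0 W" and u: "t0 \<le> u" and h: "0 < h" and n: "0 < n" and l: "0 \<le> l"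
  shows "measure M {\<omega>\<in>space M. \<exists>i\<le>n. l < W (u + h * real i) \<omega> - W u \<omega>}
    \<le> 2 * exp (- l\<^sup>2 / (2 * (h * real n)))"
proof -
  interpret prob_space M using W by (simp add: standard_wiener_def)
  let ?X = "\<lambda>i \<omega>. W (u + h * real (Suc i)) \<omega> - W (u + h * real i) \<omega>"
  have tel: "(\<Sum>k=i..<j. ?X k \<omega>) = W (u + h * real j) \<omega> - W (u + h * real i) \<omega>" if "i \<le> j" for i j \<omega>
    using sum_Suc_diff'[OF that, of "\<lambda>k. W (u + h * real k) \<omega>"] by simp
  have tel0: "(\<Sum>k<j. ?X k \<omega>) = W (u + h * real j) \<omega> - W u \<omega>" for j \<omega>
    using tel[of 0 j \<omega>] by (simp add: atLeast0LessThan)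
  have d: "distributed M lborel (\<lambda>\<omega>. W (u + h * real j) \<omega> - W (u + h * real i) \<omega>)
      (normal_density 0 (sqrt (h * (real j - real i))))" if "i < j" for i j
  proof -
    have "t0 \<le> u + h * real i" "u + h * real i < u + h * real j" using u h that by (auto intro: add_increasing2)
    then have "distributed M lborel (\<lambda>\<omega>. W (u + h * real j) \<omega> - W (u + h * real i) \<omega>)
      (normal_density 0 (sqrt (u + h * real j - (u + h * real i))))"
      using W unfolding standard_wiener_def by blast
    moreover have "u + h * real j - (u + h * real i) = h * (real j - real i)" by (simp add: algebra_simps)
    ultimately show ?thesis by (simp only:)
  qed
  have half: "1/2 \<le> prob {\<omega>\<in>space M. 0 \<le> (\<Sum>k=i..<n. ?X k \<omega>)}" if "i \<le> n" for i
  proof (cases "i = n")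
    case True then show ?thesis by (simp add: prob_space)
  next
    case False
    then show ?thesis using normal_nonneg_half[OF d[of i n]] that by (simp only: tel)
  qed
  have "prob {\<omega>\<in>space M. \<exists>i\<le>n. l < (\<Sum>k<i. ?X k \<omega>)} \<le> 2 * prob {\<omega>\<in>space M. l < (\<Sum>k<n. ?X k \<omega>)}"
    using h by (intro levy_maximal_inequality[OF wiener_grid_increments[OF W u] half]) auto
  also have "prob {\<omega>\<in>space M. l < (\<Sum>k<n. ?X k \<omega>)} \<le> exp (- l\<^sup>2 / (2 * (sqrt (h * real n))\<^sup>2))"
    unfolding tel0 using d[of 0 n] n h l by (intro normal_upper_tail) auto
  finally show ?thesis using h n unfolding tel0 by simp
qed

lemma wiener_grid_max:
  assumes W: "standard_wiener M t0 W" and u: "t0 \<le> u" and h: "0 < h" and n: "0 < n" and l: "0 \<le> l"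
  shows "{\<omega>\<in>space M. \<exists>i\<le>n. l < \<bar>W (u + h * real i) \<omega> - W u \<omega>\<bar>} \<in> sets M"
    and "measure M {\<omega>\<in>space M. \<exists>i\<le>n. l < \<bar>W (u + h * real i) \<omega> - W u \<omega>\<bar>}
    \<le> 4 * exp (- l\<^sup>2 / (2 * (h * real n)))"
proof -
  interpret prob_space M using W by (simp add: standard_wiener_def)
  let ?A = "{\<omega>\<in>space M. \<exists>i\<le>n. l < W (u + h * real i) \<omega> - W u \<omega>}"
  let ?B = "{\<omega>\<in>space M. \<exists>i\<le>n. l < - W (u + h * real i) \<omega> - - W u \<omega>}"
  have m: "W (u + h * real i) \<in> borel_measurable M" for i
  proof -
    have "t0 \<le> u + h * real i" using u h by (intro add_increasing2) auto
    then show ?thesis using W by (simp add: standard_wiener_def)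
  qed
  have m0: "W u \<in> borel_measurable M" using m[of 0] by simp
  have A: "?A \<in> events"
  proof -
    have a: "{\<omega>\<in>space M. l < W (u + h * real i) \<omega> - W u \<omega>} \<in> events" for i
      by (rule borel_measurable_less[OF borel_measurable_const borel_measurable_diff[OF m m0]])
    have "{\<omega>\<in>space M. \<exists>i\<in>{..n}. l < W (u + h * real i) \<omega> - W u \<omega>} \<in> events"
      by (rule sets.sets_Collect_finite_Ex) (rule a, simp)
    then show ?thesis unfolding Bex_def atMost_iff .
  qed
  have B: "?B \<in> events"
  proof -
    have a: "{\<omega>\<in>space M. l < - W (u + h * real i) \<omega> - - W u \<omega>} \<in> events" for i
      by (rule borel_measurable_less[OF borel_measurable_const
            borel_measurable_diff[OF borel_measurable_uminus[OF m] borel_measurable_uminus[OF m0]]])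
    have "{\<omega>\<in>space M. \<exists>i\<in>{..n}. l < - W (u + h * real i) \<omega> - - W u \<omega>} \<in> events"
      by (rule sets.sets_Collect_finite_Ex) (rule a, simp)
    then show ?thesis unfolding Bex_def atMost_iff .
  qed
  have eq: "{\<omega>\<in>space M. \<exists>i\<le>n. l < \<bar>W (u + h * real i) \<omega> - W u \<omega>\<bar>} = ?A \<union> ?B"
  proof -
    have "l < \<bar>x - y\<bar> \<longleftrightarrow> l < x - y \<or> l < - x - - y" for x y :: real by linarith
    then show ?thesis by (simp only:) blast
  qed
  show "{\<omega>\<in>space M. \<exists>i\<le>n. l < \<bar>W (u + h * real i) \<omega> - W u \<omega>\<bar>} \<in> sets M"
    unfolding eq by (rule sets.Un[OF A B])
  have "prob (?A \<union> ?B) \<le> prob ?A + prob ?B" by (rule measure_Un_le[OF A B])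
  then show "measure M {\<omega>\<in>space M. \<exists>i\<le>n. l < \<bar>W (u + h * real i) \<omega> - W u \<omega>\<bar>}
    \<le> 4 * exp (- l\<^sup>2 / (2 * (h * real n)))"
    unfolding eq using wiener_grid_upper_max[OF assms]
      wiener_grid_upper_max[OF standard_wiener_uminus[OF W] u h n l] by linarith
qed

text \<open>Events about a whole path are handled as limits of events on dyadic grids; continuity
carries a bound from the grids to the interval.\<close>

lemma dyadic_bound_extends:
  fixes g :: "real \<Rightarrow> real"
  assumes cont: "continuous_on {0..1} g"
    and dy: "\<And>m i. i \<le> 2 ^ m \<Longrightarrow> g (real i / 2 ^ m) \<le> c"
    and \<tau>: "\<tau> \<in> {0..1}"
  shows "g \<tau> \<le> c"
proof -
  define a where "a m = real (nat \<lfloor>\<tau> * 2 ^ m\<rfloor>) / 2 ^ m" for m :: nat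
  have fl: "real (nat \<lfloor>\<tau> * 2 ^ m\<rfloor>) = of_int \<lfloor>\<tau> * 2 ^ m\<rfloor>" for m :: nat
    using \<tau> by simp
  have up: "a m \<le> \<tau>" for m
    unfolding a_def fl by (simp add: divide_le_eq)
  have lo: "\<tau> - 1 / 2 ^ m \<le> a m" for m
  proof -
    have "\<tau> * 2 ^ m - 1 \<le> of_int \<lfloor>\<tau> * 2 ^ m\<rfloor>" by linarith
    then have "(\<tau> * 2 ^ m - 1) / 2 ^ m \<le> of_int \<lfloor>\<tau> * 2 ^ m\<rfloor> / 2 ^ m" by (rule divide_right_mono) simp
    then show ?thesis unfolding a_def fl by (simp add: diff_divide_distrib)
  qed
  have in01: "a m \<in> {0..1}" for m
  proof -
    have "a m \<le> 1" using up[of m] \<tau> by simp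
    moreover have "0 \<le> a m" unfolding a_def by simp
    ultimately show ?thesis by simp
  qed
  have "(\<lambda>m. 1 / 2 ^ m :: real) \<longlonglongrightarrow> 0"
    using LIMSEQ_realpow_zero[of "1/2::real"] by (simp add: power_one_over)
  then have "(\<lambda>m. \<tau> - 1 / 2 ^ m) \<longlonglongrightarrow> \<tau> - 0" by (intro tendsto_diff tendsto_const)
  then have "a \<longlonglongrightarrow> \<tau>"
    using tendsto_sandwich[of "\<lambda>m. \<tau> - 1 / 2 ^ m" a sequentially "\<lambda>_. \<tau>" \<tau>] up lo by simp
  then have "(\<lambda>m. g (a m)) \<longlonglongrightarrow> g \<tau>"
    using continuous_on_tendsto_compose[OF cont, of a \<tau> sequentially] \<tau> in01 by simp
  moreover have "g (a m) \<le> c" for m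
  proof -
    have "nat \<lfloor>\<tau> * 2 ^ m\<rfloor> \<le> 2 ^ m"
    proof -
      have "\<tau> * 2 ^ m \<le> 2 ^ m" using \<tau> by (simp add: mult_left_le_one_le)
      with of_int_floor_le[of "\<tau> * 2 ^ m"] have "real_of_int \<lfloor>\<tau> * 2 ^ m\<rfloor> \<le> 2 ^ m" by (rule order_trans)
      then have "real_of_int \<lfloor>\<tau> * 2 ^ m\<rfloor> \<le> real_of_int (2 ^ m)"
        by (simp only: of_int_power of_int_numeral)
      then have "\<lfloor>\<tau> * 2 ^ m\<rfloor> \<le> 2 ^ m" by (simp only: of_int_le_iff)
      then show ?thesis by (simp add: nat_le_iff)
    qed
    then show ?thesis using dy unfolding a_def by blast
  qed
  ultimately show ?thesis by (intro LIMSEQ_le_const2) auto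
qed

lemma wiener_path_segment_continuous:
  assumes c: "continuous_on {t0..} w" and "t0 \<le> (u::real)" "0 \<le> l"
  shows "continuous_on {0..1} (\<lambda>\<tau>. w (u + l * \<tau>) :: real)"
  using assms by (intro continuous_on_compose2[OF c]) (auto intro!: continuous_intros add_increasing2)

text \<open>The exceptional sets of the dyadic grids increase, and the bound for a grid does not
depend on its mesh, so their union satisfies it too. An explicit exceptional set is produced because
the supremum over an interval need not be measurable on the given space.\<close>

lemma wiener_maximal_inequality:
  assumes W: "standard_wiener M t0 W" and u: "t0 \<le> u" and l: "0 < l" and r: "0 \<le> r"
  obtains E where "E \<in> sets M" "measure M E \<le> 4 * exp (- r\<^sup>2 / (2 * l))"
    "AE \<omega> in M. \<omega> \<notin> E \<longrightarrow> (\<forall>v\<in>{u..u+l}. \<bar>W v \<omega> - W u \<omega>\<bar> \<le> r)"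
proof -
  interpret prob_space M using W by (simp add: standard_wiener_def)
  define E where "E m = {\<omega>\<in>space M. \<exists>i\<le>2^m. r < \<bar>W (u + (l / 2^m) * real i) \<omega> - W u \<omega>\<bar>}" for m :: nat
  have l': "0 < l / 2 ^ m" for m :: nat using l by simp
  have n': "(0::nat) < 2 ^ m" for m by simp
  have Ems: "E m \<in> events" for m unfolding E_def
    by (rule wiener_grid_max(1)[OF W u l' n' r])
  have Emp: "prob (E m) \<le> 4 * exp (- r\<^sup>2 / (2 * l))" for m unfolding E_def
    using wiener_grid_max(2)[OF W u l' n' r, of m m] by simp
  have inc: "incseq E"
  proof (rule incseq_SucI)
    fix m
    show "E m \<le> E (Suc m)"
    proof
      fix \<omega> assume "\<omega> \<in> E m"
      then obtain i where i: "i \<le> 2^m" "r < \<bar>W (u + (l / 2^m) * real i) \<omega> - W u \<omega>\<bar>" and sp: "\<omega> \<in> space M"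
        unfolding E_def by auto
      have "(l / 2^m) * real i = (l / 2^Suc m) * real (2 * i)" by (simp add: field_simps)
      then show "\<omega> \<in> E (Suc m)" unfolding E_def using i sp by (auto intro!: exI[of _ "2 * i"])
    qed
  qed
  have lim: "(\<lambda>m. prob (E m)) \<longlonglongrightarrow> prob (\<Union>m. E m)"
    using Ems inc by (intro finite_Lim_measure_incseq) auto
  have 1: "(\<Union>m. E m) \<in> events" by (intro sets.countable_UN) (use Ems in blast)
  have 2: "prob (\<Union>m. E m) \<le> 4 * exp (- r\<^sup>2 / (2 * l))"
    using lim Emp by (intro LIMSEQ_le_const2) auto
  have "AE \<omega> in M. continuous_on {t0..} (\<lambda>t. W t \<omega>)" using W by (simp add: standard_wiener_def)
  then have 3: "AE \<omega> in M. \<omega> \<notin> (\<Union>m. E m) \<longrightarrow> (\<forall>v\<in>{u..u+l}. \<bar>W v \<omega> - W u \<omega>\<bar> \<le> r)"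
  proof (rule AE_mp, intro AE_I2 impI ballI)
    fix \<omega> v assume sp: "\<omega> \<in> space M" and c: "continuous_on {t0..} (\<lambda>t. W t \<omega>)"
      and nE: "\<omega> \<notin> (\<Union>m. E m)" and v: "v \<in> {u..u+l}"
    have "\<bar>W (u + l * ((v - u) / l)) \<omega> - W u \<omega>\<bar> \<le> r"
    proof (rule dyadic_bound_extends[where g="\<lambda>\<tau>. \<bar>W (u + l * \<tau>) \<omega> - W u \<omega>\<bar>"])
      show "continuous_on {0..1} (\<lambda>\<tau>. \<bar>W (u + l * \<tau>) \<omega> - W u \<omega>\<bar>)"
        using u l by (intro continuous_intros wiener_path_segment_continuous[OF c]) auto
      show "(v - u) / l \<in> {0..1}" using v l by (auto simp: field_simps)
      fix m i :: nat assume "i \<le> 2 ^ m"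
      then show "\<bar>W (u + l * (real i / 2 ^ m)) \<omega> - W u \<omega>\<bar> \<le> r"
        using nE sp unfolding E_def by (auto simp: not_less)
    qed
    then show "\<bar>W v \<omega> - W u \<omega>\<bar> \<le> r" using l by simp
  qed
  show thesis using that[OF 1 2 3] .
qed

text \<open>The noise scenario, on two consecutive blocks of length \<open>l\<close> after time \<open>u\<close>, that forces a path
through zero: a quiet first block, in which the cubic drift acts, and a deep fall in the second one.
All heights are measured in units of \<open>sqrt l\<close>, so that the probability of the scenario does not
depend on \<open>l\<close>.\<close>

definition noise_hit :: "(real \<Rightarrow> real) \<Rightarrow> real \<Rightarrow> real \<Rightarrow> real \<Rightarrow> bool" where
  "noise_hit w u l q \<longleftrightarrow>
     (\<forall>\<tau>\<in>{0..1}. \<bar>w (u + l * \<tau>) - w u\<bar> \<le> 3 * sqrt l) \<and>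
     (\<forall>\<tau>\<in>{0..1}. w (u + l + l * \<tau>) - w (u + l) \<le> 2 * q * sqrt l) \<and>
     w (u + l + l) - w (u + l) \<le> - q * sqrt l"

text \<open>A lower bound for the probability of the scenario: one half for the quiet block, times the
probability of a fall by \<open>q\<close> minus that of an excursion above \<open>2 q\<close>.\<close>

definition hit_prob :: "real \<Rightarrow> real" where
  "hit_prob q = (exp (- (q + 1)\<^sup>2 / 2) / 3 - 2 * exp (- 2 * q\<^sup>2)) / 2"

text \<open>From \<open>q = 3\<close> on, the excursion above \<open>2 q\<close> is much less likely than the fall by \<open>q\<close>.\<close>

lemma hit_prob_bounds:
  assumes "3 \<le> q"
  shows "0 < hit_prob q" "hit_prob q \<le> 1/2"
proof -
  have "(q + 1)\<^sup>2 \<le> (4/3 * q)\<^sup>2" using assms by (intro power_mono) auto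
  then have a: "(q + 1)\<^sup>2 / 2 \<le> 8/9 * q\<^sup>2" by (simp add: power2_eq_square)
  have "3\<^sup>2 \<le> q\<^sup>2" using assms by (intro power_mono) auto
  then have b: "- 2 * q\<^sup>2 \<le> - (q + 1)\<^sup>2 / 2 - 10" using a by simp
  have "(1 + 10 + 10\<^sup>2 / 2 :: real) \<le> exp 10" by (rule exp_lower_Taylor_quadratic) simp
  then have c: "7 < exp (10::real)" by simp
  have "exp (- 2 * q\<^sup>2) \<le> exp (- (q + 1)\<^sup>2 / 2 - 10)" using b by simp
  also have "\<dots> = exp (- (q + 1)\<^sup>2 / 2) / exp 10" by (simp add: exp_diff)
  also have "\<dots> < exp (- (q + 1)\<^sup>2 / 2) / 7" using c by (intro divide_strict_left_mono) auto
  finally have d: "exp (- 2 * q\<^sup>2) < exp (- (q + 1)\<^sup>2 / 2) / 7" .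
  have "0 < (x / 3 - 2 * y) / 2" if "y < x / 7" "0 < x" for x y :: real using that by simp
  from this[OF d exp_gt_zero] show "0 < hit_prob q" unfolding hit_prob_def .
  have "exp (- (q + 1)\<^sup>2 / 2) \<le> 1" by simp
  moreover have "(x / 3 - 2 * y) / 2 \<le> 1/2" if "x \<le> 1" "0 < y" for x y :: real using that by simp
  ultimately show "hit_prob q \<le> 1/2" unfolding hit_prob_def using exp_gt_zero by blast
qed

text \<open>On a fixed dyadic grid the scenarios of different pairs of blocks are independent, and the
maximal inequalities bound the probability of each from below uniformly in the mesh. Refining the grid
makes the scenarios more demanding, so the events of avoiding all of them increase to the event for the
continuous path.\<close>

lemma wiener_hit_avoidance:
  fixes n :: nat
  assumes W: "standard_wiener M t0 W" and v: "t0 \<le> v" and l: "0 < l" and q: "3 \<le> q"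
  obtains E where "E \<in> sets M" "measure M E \<le> (1 - hit_prob q) ^ n"
    "AE \<omega> in M. (\<forall>k<n. \<not> noise_hit (\<lambda>t. W t \<omega>) (v + 2 * l * real k) l q) \<longrightarrow> \<omega> \<in> E"
proof -
  interpret prob_space M using W by (simp add: standard_wiener_def)
  define u where "u k = v + 2 * l * real k" for k :: nat
  have ut: "t0 \<le> u k" for k using v l unfolding u_def by (intro add_increasing2) auto
  define H1 where "H1 m k \<omega> \<longleftrightarrow> (\<forall>i\<le>2^m. \<bar>W (u k + l / 2^m * real i) \<omega> - W (u k) \<omega>\<bar> \<le> 3 * sqrt l)"
    for m k :: nat and \<omega>
  define H2 where "H2 m k \<omega> \<longleftrightarrow> (\<forall>i\<le>2^m. W (u k + l + l / 2^m * real i) \<omega> - W (u k + l) \<omega> \<le> 2 * q * sqrt l)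
      \<and> W (u k + l + l) \<omega> - W (u k + l) \<omega> \<le> - q * sqrt l"
    for m k :: nat and \<omega>
  define E where "E m = {\<omega>\<in>space M. \<forall>k<n. \<not> (H1 m k \<omega> \<and> H2 m k \<omega>)}" for m
  have Wm: "W t \<in> borel_measurable M" if "t0 \<le> t" for t
    using W that by (simp add: standard_wiener_def)
  have Hm: "{\<omega>\<in>space M. H1 m k \<omega>} \<in> events" "{\<omega>\<in>space M. H2 m k \<omega>} \<in> events" for m k
  proof -
    have s: "t0 \<le> u k + l / 2 ^ m * real i" "t0 \<le> u k + l" "t0 \<le> u k + l + l" "t0 \<le> u k + l + l / 2 ^ m * real i" for i :: nat
      using ut[of k] l by (auto intro!: add_increasing2)
    have a: "{\<omega>\<in>space M. \<bar>W (u k + l / 2^m * real i) \<omega> - W (u k) \<omega>\<bar> \<le> 3 * sqrt l} \<in> events" for i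
      by (rule borel_measurable_le[OF borel_measurable_abs[OF borel_measurable_diff[OF Wm[OF s(1)] Wm[OF ut]]] borel_measurable_const])
    have b: "{\<omega>\<in>space M. W (u k + l + l / 2^m * real i) \<omega> - W (u k + l) \<omega> \<le> 2 * q * sqrt l} \<in> events" for i
      by (rule borel_measurable_le[OF borel_measurable_diff[OF Wm[OF s(4)] Wm[OF s(2)]] borel_measurable_const])
    have c: "{\<omega>\<in>space M. W (u k + l + l) \<omega> - W (u k + l) \<omega> \<le> - q * sqrt l} \<in> events"
      by (rule borel_measurable_le[OF borel_measurable_diff[OF Wm[OF s(3)] Wm[OF s(2)]] borel_measurable_const])
    have "{\<omega>\<in>space M. \<forall>i\<in>{..2^m}. \<bar>W (u k + l / 2^m * real i) \<omega> - W (u k) \<omega>\<bar> \<le> 3 * sqrt l} \<in> events"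
      by (rule sets.sets_Collect_finite_All) (rule a, simp)
    then show "{\<omega>\<in>space M. H1 m k \<omega>} \<in> events" unfolding H1_def Ball_def atMost_iff .
    have "{\<omega>\<in>space M. (\<forall>i\<in>{..2^m}. W (u k + l + l / 2^m * real i) \<omega> - W (u k + l) \<omega> \<le> 2 * q * sqrt l)
        \<and> W (u k + l + l) \<omega> - W (u k + l) \<omega> \<le> - q * sqrt l} \<in> events"
      by (rule sets.sets_Collect_conj[OF c sets.sets_Collect_finite_All]) (rule b, simp)
    then show "{\<omega>\<in>space M. H2 m k \<omega>} \<in> events" unfolding H2_def Ball_def atMost_iff .
  qed
  have Ems: "E m \<in> events" for m
  proof -
    have "{\<omega>\<in>space M. H1 m k \<omega> \<and> H2 m k \<omega>} \<in> events" for k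
      by (rule sets.sets_Collect_conj[OF Hm(2) Hm(1)])
    then have "{\<omega>\<in>space M. \<forall>k\<in>{..<n}. \<not> (H1 m k \<omega> \<and> H2 m k \<omega>)} \<in> events"
      by (intro sets.sets_Collect_finite_All[OF sets.sets_Collect_neg]) auto
    then show ?thesis unfolding E_def Ball_def lessThan_iff .
  qed
  have P1: "1/2 \<le> prob {\<omega>\<in>space M. H1 m k \<omega>}" for m k
  proof -
    have l': "0 < l / 2 ^ m" and n': "(0::nat) < 2 ^ m" and r: "0 \<le> 3 * sqrt l" using l by auto
    note g = wiener_grid_max[OF W ut[of k] l' n' r]
    have "{\<omega>\<in>space M. H1 m k \<omega>} = space M - {\<omega>\<in>space M. \<exists>i\<le>2^m. 3 * sqrt l < \<bar>W (u k + l / 2^m * real i) \<omega> - W (u k) \<omega>\<bar>}"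
      unfolding H1_def by (auto simp: not_less)
    then have "prob {\<omega>\<in>space M. H1 m k \<omega>} = 1 - prob {\<omega>\<in>space M. \<exists>i\<le>2^m. 3 * sqrt l < \<bar>W (u k + l / 2^m * real i) \<omega> - W (u k) \<omega>\<bar>}"
      using prob_compl[OF g(1)] by simp
    moreover have "4 * exp (- (3 * sqrt l)\<^sup>2 / (2 * (l / 2 ^ m * real (2 ^ m)))) \<le> 1/2"
    proof -
      have "- (3 * sqrt l)\<^sup>2 / (2 * (l / 2 ^ m * real (2 ^ m))) = - (9/2)"
        using l by (simp add: power_mult_distrib)
      moreover have "(1 + 9/2 + (9/2)\<^sup>2 / 2 :: real) \<le> exp (9/2)" by (rule exp_lower_Taylor_quadratic) simp
      then have "8 \<le> exp (9/2::real)" by (simp add: power2_eq_square)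
      then have "4 * exp (- (9/2)) \<le> 1/(2::real)" by (simp add: exp_minus field_simps)
      ultimately show ?thesis by (simp only:)
    qed
    ultimately show ?thesis using g(2) by linarith
  qed
  have P2: "2 * hit_prob q \<le> prob {\<omega>\<in>space M. H2 m k \<omega>}" for m k
  proof -
    have l': "0 < l / 2 ^ m" and n': "(0::nat) < 2 ^ m" and r: "0 \<le> 2 * q * sqrt l" using l q by auto
    have u': "t0 \<le> u k + l" using ut[of k] l by simp
    let ?A = "{\<omega>\<in>space M. W (u k + l + l) \<omega> - W (u k + l) \<omega> \<le> - q * sqrt l}"
    let ?B = "{\<omega>\<in>space M. \<exists>i\<le>2^m. 2 * q * sqrt l < W (u k + l + l / 2^m * real i) \<omega> - W (u k + l) \<omega>}"
    have "distributed M lborel (\<lambda>\<omega>. W (u k + l + l) \<omega> - W (u k + l) \<omega>) (normal_density 0 (sqrt (u k + l + l - (u k + l))))"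
    proof -
      have "u k + l < u k + l + l" using l by simp
      then show ?thesis using W u' unfolding standard_wiener_def by blast
    qed
    then have d: "distributed M lborel (\<lambda>\<omega>. W (u k + l + l) \<omega> - W (u k + l) \<omega>) (normal_density 0 (sqrt l))"
      by simp
    have A: "exp (- (q + 1)\<^sup>2 / 2) / 3 \<le> prob ?A"
      using normal_lower_tail[OF d, of q] l q by simp
    have B: "prob ?B \<le> 2 * exp (- 2 * q\<^sup>2)"
    proof -
      have "- (2 * q * sqrt l)\<^sup>2 / (2 * (l / 2 ^ m * real (2 ^ m))) = - 2 * q\<^sup>2"
        using l by (simp add: power_mult_distrib)
      then show ?thesis using wiener_grid_upper_max[OF W u' l' n' r] by simp
    qed
    have Bs: "?B \<in> events"
    proof -
      have a: "{\<omega>\<in>space M. 2 * q * sqrt l < W (u k + l + l / 2^m * real i) \<omega> - W (u k + l) \<omega>} \<in> events" for i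
      proof -
        have "t0 \<le> u k + l + l / 2^m * real i" using ut[of k] l by (intro add_increasing2) auto
        from borel_measurable_less[OF borel_measurable_const borel_measurable_diff[OF Wm[OF this] Wm[OF u']]]
        show ?thesis .
      qed
      have "{\<omega>\<in>space M. \<exists>i\<in>{..2^m}. 2 * q * sqrt l < W (u k + l + l / 2^m * real i) \<omega> - W (u k + l) \<omega>} \<in> events"
        by (rule sets.sets_Collect_finite_Ex) (rule a, simp)
      then show ?thesis unfolding Bex_def atMost_iff .
    qed
    have "?A \<subseteq> {\<omega>\<in>space M. H2 m k \<omega>} \<union> ?B" unfolding H2_def by (auto simp: not_less)
    then have "prob ?A \<le> prob ({\<omega>\<in>space M. H2 m k \<omega>} \<union> ?B)"
      by (rule finite_measure_mono[OF _ sets.Un[OF Hm(2) Bs]])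
    also have "\<dots> \<le> prob {\<omega>\<in>space M. H2 m k \<omega>} + prob ?B" by (rule measure_Un_le[OF Hm(2) Bs])
    finally show ?thesis using A B unfolding hit_prob_def by simp
  qed
  have Emp: "prob (E m) \<le> (1 - hit_prob q) ^ n" for m
  proof -
    define N where "N = (2::nat) ^ m"
    define h where "h = l / 2 ^ m"
    have hN: "h * real N = l" unfolding h_def N_def by simp
    have h0: "0 \<le> h" using l unfolding h_def by simp
    define X where "X i \<omega> = W (v + h * real (Suc i)) \<omega> - W (v + h * real i) \<omega>" for i :: nat and \<omega>
    have ind: "indep_vars (\<lambda>_. borel) X {..<n * (2 * N)}"
      unfolding X_def by (rule wiener_grid_increments[OF W v h0])
    have tel: "(\<Sum>r=i..<j. X r \<omega>) = W (v + h * real j) \<omega> - W (v + h * real i) \<omega>" if "i \<le> j" for i j \<omega>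
      using sum_Suc_diff'[OF that, of "\<lambda>k. W (v + h * real k) \<omega>"] unfolding X_def by simp
    have pos: "v + h * real (k * (2 * N) + i) = u k + h * real i"
      "v + h * real (k * (2 * N) + N + i) = u k + l + h * real i"
      "v + h * real (k * (2 * N)) = u k" "v + h * real (k * (2 * N) + N) = u k + l"
      "v + h * real (k * (2 * N) + N + N) = u k + l + l" for k i
      unfolding u_def hN[symmetric] by (simp_all add: algebra_simps)
    define Q1 where "Q1 k y \<longleftrightarrow> (\<forall>i\<in>{..N}. \<bar>\<Sum>r=k*(2*N)..<k*(2*N)+i. y r\<bar> \<le> 3 * sqrt l)" for k :: nat and y :: "nat \<Rightarrow> real"
    define Q2 where "Q2 k y \<longleftrightarrow> (\<forall>i\<in>{..N}. (\<Sum>r=k*(2*N)+N..<k*(2*N)+N+i. y r) \<le> 2 * q * sqrt l)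
        \<and> (\<Sum>r=k*(2*N)+N..<k*(2*N)+N+N. y r) \<le> - q * sqrt l" for k :: nat and y :: "nat \<Rightarrow> real"
    have s1: "(\<Sum>r=k*(2*N)..<k*(2*N)+i. X r \<omega>) = W (u k + h * real i) \<omega> - W (u k) \<omega>"
      and s2: "(\<Sum>r=k*(2*N)+N..<k*(2*N)+N+i. X r \<omega>) = W (u k + l + h * real i) \<omega> - W (u k + l) \<omega>"
      and s3: "(\<Sum>r=k*(2*N)+N..<k*(2*N)+N+N. X r \<omega>) = W (u k + l + l) \<omega> - W (u k + l) \<omega>" for k i \<omega>
      by (simp only: tel[OF le_add1] pos(1,3), simp only: tel[OF le_add1] pos(2,4), simp only: tel[OF le_add1] pos(4,5))
    have Q1H: "Q1 k (\<lambda>i. X i \<omega>) = H1 m k \<omega>" for k \<omega>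
      unfolding Q1_def H1_def s1 N_def[symmetric] h_def[symmetric] Ball_def atMost_iff ..
    have Q2H: "Q2 k (\<lambda>i. X i \<omega>) = H2 m k \<omega>" for k \<omega>
      unfolding Q2_def H2_def s3 unfolding s2 N_def[symmetric] h_def[symmetric] Ball_def atMost_iff ..
    have ms: "(\<lambda>y::nat\<Rightarrow>real. \<Sum>r=a..<b. y r) \<in> borel_measurable (PiM S (\<lambda>_. borel))" if "{a..<b} \<subseteq> S" for a b S
    proof (rule borel_measurable_sum[where f="\<lambda>k (y::nat\<Rightarrow>real). y k" and S="{a..<b}"])
      show "(\<lambda>y::nat\<Rightarrow>real. y k) \<in> borel_measurable (PiM S (\<lambda>_. borel))" if "k \<in> {a..<b}" for k
        using that \<open>{a..<b} \<subseteq> S\<close> by (intro measurable_component_singleton) auto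
    qed
    have mQ1: "Measurable.pred (PiM S (\<lambda>_. borel)) (Q1 k)" if "{k*(2*N)..<k*(2*N)+N} \<subseteq> S" for k S
    proof -
      have "Measurable.pred (PiM S (\<lambda>_. borel)) (\<lambda>y::nat\<Rightarrow>real. \<bar>\<Sum>r=k*(2*N)..<k*(2*N)+i. y r\<bar> \<le> 3 * sqrt l)" if "i \<in> {..N}" for i
        unfolding pred_def
        by (rule borel_measurable_le[OF borel_measurable_abs[OF ms] borel_measurable_const])
          (use that \<open>{k*(2*N)..<k*(2*N)+N} \<subseteq> S\<close> in auto)
      then show ?thesis unfolding Q1_def by (intro pred_intros_finite(3)) auto
    qed
    have mQ2: "Measurable.pred (PiM S (\<lambda>_. borel)) (Q2 k)" if "{k*(2*N)+N..<k*(2*N)+N+N} \<subseteq> S" for k S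
    proof -
      have a: "Measurable.pred (PiM S (\<lambda>_. borel)) (\<lambda>y::nat\<Rightarrow>real. (\<Sum>r=k*(2*N)+N..<k*(2*N)+N+i. y r) \<le> c)" if "i \<in> {..N}" for i c
        unfolding pred_def
        by (rule borel_measurable_le[OF ms borel_measurable_const])
          (use that \<open>{k*(2*N)+N..<k*(2*N)+N+N} \<subseteq> S\<close> in auto)
      then show ?thesis unfolding Q2_def by (intro pred_intros_logic(3) pred_intros_finite(3) a) auto
    qed
    have rs: "(\<Sum>r=a..<b. restrict y S r) = (\<Sum>r=a..<b. y r)" if "{a..<b} \<subseteq> S" for a b S and y :: "nat \<Rightarrow> real"
      using that by (intro sum.cong) auto
    have rQ1: "Q1 k (restrict y S) = Q1 k y" if "{k*(2*N)..<k*(2*N)+N} \<subseteq> S" for k S y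
    proof -
      have "(\<Sum>r=k*(2*N)..<k*(2*N)+i. restrict y S r) = (\<Sum>r=k*(2*N)..<k*(2*N)+i. y r)" if "i \<in> {..N}" for i
        using that \<open>{k*(2*N)..<k*(2*N)+N} \<subseteq> S\<close> by (intro rs) auto
      then show ?thesis unfolding Q1_def by (intro ball_cong) (simp_all only:)
    qed
    have rQ2: "Q2 k (restrict y S) = Q2 k y" if "{k*(2*N)+N..<k*(2*N)+N+N} \<subseteq> S" for k S y
    proof -
      have a: "(\<Sum>r=k*(2*N)+N..<k*(2*N)+N+i. restrict y S r) = (\<Sum>r=k*(2*N)+N..<k*(2*N)+N+i. y r)" if "i \<in> {..N}" for i
        using that \<open>{k*(2*N)+N..<k*(2*N)+N+N} \<subseteq> S\<close> by (intro rs) auto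
      then show ?thesis unfolding Q2_def by (intro arg_cong2[where f="(\<and>)"] ball_cong) (simp_all only: atMost_iff order_refl)
    qed
    have "prob {\<omega>\<in>space M. \<forall>k<n. \<not> (Q1 k (\<lambda>i. X i \<omega>) \<and> Q2 k (\<lambda>i. X i \<omega>))} \<le> (1 - hit_prob q) ^ n"
    proof (rule indep_blocks_avoid[OF ind, where H="\<lambda>k y. Q1 k y \<and> Q2 k y"])
      show "hit_prob q \<le> 1" using hit_prob_bounds[OF q] by simp
    next
      fix k assume "k < n"
      have s: "{k*(2*N)..<k*(2*N)+N} \<subseteq> {k*(2*N)..<(k+1)*(2*N)}" "{k*(2*N)+N..<k*(2*N)+N+N} \<subseteq> {k*(2*N)..<(k+1)*(2*N)}"
        by auto
      show "Measurable.pred (PiM {k*(2*N)..<(k+1)*(2*N)} (\<lambda>_. borel)) (\<lambda>y. Q1 k y \<and> Q2 k y)"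
        by (intro pred_intros_logic(3) mQ1 mQ2 s)
      show "(Q1 k (restrict y {k*(2*N)..<(k+1)*(2*N)}) \<and> Q2 k (restrict y {k*(2*N)..<(k+1)*(2*N)})) = (Q1 k y \<and> Q2 k y)" for y
        by (simp only: rQ1[OF s(1)] rQ2[OF s(2)])
      let ?A = "{k*(2*N)..<k*(2*N)+N}" and ?B = "{k*(2*N)+N..<k*(2*N)+N+N}"
      have "(k + 1) * (2 * N) \<le> n * (2 * N)" using \<open>k < n\<close> by (intro mult_le_mono1) simp
      then have AB: "?A \<inter> ?B = {}" "?A \<subseteq> {..<n*(2*N)}" "?B \<subseteq> {..<n*(2*N)}" by auto
      have "prob {\<omega>\<in>space M. Q1 k (\<lambda>i\<in>?A. X i \<omega>) \<and> Q2 k (\<lambda>i\<in>?B. X i \<omega>)}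
          = prob {\<omega>\<in>space M. Q1 k (\<lambda>i\<in>?A. X i \<omega>)} * prob {\<omega>\<in>space M. Q2 k (\<lambda>i\<in>?B. X i \<omega>)}"
        by (rule indep_coordinates_product[OF ind AB mQ1[OF order_refl] mQ2[OF order_refl]])
      then have "prob {\<omega>\<in>space M. Q1 k (\<lambda>i. X i \<omega>) \<and> Q2 k (\<lambda>i. X i \<omega>)}
          = prob {\<omega>\<in>space M. H1 m k \<omega>} * prob {\<omega>\<in>space M. H2 m k \<omega>}"
        by (simp only: rQ1[OF order_refl] rQ2[OF order_refl] Q1H Q2H)
      moreover have "1/2 * (2 * hit_prob q) \<le> prob {\<omega>\<in>space M. H1 m k \<omega>} * prob {\<omega>\<in>space M. H2 m k \<omega>}"
        using P1 P2 hit_prob_bounds[OF q] by (intro mult_mono) auto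
      ultimately show "hit_prob q \<le> prob {\<omega>\<in>space M. Q1 k (\<lambda>i. X i \<omega>) \<and> Q2 k (\<lambda>i. X i \<omega>)}" by simp
    qed
    then show ?thesis unfolding E_def Q1H Q2H .
  qed
  have dec: "H1 m k \<omega>" "H2 m k \<omega>" if "H1 (Suc m) k \<omega>" "H2 (Suc m) k \<omega>" for m k \<omega>
  proof -
    have e: "l / 2 ^ m * real i = l / 2 ^ Suc m * real (2 * i)" for i by (simp add: field_simps)
    have b: "2 * i \<le> 2 ^ Suc m" if "i \<le> 2 ^ m" for i :: nat using that by simp
    have "\<bar>W (u k + l / 2 ^ m * real i) \<omega> - W (u k) \<omega>\<bar> \<le> 3 * sqrt l" if "i \<le> 2 ^ m" for i
      using that(1) b[OF that] \<open>H1 (Suc m) k \<omega>\<close> unfolding H1_def by (simp only: e[of i])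
    then show "H1 m k \<omega>" unfolding H1_def by blast
    have "W (u k + l + l / 2 ^ m * real i) \<omega> - W (u k + l) \<omega> \<le> 2 * q * sqrt l" if "i \<le> 2 ^ m" for i
      using that(1) b[OF that] \<open>H2 (Suc m) k \<omega>\<close> unfolding H2_def by (simp only: e[of i])
    then show "H2 m k \<omega>" using that(2) unfolding H2_def by blast
  qed
  have anti: "H1 m k \<omega> \<and> H2 m k \<omega>" if "H1 m' k \<omega> \<and> H2 m' k \<omega>" "m \<le> m'" for m m' k \<omega>
    using that(2,1) by (induction m' rule: dec_induct) (use dec in blast)+
  have inc: "incseq E"
  proof (rule incseq_SucI)
    show "E m \<le> E (Suc m)" for m unfolding E_def using anti[of "Suc m" _ _ m] by auto
  qed
  have lim: "(\<lambda>m. prob (E m)) \<longlonglongrightarrow> prob (\<Union>m. E m)"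
    using Ems inc by (intro finite_Lim_measure_incseq) auto
  have 1: "(\<Union>m. E m) \<in> events" by (intro sets.countable_UN) (use Ems in blast)
  have 2: "prob (\<Union>m. E m) \<le> (1 - hit_prob q) ^ n"
    using lim Emp by (intro LIMSEQ_le_const2) auto
  have "AE \<omega> in M. continuous_on {t0..} (\<lambda>t. W t \<omega>)" using W by (simp add: standard_wiener_def)
  then have 3: "AE \<omega> in M. (\<forall>k<n. \<not> noise_hit (\<lambda>t. W t \<omega>) (v + 2 * l * real k) l q) \<longrightarrow> \<omega> \<in> (\<Union>m. E m)"
  proof (rule AE_mp, intro AE_I2 impI)
    fix \<omega> assume sp: "\<omega> \<in> space M" and c: "continuous_on {t0..} (\<lambda>t. W t \<omega>)"
      and nh: "\<forall>k<n. \<not> noise_hit (\<lambda>t. W t \<omega>) (v + 2 * l * real k) l q"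
    have ex: "\<exists>m. \<not> (H1 m k \<omega> \<and> H2 m k \<omega>)" if k: "k < n" for k
    proof (rule ccontr)
      assume "\<not> ?thesis"
      then have all: "H1 m k \<omega>" "H2 m k \<omega>" for m by auto
      have u': "t0 \<le> u k + l" using ut[of k] l by simp
      have c1: "continuous_on {0..1} (\<lambda>\<tau>. W (u k + l * \<tau>) \<omega>)"
        by (rule wiener_path_segment_continuous[OF c ut]) (use l in simp)
      have c2: "continuous_on {0..1} (\<lambda>\<tau>. W (u k + l + l * \<tau>) \<omega>)"
        by (rule wiener_path_segment_continuous[OF c u']) (use l in simp)
      have "\<bar>W (u k + l * \<tau>) \<omega> - W (u k) \<omega>\<bar> \<le> 3 * sqrt l" if "\<tau> \<in> {0..1}" for \<tau>
      proof (rule dyadic_bound_extends[where g="\<lambda>\<tau>. \<bar>W (u k + l * \<tau>) \<omega> - W (u k) \<omega>\<bar>", OF _ _ that])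
        show "continuous_on {0..1} (\<lambda>\<tau>. \<bar>W (u k + l * \<tau>) \<omega> - W (u k) \<omega>\<bar>)"
          by (intro continuous_intros c1)
        show "\<bar>W (u k + l * (real i / 2 ^ m)) \<omega> - W (u k) \<omega>\<bar> \<le> 3 * sqrt l" if "i \<le> 2 ^ m" for m i
          using all(1)[of m] that unfolding H1_def by simp
      qed
      moreover have "W (u k + l + l * \<tau>) \<omega> - W (u k + l) \<omega> \<le> 2 * q * sqrt l" if "\<tau> \<in> {0..1}" for \<tau>
      proof (rule dyadic_bound_extends[where g="\<lambda>\<tau>. W (u k + l + l * \<tau>) \<omega> - W (u k + l) \<omega>", OF _ _ that])
        show "continuous_on {0..1} (\<lambda>\<tau>. W (u k + l + l * \<tau>) \<omega> - W (u k + l) \<omega>)"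
          by (intro continuous_intros c2)
        show "W (u k + l + l * (real i / 2 ^ m)) \<omega> - W (u k + l) \<omega> \<le> 2 * q * sqrt l" if "i \<le> 2 ^ m" for m i
          using all(2)[of m] that unfolding H2_def by simp
      qed
      moreover have "W (u k + l + l) \<omega> - W (u k + l) \<omega> \<le> - q * sqrt l"
        using all(2)[of 0] unfolding H2_def by simp
      ultimately have "noise_hit (\<lambda>t. W t \<omega>) (u k) l q" unfolding noise_hit_def by blast
      then show False using nh k unfolding u_def by blast
    qed
    have "eventually (\<lambda>m. \<forall>k\<in>{..<n}. \<not> (H1 m k \<omega> \<and> H2 m k \<omega>)) sequentially"
    proof (rule eventually_ball_finite)
      show "\<forall>k\<in>{..<n}. eventually (\<lambda>m. \<not> (H1 m k \<omega> \<and> H2 m k \<omega>)) sequentially"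
      proof
        fix k assume "k \<in> {..<n}"
        then obtain m where m: "\<not> (H1 m k \<omega> \<and> H2 m k \<omega>)" using ex by auto
        show "eventually (\<lambda>m. \<not> (H1 m k \<omega> \<and> H2 m k \<omega>)) sequentially"
          unfolding eventually_sequentially using m anti by blast
      qed
    qed simp
    then obtain m where "\<forall>k\<in>{..<n}. \<not> (H1 m k \<omega> \<and> H2 m k \<omega>)"
      unfolding eventually_sequentially by blast
    then show "\<omega> \<in> (\<Union>m. E m)" unfolding E_def using sp by auto
  qed
  show thesis using that[OF 1 2 3] .
qed

section \<open>Scalar comparison principles\<close>

lemma first_passage:
  fixes \<phi> :: "real \<Rightarrow> real"
  assumes c: "continuous_on {p..q} \<phi>" and "p \<le> q" and "\<phi> p < l" and "l \<le> \<phi> q"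
  obtains t where "p < t" "t \<le> q" "\<phi> t = l" "\<And>u. p \<le> u \<Longrightarrow> u < t \<Longrightarrow> \<phi> u < l"
proof -
  define S where "S = {t\<in>{p..q}. l \<le> \<phi> t}"
  have "S = {p..q} \<inter> \<phi> -` {l..}" unfolding S_def by auto
  then have "closed S"
    using continuous_closed_preimage[OF c closed_real_atLeastAtMost closed_atLeast[of l]] by simp
  moreover have "bounded S"
    by (rule bounded_subset[OF bounded_closed_interval[of p q]]) (auto simp: S_def)
  ultimately have "compact S" by (simp add: compact_eq_bounded_closed)
  moreover have "q \<in> S" using assms unfolding S_def by simp
  ultimately obtain t where t: "t \<in> S" "\<And>u. u \<in> S \<Longrightarrow> t \<le> u"
    using compact_attains_inf[of S] by blast
  have tq: "p \<le> t" "t \<le> q" "l \<le> \<phi> t" using t(1) unfolding S_def by auto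
  have lt: "\<phi> u < l" if "p \<le> u" "u < t" for u
    using t(2)[of u] that tq unfolding S_def by force
  have "p \<noteq> t" using tq \<open>\<phi> p < l\<close> by auto
  then have "p < t" using tq by simp
  have "\<phi> t \<le> l"
  proof (rule ccontr)
    assume "\<not> \<phi> t \<le> l"
    then have "l \<le> \<phi> t" "\<phi> p \<le> l" using assms by auto
    then obtain u where "p \<le> u" "u \<le> t" "\<phi> u = l"
      using IVT'[of \<phi> p l t] continuous_on_subset[OF c, of "{p..t}"] tq by auto
    then show False using lt[of u] \<open>\<not> \<phi> t \<le> l\<close> by (cases "u = t") auto
  qed
  then show thesis using that[of t] \<open>p < t\<close> tq lt by auto
qed

text \<open>A function that is increasing wherever it vanishes cannot become negative. All
comparisons with sub- and supersolutions below are instances.\<close>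

lemma barrier_nonneg:
  fixes D :: "real \<Rightarrow> real"
  assumes D: "\<And>t. t \<in> {p..q} \<Longrightarrow> (D has_real_derivative D' t) (at t within {p..q})"
    and "0 \<le> D p" and pos: "\<And>t. t \<in> {p..q} \<Longrightarrow> D t = 0 \<Longrightarrow> 0 < D' t"
    and t: "t \<in> {p..q}"
  shows "0 \<le> D t"
proof (rule ccontr)
  assume neg: "\<not> 0 \<le> D t"
  have c: "continuous_on {p..q} D"
    by (rule DERIV_continuous_on[OF D])
  define S where "S = {u\<in>{p..t}. 0 \<le> D u}"
  have c': "continuous_on {p..t} D" using continuous_on_subset[OF c] t by auto
  have "S = {p..t} \<inter> D -` {0..}" unfolding S_def by auto
  then have "closed S"
    using continuous_closed_preimage[OF c' closed_real_atLeastAtMost closed_atLeast[of 0]] by simp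
  moreover have "bounded S"
    by (rule bounded_subset[OF bounded_closed_interval[of p t]]) (auto simp: S_def)
  ultimately have "compact S" by (simp add: compact_eq_bounded_closed)
  moreover have "p \<in> S" using assms(2) t unfolding S_def by simp
  ultimately obtain z where z: "z \<in> S" "\<And>u. u \<in> S \<Longrightarrow> u \<le> z"
    using compact_attains_sup[of S] by blast
  have zt: "p \<le> z" "z \<le> t" "0 \<le> D z" using z(1) unfolding S_def by auto
  have lt: "D u < 0" if "z < u" "u \<le> t" for u
    using z(2)[of u] that zt unfolding S_def by force
  have "z \<noteq> t" using zt neg by auto
  then have zt': "z < t" using zt by simp
  have "D z = 0"
  proof (rule ccontr)
    assume "D z \<noteq> 0"
    then have "0 < D z" using zt by simp
    moreover have "continuous_on {z..t} D" by (rule continuous_on_subset[OF c']) (use zt in auto)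
    ultimately obtain u where "z \<le> u" "u \<le> t" "D u = 0"
      using IVT2'[of D t 0 z] neg zt by auto
    then show False using lt[of u] \<open>0 < D z\<close> by (cases "u = z") auto
  qed
  have zin: "z \<in> {p..q}" using zt t by auto
  obtain e where e: "0 < e" "\<And>h. 0 < h \<Longrightarrow> z + h \<in> {p..q} \<Longrightarrow> h < e \<Longrightarrow> D z < D (z + h)"
    using has_real_derivative_pos_inc_right[OF D[OF zin] pos[OF zin \<open>D z = 0\<close>]] by blast
  define h where "h = min (e / 2) (t - z)"
  have h: "0 < h" "h < e" "z + h \<le> t" using e(1) zt' unfolding h_def by (auto simp: min_def)
  have "D z < D (z + h)" using e(2)[of h] h zt t by auto
  moreover have "D (z + h) < 0" using lt[of "z + h"] h by simp
  ultimately show False using \<open>D z = 0\<close> by simp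
qed

lemma nonincreasing_within:
  fixes f :: "real \<Rightarrow> real"
  assumes "a \<le> b" and f: "\<And>x. x \<in> {a..b} \<Longrightarrow> (f has_real_derivative f' x) (at x within {a..b})"
    and n: "\<And>x. a < x \<Longrightarrow> x < b \<Longrightarrow> f' x \<le> 0"
  shows "f b \<le> f a"
proof (rule DERIV_nonpos_imp_decreasing_open[OF \<open>a \<le> b\<close>])
  fix x assume x: "a < x" "x < b"
  then have "(f has_real_derivative f' x) (at x)"
    using f[of x] at_within_Icc_at[of a x b] by simp
  then show "\<exists>y. (f has_real_derivative y) (at x) \<and> y \<le> 0" using n[OF x] by blast
next
  show "continuous_on {a..b} f"
    by (rule DERIV_continuous_on[OF f])
qed

text \<open>\<open>Y\<close> is a path from which the noise \<open>n\<close> has been subtracted; this makes it differentiable, so that the linear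
stochastic equation is compared without any stochastic integral. The noise enters through its
size \<open>\<eta>\<close> only.\<close>

lemma noisy_gronwall:
  fixes Y g n :: "real \<Rightarrow> real"
  assumes uv: "u \<le> v" and g: "continuous_on {u..v} g"
    and Y: "\<And>r. r \<in> {u..v} \<Longrightarrow> (Y has_real_derivative Y' r) (at r within {u..v})"
    and le: "\<And>r. r \<in> {u..v} \<Longrightarrow> Y' r \<le> g r * (Y r + n r)"
    and n: "\<And>r. r \<in> {u..v} \<Longrightarrow> \<bar>n r\<bar> \<le> \<eta>"
    and C: "\<And>r. r \<in> {u..v} \<Longrightarrow> exp (integral {r..v} g) \<le> C"
    and I: "integral {u..v} (\<lambda>r. \<bar>g r\<bar>) \<le> I"
  shows "Y v \<le> exp (integral {u..v} g) * Y u + \<eta> * C * I"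
proof -
  define G where "G r = integral {u..r} g" for r
  define J where "J r = integral {u..r} (\<lambda>r. \<bar>g r\<bar>)" for r
  have gi: "g integrable_on {u..v}" using g by (rule integrable_continuous_real)
  have G: "(G has_real_derivative g r) (at r within {u..v})" if "r \<in> {u..v}" for r
    unfolding G_def using integral_has_real_derivative[OF g that] .
  have J: "(J has_real_derivative \<bar>g r\<bar>) (at r within {u..v})" if "r \<in> {u..v}" for r
    unfolding J_def using integral_has_real_derivative[OF continuous_on_rabs[OF g] that] .
  have Gv: "integral {r..v} g = G v - G r" if "r \<in> {u..v}" for r
    using Henstock_Kurzweil_Integration.integral_combine[of u r v g] that gi unfolding G_def by auto
  have G0: "G u = 0" "J u = 0" unfolding G_def J_def by auto
  have eta0: "0 \<le> \<eta>" using n[of u] uv by auto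
  have C0: "0 < C" using C[of v] uv by simp
  \<comment> \<open>The correction term makes the function nonincreasing: \<open>exp (- G r) \<le> C exp (- G v)\<close>.\<close>
  define Z where "Z r = exp (- G r) * Y r - \<eta> * C * exp (- G v) * J r" for r
  have Z: "(Z has_real_derivative
      (exp (- G r) * Y' r + - g r * exp (- G r) * Y r) - \<eta> * C * exp (- G v) * \<bar>g r\<bar>) (at r within {u..v})"
    if "r \<in> {u..v}" for r
    unfolding Z_def
    by (auto intro!: derivative_eq_intros G[OF that] Y[OF that] J[OF that])
  have "Z v \<le> Z u"
  proof (rule nonincreasing_within[OF uv Z])
    fix r assume "u < r" "r < v"
    then have r: "r \<in> {u..v}" by auto
    have "Y' r - g r * Y r \<le> g r * n r" using le[OF r] by (simp add: algebra_simps)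
    also have "\<dots> \<le> \<bar>g r\<bar> * \<eta>"
    proof -
      have "g r * n r \<le> \<bar>g r\<bar> * \<bar>n r\<bar>" by (metis abs_ge_self abs_mult)
      also have "\<dots> \<le> \<bar>g r\<bar> * \<eta>" using n[OF r] by (intro mult_left_mono) auto
      finally show ?thesis .
    qed
    finally have 1: "exp (- G r) * (Y' r - g r * Y r) \<le> exp (- G r) * (\<bar>g r\<bar> * \<eta>)"
      by (intro mult_left_mono) auto
    have "exp (- G r) = exp (- G v) * exp (G v - G r)" by (simp add: exp_add[symmetric])
    also have "\<dots> \<le> exp (- G v) * C" using C[OF r] Gv[OF r] by (intro mult_left_mono) auto
    finally have "exp (- G r) * (\<bar>g r\<bar> * \<eta>) \<le> exp (- G v) * C * (\<bar>g r\<bar> * \<eta>)"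
      using eta0 by (intro mult_right_mono) auto
    with 1 show "exp (- G r) * Y' r + - g r * exp (- G r) * Y r - \<eta> * C * exp (- G v) * \<bar>g r\<bar> \<le> 0"
      by (simp add: algebra_simps)
  qed auto
  then have "exp (- G v) * Y v \<le> Y u + \<eta> * C * exp (- G v) * J v"
    unfolding Z_def G0 by simp
  then have "exp (G v) * (exp (- G v) * Y v) \<le> exp (G v) * (Y u + \<eta> * C * exp (- G v) * J v)"
    by (intro mult_left_mono) auto
  also have "\<dots> = exp (G v) * Y u + \<eta> * C * J v"
    by (simp add: algebra_simps exp_minus)
  also have "exp (G v) * (exp (- G v) * Y v) = Y v" by (simp add: exp_minus)
  also have "\<eta> * C * J v \<le> \<eta> * C * I"
    using I eta0 C0 unfolding J_def by (intro mult_left_mono) auto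
  finally show ?thesis unfolding G_def by simp
qed

section \<open>Tracking of the stable equilibrium branch\<close>

text \<open>The properties of the drift at one value \<open>r\<close> of the small parameter that the analysis uses, with all
constants as parameters: \<open>X\<close> is the equilibrium branch, \<open>\<tau>\<close> and \<open>x1\<close> delimit the region around the origin
in which the third derivative is close to its value at the origin, and \<open>tangent\<close>
expresses concavity on \<open>[0,\<delta>]\<close>.\<close>

locale slice =
  fixes F ft :: "real \<Rightarrow> real \<Rightarrow> real" and X :: "real \<Rightarrow> real"
    and d T r \<delta> B \<tau> x1 c A m k :: real
  assumes pos: "0 < d" "0 < T" "0 < r" "0 < \<delta>" "\<delta> \<le> d" "0 < B" "0 < \<tau>" "\<tau> < T" "0 < x1" "x1 \<le> \<delta>"
      "0 < c" "0 < A" "0 < m" "0 < k"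
    and r_small: "sqrt r \<le> \<tau>"
    and F_derivative: "\<And>x t. x \<in> {-d..d} \<Longrightarrow>
      ((\<lambda>(x, t). F x t) has_derivative (\<lambda>v. ddx d F x t * fst v + ft x t * snd v)) (at (x, t) within {-d..d} \<times> UNIV)"
    and fx_bound: "\<And>x t. x \<in> {-d..d} \<Longrightarrow> \<bar>ddx d F x t\<bar> \<le> B"
    and ft_bound: "\<And>x t. x \<in> {-d..d} \<Longrightarrow> \<bar>ft x t\<bar> \<le> B"
    and fx_lipschitz: "\<And>x y t. x \<in> {-d..d} \<Longrightarrow> y \<in> {-d..d} \<Longrightarrow> \<bar>ddx d F x t - ddx d F y t\<bar> \<le> B * \<bar>x - y\<bar>"
    and fx_continuous: "continuous_on ({-d..d} \<times> UNIV) (\<lambda>(x, t). ddx d F x t)"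
    and F_zero: "\<And>t. F 0 t = 0"
    and tangent: "\<And>x y t. x \<in> {0..\<delta>} \<Longrightarrow> y \<in> {0..\<delta>} \<Longrightarrow> \<bar>t\<bar> \<le> T \<Longrightarrow> F y t \<le> F x t + ddx d F x t * (y - x)"
    and cubic: "\<And>x t. x \<in> {0..\<delta>} \<Longrightarrow> \<bar>t\<bar> \<le> \<tau> \<Longrightarrow> F x t \<le> ddx d F 0 t * x - c * x ^ 3"
    and slope: "\<And>x t. x \<in> {0..x1} \<Longrightarrow> \<bar>t\<bar> \<le> \<tau> \<Longrightarrow> x * ddx d F x t \<le> F x t - c * x ^ 3"
    and quad: "\<And>x t. x \<in> {-d..d} \<Longrightarrow> \<bar>t\<bar> \<le> T \<Longrightarrow> \<bar>ddx d F x t - ddx d F 0 t\<bar> \<le> B * x\<^sup>2"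
    and a_pos: "\<And>t. 0 < ddx d F 0 t"
    and a_upper: "\<And>t. \<bar>t\<bar> \<le> T \<Longrightarrow> ddx d F 0 t \<le> A * max r (t\<^sup>2)"
    and X_cont: "continuous_on UNIV X"
    and X_range: "\<And>t. 0 < X t" "\<And>t. X t \<le> d"
    and X_zero: "\<And>t. F (X t) t = 0"
    and F_pos: "\<And>x t. 0 < x \<Longrightarrow> x < X t \<Longrightarrow> 0 < F x t"
    and X_lower: "\<And>t. sqrt r \<le> \<bar>t\<bar> \<Longrightarrow> \<bar>t\<bar> \<le> T \<Longrightarrow> m * \<bar>t\<bar> \<le> X t"
    and X_upper: "\<And>t. sqrt r \<le> \<bar>t\<bar> \<Longrightarrow> \<bar>t\<bar> \<le> T \<Longrightarrow> X t \<le> A * \<bar>t\<bar>"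
    and X_slope: "\<And>t. sqrt r \<le> \<bar>t\<bar> \<Longrightarrow> \<bar>t\<bar> \<le> T \<Longrightarrow> ddx d F (X t) t \<le> - k * t\<^sup>2"
begin

lemma F_x_derivative:
  assumes "x \<in> {-d..d}"
  shows "((\<lambda>y. F y t) has_real_derivative ddx d F x t) (at x within {-d..d})"
proof -
  have g: "((\<lambda>y. (y, t)) has_derivative (\<lambda>v. (v, 0))) (at x within {-d..d})"
    by (auto intro!: derivative_eq_intros)
  have "((\<lambda>(x, t). F x t) has_derivative (\<lambda>v. ddx d F x t * fst v + ft x t * snd v)) (at (x, t) within (\<lambda>y. (y, t)) ` {-d..d})"
    by (rule has_derivative_subset[OF F_derivative[OF assms]]) auto
  from has_derivative_in_compose[OF g this]
  show ?thesis by (simp add: has_field_derivative_def)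
qed

lemma F_mean_value:
  assumes "x \<in> {-d..d}" "y \<in> {-d..d}" "x \<le> y"
  obtains z where "z \<in> {x..y}" "F y t - F x t = ddx d F z t * (y - x)"
proof (cases "x = y")
  case True then show thesis using that[of x] by simp
next
  case False
  then have xy: "x < y" using assms by simp
  have sub: "{x..y} \<subseteq> {-d..d}" using assms by auto
  have "((\<lambda>y. F y t) has_derivative (\<lambda>h. h * ddx d F z t)) (at z within {x..y})" if "x \<le> z" "z \<le> y" for z
    using has_field_derivative_subset[OF F_x_derivative[of z t] sub] that assms
    by (simp add: has_field_derivative_def mult.commute[of _ "ddx d F z t"])
  from mvt_very_simple[OF less_imp_le[OF xy], of "\<lambda>y. F y t" "\<lambda>z h. h * ddx d F z t", OF this]
  obtain z where "z \<in> {x..y}" "F y t - F x t = (y - x) * ddx d F z t" by auto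
  then show thesis using that[of z] by (simp add: mult.commute)
qed

lemma F_lipschitz:
  assumes "x \<in> {-d..d}" "y \<in> {-d..d}"
  shows "\<bar>F x t - F y t\<bar> \<le> B * \<bar>x - y\<bar>"
proof -
  have *: "\<bar>F y t - F x t\<bar> \<le> B * (y - x)" if xy: "x \<in> {-d..d}" "y \<in> {-d..d}" "x \<le> y" for x y
  proof -
    obtain z where z: "z \<in> {x..y}" "F y t - F x t = ddx d F z t * (y - x)" by (rule F_mean_value[OF xy])
    have "\<bar>ddx d F z t\<bar> \<le> B" using fx_bound[of z t] z(1) xy by auto
    then show ?thesis using z(2) xy by (simp add: abs_mult mult_right_mono)
  qed
  show ?thesis using *[of x y] *[of y x] assms by (cases "x \<le> y") (auto simp: abs_minus_commute)
qed

lemma F_continuous: "continuous_on ({-d..d} \<times> UNIV) (\<lambda>(x, t). F x t)"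
proof -
  have "continuous (at p within {-d..d} \<times> UNIV) (\<lambda>(x, t). F x t)" if "p \<in> {-d..d} \<times> UNIV" for p
  proof -
    obtain x t where p: "p = (x, t)" by (cases p)
    show ?thesis using has_derivative_continuous[OF F_derivative[of x t]] that unfolding p by auto
  qed
  then show ?thesis by (simp add: continuous_on_eq_continuous_within)
qed

text \<open>The derivative is taken within the time interval, because \<open>x\<close> is allowed to run along
the boundary of the strip, where \<open>F\<close> has one-sided derivatives only.\<close>

lemma F_along_derivative:
  assumes x: "\<And>u. u \<in> S \<Longrightarrow> x u \<in> {-d..d}" and t: "t \<in> S" and dx: "(x has_real_derivative v) (at t within S)"
  shows "((\<lambda>u. F (x u) u) has_real_derivative ddx d F (x t) t * v + ft (x t) t) (at t within S)"
proof -
  have g: "((\<lambda>u. (x u, u)) has_derivative (\<lambda>h. (v * h, h))) (at t within S)"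
    using dx by (auto intro!: has_derivative_Pair simp: has_field_derivative_def)
  have "((\<lambda>(x, t). F x t) has_derivative (\<lambda>v. ddx d F (x t) t * fst v + ft (x t) t * snd v)) (at (x t, t) within (\<lambda>u. (x u, u)) ` S)"
    by (rule has_derivative_subset[OF F_derivative[OF x[OF t]]]) (use x in auto)
  from has_derivative_in_compose[OF g this]
  have 1: "((\<lambda>u. F (x u) u) has_derivative (\<lambda>h. ddx d F (x t) t * (v * h) + ft (x t) t * h)) (at t within S)"
    by simp
  have "(\<lambda>h. ddx d F (x t) t * (v * h) + ft (x t) t * h) = (*) (ddx d F (x t) t * v + ft (x t) t)"
    by (rule ext) (simp add: algebra_simps)
  with 1 show ?thesis by (simp only: has_field_derivative_def)
qed

end

text \<open>The deterministic solution on top of a slice. \<open>K\<close> is the constant of the tracking estimate; the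
conditions \<open>eps_small\<close> are the ones that "for sufficiently small \<open>\<epsilon>\<close>" refers to.\<close>

locale det_slice = slice +
  fixes \<epsilon> :: real and xdet :: "real \<Rightarrow> real" and p K :: real
  assumes eps: "0 < \<epsilon>"
    and det: "det_solution F d T \<epsilon> xdet"
    and start: "\<bar>xdet (- T) - X (- T)\<bar> \<le> p * \<epsilon>" and p: "0 < p"
    and K: "K * (k * \<tau>\<^sup>2) > 4 * B / (k * \<tau>\<^sup>2)" "K * (k * \<tau>\<^sup>2) \<ge> 2 * B * p"
    and eps_small: "2 * K * \<epsilon> < k * \<tau>\<^sup>2 / (2 * B)" "K * \<epsilon> \<le> A * \<tau>" "2 * K * \<epsilon> \<le> m * \<tau>" 
begin

abbreviation (input) "\<mu> \<equiv> k * \<tau>\<^sup>2"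

lemma xdet_range: "t \<in> {-T..T} \<Longrightarrow> xdet t \<in> {-d..d}"
  using det by (auto simp: det_solution_def)

lemma xdet_derivative: "t \<in> {-T..T} \<Longrightarrow> (xdet has_real_derivative F (xdet t) t / \<epsilon>) (at t within {-T..T})"
  using det by (auto simp: det_solution_def)

lemma xdet_derivative_sub:
  "{u..v} \<subseteq> {-T..T} \<Longrightarrow> t \<in> {u..v} \<Longrightarrow> (xdet has_real_derivative F (xdet t) t / \<epsilon>) (at t within {u..v})"
  using has_field_derivative_subset[OF xdet_derivative] by blast

lemma xdet_continuous: "continuous_on {-T..T} xdet"
  by (rule DERIV_continuous_on[OF xdet_derivative])

lemma slope_near_X:
  assumes t: "\<tau> \<le> \<bar>t\<bar>" "\<bar>t\<bar> \<le> T" and x: "x \<in> {-d..d}" "\<bar>x - X t\<bar> \<le> \<mu> / (2 * B)"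
  shows "ddx d F x t \<le> - \<mu> / 2"
proof -
  have "\<tau>\<^sup>2 \<le> \<bar>t\<bar>\<^sup>2" using t pos by (intro power_mono) auto
  then have "\<mu> \<le> k * t\<^sup>2" using pos by simp
  moreover have "ddx d F (X t) t \<le> - k * t\<^sup>2" using X_slope[of t] t r_small by simp
  ultimately have 1: "ddx d F (X t) t \<le> - \<mu>" by simp
  have "X t \<in> {-d..d}" using X_range[of t] pos by auto
  then have "\<bar>ddx d F x t - ddx d F (X t) t\<bar> \<le> B * \<bar>x - X t\<bar>" using fx_lipschitz x by blast
  also have "\<dots> \<le> B * (\<mu> / (2 * B))" using x pos by (intro mult_left_mono) auto
  also have "\<dots> = \<mu> / 2" using pos by simp
  finally show ?thesis using 1 by linarith
qed

lemma mu_pos: "0 < \<mu>" using pos by simp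

lemma K_pos: "0 < K"
proof -
  have "0 < 4 * B / \<mu>" using pos by simp
  then have "0 < K * \<mu>" using K(1) by linarith
  then show ?thesis using mu_pos by (simp add: zero_less_mult_iff)
qed

text \<open>Not the distance to \<open>X\<close> is estimated but \<open>g = F(xdet,t)\<close>, which is differentiable whereas
\<open>X\<close> is merely continuous: \<open>g' = (F\<^sub>x g)/\<epsilon> + F\<^sub>t\<close> with \<open>F\<^sub>x \<le> -\<mu>/2\<close> near the branch, so \<open>g\<close> stays of order \<open>\<epsilon>\<close>, and by the
slope so does the distance.\<close>

lemma tracking_upto:
  assumes v: "-T \<le> v" "v \<le> -\<tau>" and near: "\<And>u. u \<in> {-T..v} \<Longrightarrow> \<bar>xdet u - X u\<bar> \<le> \<mu> / (2 * B)"
    and u: "u \<in> {-T..v}"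
  shows "\<bar>xdet u - X u\<bar> \<le> K * \<epsilon>"
proof -
  define g where "g u = F (xdet u) u" for u
  have sub: "{-T..v} \<subseteq> {-T..T}" using v pos by auto
  have in1: "z \<in> {-T..T}" if "z \<in> {-T..v}" for z using that sub by auto
  define g' where "g' z = ddx d F (xdet z) z * (F (xdet z) z / \<epsilon>) + ft (xdet z) z" for z
  have g: "(g has_real_derivative g' z) (at z within {-T..v})" if "z \<in> {-T..v}" for z
    unfolding g_def g'_def
    by (rule F_along_derivative[OF xdet_range[OF in1] that xdet_derivative_sub[OF sub that]])
  have sl: "ddx d F (xdet z) z \<le> - \<mu> / 2" if "z \<in> {-T..v}" for z
  proof (rule slope_near_X)
    show "\<tau> \<le> \<bar>z\<bar>" "\<bar>z\<bar> \<le> T" using that v pos by auto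
    show "xdet z \<in> {-d..d}" using xdet_range[OF in1[OF that]] .
    show "\<bar>xdet z - X z\<bar> \<le> \<mu> / (2 * B)" using near[OF that] .
  qed
  have XT: "X z \<in> {-d..d}" for z using X_range[of z] pos by auto
  define K1 where "K1 = K * \<mu> / 2"
  have Tin: "-T \<in> {-T..v}" using v by simp
  have g0: "\<bar>g (-T)\<bar> \<le> K1 * \<epsilon>"
  proof -
    have "\<bar>g (-T)\<bar> = \<bar>F (xdet (-T)) (-T) - F (X (-T)) (-T)\<bar>" unfolding g_def by (simp add: X_zero)
    also have "\<dots> \<le> B * \<bar>xdet (-T) - X (-T)\<bar>" by (rule F_lipschitz[OF xdet_range[OF in1[OF Tin]] XT])
    also have "\<dots> \<le> B * (p * \<epsilon>)" using start pos by (intro mult_left_mono) auto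
    also have "\<dots> \<le> K1 * \<epsilon>" using K(2) eps unfolding K1_def by (simp add: mult.assoc[symmetric] mult_right_mono)
    finally show ?thesis .
  qed
  have K1: "B < \<mu> / 2 * K1"
  proof -
    have "B = y / 4 * (4 * B / y)" if "0 < y" for y :: real using that by simp
    from this[OF mu_pos] have "B = \<mu> / 4 * (4 * B / \<mu>)" .
    also have "\<dots> < \<mu> / 4 * (K * \<mu>)" using K(1) mu_pos by (intro mult_strict_left_mono) auto
    also have "\<dots> = \<mu> / 2 * K1" unfolding K1_def by simp
    finally show ?thesis .
  qed
  have K1pos: "0 < K1" unfolding K1_def using K_pos mu_pos by simp
  have up: "0 \<le> K1 * \<epsilon> - g u"
  proof (rule barrier_nonneg[where D="\<lambda>z. K1 * \<epsilon> - g z" and t=u and p="-T" and q=v and D'="\<lambda>z. - g' z"])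
    show "((\<lambda>z. K1 * \<epsilon> - g z) has_real_derivative - g' z) (at z within {-T..v})" if "z \<in> {-T..v}" for z
      using g[OF that] by (auto intro!: derivative_eq_intros)
    show "0 < - g' z" if z: "z \<in> {-T..v}" "K1 * \<epsilon> - g z = 0" for z
    proof -
      have "F (xdet z) z / \<epsilon> = K1" 
      proof -
        have "F (xdet z) z = K1 * \<epsilon>" using z(2) unfolding g_def by simp
        then show ?thesis using eps by simp
      qed
      moreover have "ft (xdet z) z \<le> B" using ft_bound[OF xdet_range[OF in1[OF z(1)]], of z] by simp
      moreover have "ddx d F (xdet z) z * K1 \<le> - \<mu> / 2 * K1" using sl[OF z(1)] K1pos by (intro mult_right_mono) auto
      ultimately show ?thesis using K1 unfolding g'_def by simp
    qed
  qed (use g0 u in auto)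
  have lo: "0 \<le> K1 * \<epsilon> + g u"
  proof (rule barrier_nonneg[where D="\<lambda>z. K1 * \<epsilon> + g z" and t=u and p="-T" and q=v and D'="\<lambda>z. g' z"])
    show "((\<lambda>z. K1 * \<epsilon> + g z) has_real_derivative g' z) (at z within {-T..v})" if "z \<in> {-T..v}" for z
      using g[OF that] by (auto intro!: derivative_eq_intros)
    show "0 < g' z" if z: "z \<in> {-T..v}" "K1 * \<epsilon> + g z = 0" for z
    proof -
      have "F (xdet z) z / \<epsilon> = - K1" 
      proof -
        have "F (xdet z) z = - K1 * \<epsilon>" using z(2) unfolding g_def by simp
        then show ?thesis using eps by simp
      qed
      moreover have "- B \<le> ft (xdet z) z" using ft_bound[OF xdet_range[OF in1[OF z(1)]], of z] by simp
      moreover have "ddx d F (xdet z) z * K1 \<le> - \<mu> / 2 * K1" using sl[OF z(1)] K1pos by (intro mult_right_mono) auto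
      ultimately show ?thesis using K1 unfolding g'_def by simp
    qed
  qed (use g0 u in auto)
  have gb: "\<bar>g u\<bar> \<le> K1 * \<epsilon>" using up lo by simp
  have uu: "\<tau> \<le> \<bar>u\<bar>" "\<bar>u\<bar> \<le> T" using u v pos by auto
  have xu: "xdet u \<in> {-d..d}" using xdet_range[OF in1[OF u]] .
  have "\<mu> / 2 * \<bar>xdet u - X u\<bar> \<le> \<bar>g u\<bar>"
  proof -
    have slz: "\<mu> / 2 \<le> \<bar>ddx d F z u\<bar>" if "\<bar>z - X u\<bar> \<le> \<bar>xdet u - X u\<bar>" "z \<in> {-d..d}" for z
    proof -
      have "ddx d F z u \<le> - \<mu> / 2"
        using that near[OF u] by (intro slope_near_X[OF uu]) auto
      then show ?thesis by simp
    qed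
    have ex: "\<exists>z. \<bar>z - X u\<bar> \<le> \<bar>xdet u - X u\<bar> \<and> z \<in> {-d..d} \<and> \<bar>g u\<bar> = \<bar>ddx d F z u\<bar> * \<bar>xdet u - X u\<bar>"
    proof (cases "xdet u \<le> X u")
      case True
      then obtain z where "z \<in> {xdet u..X u}" "F (X u) u - F (xdet u) u = ddx d F z u * (X u - xdet u)"
        using F_mean_value[OF xu XT] by blast
      then have "\<bar>- g u\<bar> = \<bar>ddx d F z u * (X u - xdet u)\<bar>" unfolding g_def by (simp add: X_zero)
      then have "\<bar>g u\<bar> = \<bar>ddx d F z u\<bar> * \<bar>xdet u - X u\<bar>"
        by (simp only: abs_mult abs_minus_cancel abs_minus_commute)
      then show ?thesis using True xu XT[of u] \<open>z \<in> {xdet u..X u}\<close> by (intro exI[of _ z]) auto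
    next
      case False
      then obtain z where "z \<in> {X u..xdet u}" "F (xdet u) u - F (X u) u = ddx d F z u * (xdet u - X u)"
        using F_mean_value[OF XT xu] by (metis nle_le)
      then have "g u = ddx d F z u * (xdet u - X u)" unfolding g_def by (simp add: X_zero)
      then have "\<bar>g u\<bar> = \<bar>ddx d F z u\<bar> * \<bar>xdet u - X u\<bar>" by (simp only: abs_mult)
      then show ?thesis using False xu XT[of u] \<open>z \<in> {X u..xdet u}\<close> by (intro exI[of _ z]) auto
    qed
    then obtain z where z: "\<bar>z - X u\<bar> \<le> \<bar>xdet u - X u\<bar>" "z \<in> {-d..d}" "\<bar>g u\<bar> = \<bar>ddx d F z u\<bar> * \<bar>xdet u - X u\<bar>" by blast
    show ?thesis unfolding z(3) by (rule mult_right_mono[OF slz[OF z(1,2)]]) simp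
  qed
  then have "\<mu> / 2 * \<bar>xdet u - X u\<bar> \<le> \<mu> / 2 * (K * \<epsilon>)" using gb unfolding K1_def by (simp add: algebra_simps)
  then show ?thesis by (rule mult_left_le_imp_le) (use mu_pos in simp)
qed

text \<open>The a priori closeness needed above cannot be lost, since at the first time of losing it
the estimate would still hold.\<close>

lemma tracking:
  assumes u: "u \<in> {-T..-\<tau>}"
  shows "\<bar>xdet u - X u\<bar> \<le> K * \<epsilon>"
proof -
  let ?\<phi> = "\<lambda>t. \<bar>xdet t - X t\<bar>"
  have Ke: "K * \<epsilon> < \<mu> / (2 * B)"
    using eps_small(1) K_pos eps mult_pos_pos[OF K_pos eps] by linarith
  have cont: "continuous_on {-T..-\<tau>} ?\<phi>"
    by (intro continuous_intros continuous_on_subset[OF xdet_continuous] continuous_on_subset[OF X_cont]) (use pos in auto)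
  have pK: "p * \<epsilon> \<le> K * \<epsilon>"
  proof -
    have "k * \<tau>\<^sup>2 \<le> B"
    proof -
      have "sqrt r \<le> \<bar>-\<tau>\<bar>" "\<bar>-\<tau>\<bar> \<le> T" using r_small pos by auto
      then have "ddx d F (X (-\<tau>)) (-\<tau>) \<le> - k * (-\<tau>)\<^sup>2" using X_slope by blast
      moreover have "- B \<le> ddx d F (X (-\<tau>)) (-\<tau>)" using fx_bound[of "X (-\<tau>)" "-\<tau>"] X_range[of "-\<tau>"] pos by (auto simp: abs_le_iff)
      ultimately show ?thesis by simp
    qed
    then have "p * \<mu> \<le> 2 * B * p" using p pos by (simp add: mult.commute)
    then have "p * \<mu> \<le> K * \<mu>" using K(2) by simp
    then have "p \<le> K" by (rule mult_right_le_imp_le[OF _ mu_pos])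
    then show ?thesis using eps by simp
  qed
  have near: "?\<phi> v < \<mu> / (2 * B)" if v: "v \<in> {-T..-\<tau>}" for v
  proof (rule ccontr)
    assume "\<not> ?\<phi> v < \<mu> / (2 * B)"
    then have ge: "\<mu> / (2 * B) \<le> ?\<phi> v" by simp
    have c: "continuous_on {-T..v} ?\<phi>" by (rule continuous_on_subset[OF cont]) (use v in auto)
    have s: "?\<phi> (-T) < \<mu> / (2 * B)" using start pK Ke by linarith
    obtain t where t: "-T < t" "t \<le> v" "?\<phi> t = \<mu> / (2 * B)" "\<And>u. -T \<le> u \<Longrightarrow> u < t \<Longrightarrow> ?\<phi> u < \<mu> / (2 * B)"
      using first_passage[OF c _ s ge] v by auto
    have "?\<phi> t \<le> K * \<epsilon>"
    proof (rule tracking_upto[of t])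
      show "?\<phi> u \<le> \<mu> / (2 * B)" if "u \<in> {-T..t}" for u
        using t(3) t(4)[of u] that by (cases "u = t") auto
    qed (use t v in auto)
    then show False using t(3) Ke by simp
  qed
  show ?thesis
    by (rule tracking_upto[of "-\<tau>"]) (use near u pos in \<open>auto intro: less_imp_le\<close>)
qed

lemma fx_tracking:
  assumes u: "u \<in> {-T..-\<tau>}"
  shows "ddx d F (xdet u) u \<le> - \<mu> / 2"
proof (rule slope_near_X)
  have "K * \<epsilon> < \<mu> / (2 * B)"
    using eps_small(1) K_pos eps mult_pos_pos[OF K_pos eps] by linarith
  then show "\<bar>xdet u - X u\<bar> \<le> \<mu> / (2 * B)" using tracking[OF u] by simp
  show "\<tau> \<le> \<bar>u\<bar>" "\<bar>u\<bar> \<le> T" using u pos by auto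
  show "xdet u \<in> {-d..d}" using u pos by (intro xdet_range) auto
qed

end

section \<open>The linearisation along the deterministic solution\<close>

context det_slice begin

lemma abar_bound: "t \<in> {-T..T} \<Longrightarrow> \<bar>abar d F xdet t\<bar> \<le> B"
  unfolding abar_def using fx_bound xdet_range by blast

lemma abar_continuous: "continuous_on {-T..T} (abar d F xdet)"
proof -
  have "continuous_on {-T..T} (\<lambda>t. (xdet t, t))" by (intro continuous_intros xdet_continuous)
  moreover have "(\<lambda>t. (xdet t, t)) ` {-T..T} \<subseteq> {-d..d} \<times> UNIV" using xdet_range by auto
  ultimately have "continuous_on {-T..T} (\<lambda>t. (\<lambda>(x, t). ddx d F x t) (xdet t, t))"
    using continuous_on_compose2[OF fx_continuous] by blast
  then show ?thesis unfolding abar_def[abs_def] by simp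
qed

lemma abar_integrable: "{u..v} \<subseteq> {-T..T} \<Longrightarrow> abar d F xdet integrable_on {u..v}"
  by (rule integrable_continuous_real[OF continuous_on_subset[OF abar_continuous]])

lemma alphabar_add:
  assumes "-T \<le> u" "u \<le> w" "w \<le> v" "v \<le> T"
  shows "alphabar d F xdet v u = alphabar d F xdet w u + alphabar d F xdet v w"
  unfolding alphabar_def
  by (rule Henstock_Kurzweil_Integration.integral_combine[symmetric]) (use assms in \<open>auto intro!: abar_integrable\<close>)

lemma alphabar_le:
  assumes uv: "-T \<le> u" "u \<le> v" "v \<le> T"
    and H: "\<And>t. t \<in> {u..v} \<Longrightarrow> (H has_real_derivative H' t) (at t within {u..v})"
    and le: "\<And>t. t \<in> {u..v} \<Longrightarrow> abar d F xdet t \<le> H' t"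
  shows "alphabar d F xdet v u \<le> H v - H u"
proof -
  have "(H' has_integral (H v - H u)) {u..v}"
    by (rule fundamental_theorem_of_calculus[OF uv(2)]) (use H in \<open>auto simp: has_real_derivative_iff_has_vector_derivative\<close>)
  moreover have "(abar d F xdet has_integral alphabar d F xdet v u) {u..v}"
    unfolding alphabar_def using abar_integrable[of u v] uv by (auto intro!: integrable_integral)
  ultimately show ?thesis using has_integral_le le by blast
qed

lemma alphabar_self: "alphabar d F xdet u u = 0" unfolding alphabar_def by simp

lemma alphabar_abs_le:
  assumes "-T \<le> u" "u \<le> v" "v \<le> T" and L: "\<And>t. t \<in> {u..v} \<Longrightarrow> \<bar>abar d F xdet t\<bar> \<le> L"
  shows "\<bar>alphabar d F xdet v u\<bar> \<le> L * (v - u)"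
proof -
  have 0: "abar d F xdet integrable_on {u..v}" using assms by (intro abar_integrable) auto
  have "integral {u..v} (abar d F xdet) \<le> integral {u..v} (\<lambda>_. L)"
    using L by (intro integral_le[OF 0]) (auto simp: abs_le_iff)
  moreover have "integral {u..v} (\<lambda>_. - L) \<le> integral {u..v} (abar d F xdet)"
  proof (rule integral_le[OF _ 0])
    show "- L \<le> abar d F xdet t" if "t \<in> {u..v}" for t using L[OF that] by (simp add: abs_le_iff)
  qed auto
  ultimately show ?thesis unfolding alphabar_def using assms by (simp add: abs_le_iff mult.commute)
qed

abbreviation (input) E :: "real \<Rightarrow> real \<Rightarrow> real" where "E t u \<equiv> exp (2 * alphabar d F xdet t u / \<epsilon>)"

abbreviation (input) \<zeta> :: "real \<Rightarrow> real" where "\<zeta> \<equiv> zeta d F T \<epsilon> xdet"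

lemma E_mult: "-T \<le> u \<Longrightarrow> u \<le> w \<Longrightarrow> w \<le> v \<Longrightarrow> v \<le> T \<Longrightarrow> E v u = E v w * E w u"
  using alphabar_add[of u w v] by (simp add: exp_add[symmetric] add_divide_distrib[symmetric] algebra_simps)

lemma E_continuous:
  assumes "-T \<le> u" "u \<le> t" "t \<le> T"
  shows "continuous_on {u..t} (\<lambda>v. E t v)"
proof -
  have c: "continuous_on {u..t} (\<lambda>v. alphabar d F xdet v u)"
    unfolding alphabar_def using assms by (intro indefinite_integral_continuous_1 abar_integrable) auto
  have eq: "alphabar d F xdet t u - alphabar d F xdet v u = alphabar d F xdet t v" if "v \<in> {u..t}" for v
    using alphabar_add[of u v t] that assms by simp
  have "continuous_on {u..t} (\<lambda>v. alphabar d F xdet t u - alphabar d F xdet v u)"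
    by (rule continuous_on_diff[OF continuous_on_const c])
  from continuous_on_eq[OF this eq] have "continuous_on {u..t} (\<lambda>v. alphabar d F xdet t v)" .
  from continuous_on_exp[OF continuous_on_divide[OF continuous_on_mult[OF continuous_on_const this] continuous_on_const]]
  show ?thesis using eps by auto
qed

lemma E_integrable: "-T \<le> u \<Longrightarrow> u \<le> v \<Longrightarrow> v \<le> t \<Longrightarrow> t \<le> T \<Longrightarrow> (\<lambda>v. E t v) integrable_on {u..v}"
  by (rule integrable_continuous_real[OF continuous_on_subset[OF E_continuous[of u t]]]) auto

text \<open>In particular \<open>abar(-T)\<close> does not vanish, so the division in the definition of
\<open>\<zeta>\<close> is a genuine one.\<close>

lemma abar_start: "abar d F xdet (-T) < 0"
proof -
  have "ddx d F (xdet (-T)) (-T) \<le> - (k * \<tau>\<^sup>2) / 2" using pos by (intro fx_tracking) auto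
  then show ?thesis using mu_pos unfolding abar_def by linarith
qed

text \<open>\<open>\<zeta>\<close> solves \<open>\<epsilon> \<zeta>' = 2 abar \<zeta> + 1\<close>, hence dominates the homogeneous solution.\<close>

lemma zeta_propagate:
  assumes "-T \<le> u" "u \<le> t" "t \<le> T"
  shows "E t u * \<zeta> u \<le> \<zeta> t"
proof -
  have "E t u * (1 / (2 * \<bar>abar d F xdet (- T)\<bar>) * E u (-T)) = 1 / (2 * \<bar>abar d F xdet (- T)\<bar>) * E t (-T)"
    using E_mult[of "-T" u t] assms by simp
  moreover have "E t u * (1 / \<epsilon> * integral {-T..u} (\<lambda>v. E u v)) \<le> 1 / \<epsilon> * integral {-T..t} (\<lambda>v. E t v)"
  proof -
    have "E t u * integral {-T..u} (\<lambda>v. E u v) = integral {-T..u} (\<lambda>v. E t u * E u v)" by simp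
    also have "\<dots> = integral {-T..u} (\<lambda>v. E t v)"
    proof (rule integral_cong)
      fix v assume "v \<in> {-T..u}"
      then show "E t u * E u v = E t v" using E_mult[of v u t] assms by simp
    qed
    also have "\<dots> \<le> integral {-T..t} (\<lambda>v. E t v)"
      using assms by (intro integral_subset_le E_integrable) auto
    finally have "1 / \<epsilon> * (E t u * integral {-T..u} (\<lambda>v. E u v)) \<le> 1 / \<epsilon> * integral {-T..t} (\<lambda>v. E t v)"
      using eps by (intro mult_left_mono) auto
    then show ?thesis by (simp only: mult.left_commute)
  qed
  ultimately show ?thesis unfolding zeta_def by (simp only: distrib_left)
qed

text \<open>Only the noise of the recent past \<open>[u,t]\<close> is counted.\<close>

lemma zeta_lower_recent:
  assumes u: "-T \<le> u" "u \<le> t" "t \<le> T" and L: "\<And>v. v \<in> {u..t} \<Longrightarrow> \<bar>abar d F xdet v\<bar> \<le> L"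
  shows "(t - u) / \<epsilon> * exp (- 2 * L * (t - u) / \<epsilon>) \<le> \<zeta> t"
proof -
  have L0: "0 \<le> L" using L[of t] u by force
  have le: "exp (- 2 * L * (t - u) / \<epsilon>) \<le> E t v" if v: "v \<in> {u..t}" for v
  proof -
    have "\<bar>alphabar d F xdet t v\<bar> \<le> L * (t - v)" using v u by (intro alphabar_abs_le L) auto
    also have "\<dots> \<le> L * (t - u)" using v L0 by (intro mult_left_mono) auto
    finally have "- 2 * L * (t - u) \<le> 2 * alphabar d F xdet t v" by linarith
    then show ?thesis unfolding exp_le_cancel_iff by (rule divide_right_mono) (use eps in simp)
  qed
  have "(t - u) * exp (- 2 * L * (t - u) / \<epsilon>) = integral {u..t} (\<lambda>_. exp (- 2 * L * (t - u) / \<epsilon>))"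
    using u by simp
  also have "\<dots> \<le> integral {u..t} (\<lambda>v. E t v)"
    using u le by (intro integral_le E_integrable) auto
  also have "\<dots> \<le> integral {-T..t} (\<lambda>v. E t v)"
    using u by (intro integral_subset_le E_integrable) auto
  finally have "1 / \<epsilon> * ((t - u) * exp (- 2 * L * (t - u) / \<epsilon>)) \<le> 1 / \<epsilon> * integral {-T..t} (\<lambda>v. E t v)"
    using eps by (intro mult_left_mono) auto
  moreover have "0 \<le> 1 / (2 * \<bar>abar d F xdet (- T)\<bar>) * E t (-T)" by (intro mult_nonneg_nonneg) auto
  moreover have "(t - u) / \<epsilon> * exp (- 2 * L * (t - u) / \<epsilon>) = 1 / \<epsilon> * ((t - u) * exp (- 2 * L * (t - u) / \<epsilon>))" by simp
  ultimately show ?thesis unfolding zeta_def by linarith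
qed

lemma zeta_lower_start:
  assumes u: "-T \<le> t" "t \<le> T" and L: "\<And>v. v \<in> {-T..t} \<Longrightarrow> \<bar>abar d F xdet v\<bar> \<le> L"
  shows "1 / (2 * B) * exp (- 2 * L * (t + T) / \<epsilon>) \<le> \<zeta> t"
proof -
  have "\<bar>alphabar d F xdet t (-T)\<bar> \<le> L * (t - (-T))" using u pos by (intro alphabar_abs_le L) auto
  then have "- 2 * L * (t + T) \<le> 2 * alphabar d F xdet t (-T)" by (simp add: abs_le_iff)
  then have 1: "exp (- 2 * L * (t + T) / \<epsilon>) \<le> E t (-T)"
    unfolding exp_le_cancel_iff by (rule divide_right_mono) (use eps in simp)
  have "\<bar>abar d F xdet (-T)\<bar> \<le> B" using abar_bound pos by simp
  then have "1 / (2 * B) \<le> 1 / (2 * \<bar>abar d F xdet (- T)\<bar>)"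
    using abar_start pos by (intro divide_left_mono mult_pos_pos) auto
  then have "1 / (2 * B) * exp (- 2 * L * (t + T) / \<epsilon>) \<le> 1 / (2 * \<bar>abar d F xdet (- T)\<bar>) * E t (-T)"
    using 1 pos by (intro mult_mono) auto
  moreover have "0 \<le> 1 / \<epsilon> * integral {-T..t} (\<lambda>v. E t v)"
    using eps u by (intro mult_nonneg_nonneg integral_nonneg E_integrable) auto
  ultimately show ?thesis unfolding zeta_def by simp
qed

lemma zeta_lower_const:
  assumes t: "t \<in> {-T..T}"
  shows "exp (- 2 * B) * min 1 (1 / (2 * B)) \<le> \<zeta> t"
proof (cases "-T \<le> t - \<epsilon>")
  case True
  have "exp (- 2 * B) * min 1 (1 / (2 * B)) \<le> exp (- 2 * B) * 1" by (intro mult_left_mono) auto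
  also have "\<dots> = (t - (t - \<epsilon>)) / \<epsilon> * exp (- 2 * B * (t - (t - \<epsilon>)) / \<epsilon>)" using eps by simp
  also have "\<dots> \<le> \<zeta> t" using True t eps by (intro zeta_lower_recent abar_bound) auto
  finally show ?thesis .
next
  case False
  have "(t + T) / \<epsilon> \<le> 1" using False eps by (simp add: divide_le_eq)
  then have "2 * B * ((t + T) / \<epsilon>) \<le> 2 * B * 1" using pos by (intro mult_left_mono) auto
  then have "exp (- 2 * B) \<le> exp (- 2 * B * (t + T) / \<epsilon>)" by simp
  moreover have "1 / (2 * B) * exp (- 2 * B * (t + T) / \<epsilon>) \<le> \<zeta> t" using t by (intro zeta_lower_start abar_bound) auto
  moreover have "exp (- 2 * B) * min 1 (1 / (2 * B)) \<le> exp (- 2 * B) * (1 / (2 * B))" by (intro mult_left_mono) auto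
  moreover have "1 / (2 * B) * exp (- 2 * B) \<le> 1 / (2 * B) * exp (- 2 * B * (t + T) / \<epsilon>)"
    using calculation(1) pos by (intro mult_left_mono) auto
  ultimately show ?thesis by (simp only: mult.commute)
qed

lemma zeta_pos: "t \<in> {-T..T} \<Longrightarrow> 0 < \<zeta> t"
proof -
  assume "t \<in> {-T..T}"
  moreover have "0 < exp (- 2 * B) * min 1 (1 / (2 * B))" using pos by simp
  ultimately show ?thesis using zeta_lower_const by (meson less_le_trans)
qed

end

text \<open>\<open>s\<close> is the half-width of the window in which the noise dominates. The condition \<open>\<epsilon> \<le> s^3\<close> says that the
relaxation time \<open>\<epsilon>/s\<^sup>2\<close> at the entrance does not exceed \<open>s\<close>; \<open>C\<close> is the constant of the
supersolution \<open>C max(-t,s)\<close> and \<open>c3\<close> the rate of contraction.\<close>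

locale window = det_slice +
  fixes s C c3 :: real
  assumes s: "0 < s" "s \<le> \<tau>" "\<epsilon> \<le> s ^ 3" "r \<le> s\<^sup>2"
    and C: "2 * A \<le> C" "m \<le> C" "C * \<tau> \<le> x1" "A + 2 \<le> c * C\<^sup>2"
    and c3: "0 < c3" "6 * c3 * T\<^sup>2 \<le> k * \<tau>\<^sup>2" "12 * c3 \<le> c * m\<^sup>2"
begin

text \<open>The scale of \<open>xdet\<close>, and the square root of the scale of \<open>abar\<close> and \<open>1/\<zeta>\<close>, at time \<open>t\<close>.\<close>

definition width :: "real \<Rightarrow> real" where "width t = max (- t) s"

lemma width_ge: "s \<le> width t" "- t \<le> width t" "0 < width t"
  using s unfolding width_def by auto

lemma width_antimono: "u \<le> v \<Longrightarrow> width v \<le> width u"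
  unfolding width_def by auto

lemma C_pos: "0 < C" using C pos by linarith

lemma window_sub: "{u..v} \<subseteq> {-T..T}" if "-T \<le> u" "v \<le> s"
  using that s pos by auto

lemma a_le_width: "\<bar>t\<bar> \<le> T \<Longrightarrow> t \<le> s \<Longrightarrow> ddx d F 0 t \<le> A * (width t)\<^sup>2"
proof -
  assume t: "\<bar>t\<bar> \<le> T" "t \<le> s"
  have "\<bar>t\<bar> \<le> width t" using t unfolding width_def by auto
  then have "\<bar>t\<bar>\<^sup>2 \<le> (width t)\<^sup>2" by (intro power_mono) auto
  moreover have "s\<^sup>2 \<le> (width t)\<^sup>2" using width_ge s by (intro power_mono) auto
  ultimately have "max r (t\<^sup>2) \<le> (width t)\<^sup>2" using s by simp
  then have "A * max r (t\<^sup>2) \<le> A * (width t)\<^sup>2" using pos by (intro mult_left_mono) auto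
  then show ?thesis using a_upper[OF t(1)] by simp
qed

text \<open>On the curve \<open>C width(t)\<close> the cubic term outweighs the linear one, so strongly that even the
falling part of the curve is a supersolution.\<close>

lemma F_on_envelope:
  assumes t: "-\<tau> \<le> t" "t \<le> s" and x: "x = C * width t"
  shows "F x t \<le> - 2 * C * \<epsilon>"
proof -
  have w: "width t \<le> \<tau>" "0 < width t" using t s width_ge unfolding width_def by auto
  have "C * width t \<le> C * \<tau>" using w C_pos by simp
  then have "x \<le> \<delta>" using x C(3) pos(10) by linarith
  moreover have "0 \<le> x" using x C_pos w by simp
  ultimately have xd: "x \<in> {0..\<delta>}" by simp
  have tt: "\<bar>t\<bar> \<le> \<tau>" using t s by auto
  have "F x t \<le> ddx d F 0 t * x - c * x ^ 3" by (rule cubic[OF xd tt])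
  also have "ddx d F 0 t * x \<le> A * (width t)\<^sup>2 * x"
    using a_le_width[of t] t tt pos xd by (intro mult_right_mono) auto
  also have "A * (width t)\<^sup>2 * x - c * x ^ 3 = - (C * (width t)^3 * (c * C\<^sup>2 - A))"
    unfolding x by (simp add: power2_eq_square power3_eq_cube algebra_simps)
  also have "\<dots> \<le> - (C * s ^ 3 * 2)"
  proof -
    have "s ^ 3 \<le> (width t) ^ 3" using width_ge s by (intro power_mono) auto
    then have "C * s ^ 3 * 2 \<le> C * (width t) ^ 3 * (c * C\<^sup>2 - A)"
      using C C_pos s w by (intro mult_mono) auto
    then show ?thesis by simp
  qed
  also have "\<dots> \<le> - 2 * C * \<epsilon>" using s C_pos by simp
  finally show ?thesis by simp
qed

lemma xdet_lower_outer: "t \<in> {-T..-\<tau>} \<Longrightarrow> m / 2 * (- t) \<le> xdet t"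
proof -
  assume t: "t \<in> {-T..-\<tau>}"
  have "m * \<bar>t\<bar> \<le> X t" using t r_small pos by (intro X_lower) auto
  moreover have "\<bar>xdet t - X t\<bar> \<le> K * \<epsilon>" by (rule tracking[OF t])
  moreover have "m * \<tau> \<le> m * \<bar>t\<bar>" using t pos by (intro mult_left_mono) auto
  moreover have "m * \<bar>t\<bar> = m * (- t)" using t pos by simp
  ultimately show ?thesis using eps_small(3) by linarith
qed

text \<open>The line \<open>-(m/2) t\<close> lies below the equilibrium branch, where the drift is positive, and is
decreasing; it is therefore a subsolution.\<close>

lemma xdet_lower_inner:
  assumes "t \<in> {-\<tau>..-s}" shows "m / 2 * (- t) \<le> xdet t"
proof -
  have sub: "{-\<tau>..-s} \<subseteq> {-T..T}" using s pos by auto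
  have "0 \<le> xdet t + m / 2 * t"
  proof (rule barrier_nonneg[where D="\<lambda>t. xdet t + m / 2 * t" and t=t and p="-\<tau>" and q="-s"
        and D'="\<lambda>t. F (xdet t) t / \<epsilon> + m / 2"])
    show "((\<lambda>t. xdet t + m / 2 * t) has_real_derivative F (xdet z) z / \<epsilon> + m / 2) (at z within {-\<tau>..-s})"
      if "z \<in> {-\<tau>..-s}" for z
      using xdet_derivative_sub[OF sub that] by (auto intro!: derivative_eq_intros)
    show "0 \<le> xdet (-\<tau>) + m / 2 * (-\<tau>)" using xdet_lower_outer[of "-\<tau>"] pos by auto
    show "0 < F (xdet z) z / \<epsilon> + m / 2" if z: "z \<in> {-\<tau>..-s}" "xdet z + m / 2 * z = 0" for z
    proof -
      have x: "xdet z = m / 2 * (- z)" using z by simp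
      have mz: "0 < m * (- z)" using z s pos by (intro mult_pos_pos) auto
      have rs: "sqrt r \<le> s" using real_sqrt_le_mono[OF s(4)] s by simp
      have "m * \<bar>z\<bar> \<le> X z" using z s pos rs by (intro X_lower) auto
      then have "m * (- z) \<le> X z" using z s by simp
      then have "0 < F (xdet z) z" using mz unfolding x by (intro F_pos) auto
      then show ?thesis using eps pos by (intro add_pos_pos divide_pos_pos) auto
    qed
  qed (use assms in auto)
  then show ?thesis by simp
qed

lemma xdet_lower: "t \<in> {-T..-s} \<Longrightarrow> m / 2 * (- t) \<le> xdet t"
  using xdet_lower_inner[of t] xdet_lower_outer[of t] by (cases "t \<le> -\<tau>") auto

lemma xdet_upper_left:
  assumes "t \<in> {-\<tau>..-s}" shows "xdet t \<le> C * (- t)"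
proof -
  have sub: "{-\<tau>..-s} \<subseteq> {-T..T}" using s pos by auto
  have "0 \<le> C * (- t) - xdet t"
  proof (rule barrier_nonneg[where D="\<lambda>t. C * (- t) - xdet t" and t=t and p="-\<tau>" and q="-s"
        and D'="\<lambda>t. - C - F (xdet t) t / \<epsilon>"])
    show "((\<lambda>t. C * (- t) - xdet t) has_real_derivative - C - F (xdet z) z / \<epsilon>) (at z within {-\<tau>..-s})"
      if "z \<in> {-\<tau>..-s}" for z
      using xdet_derivative_sub[OF sub that] by (auto intro!: derivative_eq_intros)
    have "X (-\<tau>) \<le> A * \<bar>-\<tau>\<bar>" using r_small pos by (intro X_upper) auto
    moreover have "\<bar>xdet (-\<tau>) - X (-\<tau>)\<bar> \<le> K * \<epsilon>" using pos by (intro tracking) auto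
    moreover have "2 * A * \<tau> \<le> C * \<tau>" using C pos by (intro mult_right_mono) auto
    moreover have "\<bar>-\<tau>\<bar> = \<tau>" using pos(7) by simp
    ultimately have "xdet (-\<tau>) \<le> C * \<tau>" using eps_small(2) by (simp only: mult.assoc abs_le_iff) linarith
    then show "0 \<le> C * (- (-\<tau>)) - xdet (-\<tau>)" by simp
    show "0 < - C - F (xdet z) z / \<epsilon>" if z: "z \<in> {-\<tau>..-s}" "C * (- z) - xdet z = 0" for z
    proof -
      have "width z = - z" using z s unfolding width_def by auto
      then have "F (xdet z) z \<le> - 2 * C * \<epsilon>"
        using z s by (intro F_on_envelope) auto
      then have "F (xdet z) z / \<epsilon> \<le> - 2 * C" using eps by (simp add: divide_le_eq)
      then show ?thesis using C_pos by linarith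
    qed
  qed (use assms in auto)
  then show ?thesis by simp
qed

lemma xdet_upper_right:
  assumes "t \<in> {-s..s}" shows "xdet t \<le> C * s"
proof -
  have sub: "{-s..s} \<subseteq> {-T..T}" using s pos by auto
  have "0 \<le> C * s - xdet t"
  proof (rule barrier_nonneg[where D="\<lambda>t. C * s - xdet t" and t=t and p="-s" and q="s"
        and D'="\<lambda>t. - (F (xdet t) t / \<epsilon>)"])
    show "((\<lambda>t. C * s - xdet t) has_real_derivative - (F (xdet z) z / \<epsilon>)) (at z within {-s..s})"
      if "z \<in> {-s..s}" for z
      using xdet_derivative_sub[OF sub that] by (auto intro!: derivative_eq_intros)
    show "0 \<le> C * s - xdet (-s)" using xdet_upper_left[of "-s"] s by auto
    show "0 < - (F (xdet z) z / \<epsilon>)" if z: "z \<in> {-s..s}" "C * s - xdet z = 0" for z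
    proof -
      have "F (xdet z) z \<le> - 2 * C * \<epsilon>"
        using z s by (intro F_on_envelope) (auto simp: width_def max_def)
      then have "F (xdet z) z < 0" using mult_pos_pos[OF C_pos eps] by linarith
      then show ?thesis using eps by (simp add: divide_less_0_iff)
    qed
  qed (use assms in auto)
  then show ?thesis by simp
qed

lemma xdet_upper: "t \<in> {-\<tau>..s} \<Longrightarrow> xdet t \<le> C * width t"
proof (cases "t \<le> -s")
  case True
  assume "t \<in> {-\<tau>..s}"
  then have "xdet t \<le> C * (- t)" using xdet_upper_left[of t] True by auto
  also have "\<dots> \<le> C * width t" using C_pos width_ge(2)[of t] by (intro mult_left_mono) auto
  finally show ?thesis .
next
  case False
  assume "t \<in> {-\<tau>..s}"
  then have "xdet t \<le> C * s" using xdet_upper_right[of t] False by auto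
  also have "\<dots> \<le> C * width t" using C_pos width_ge(1)[of t] by (intro mult_left_mono) auto
  finally show ?thesis .
qed

text \<open>Since \<open>F \<ge> -B x\<close>, the solution decays at most exponentially; the doubled rate makes the
subsolution strict.\<close>

lemma xdet_pos_inner:
  assumes "t \<in> {-s..s}" shows "0 < xdet t"
proof -
  have sub: "{-s..s} \<subseteq> {-T..T}" using s pos by auto
  define \<eta> where "\<eta> = xdet (-s)"
  have "m / 2 * (- (- s)) \<le> \<eta>" unfolding \<eta>_def using s pos by (intro xdet_lower) auto
  moreover have "0 < m / 2 * s" using pos s by simp
  ultimately have \<eta>: "0 < \<eta>" by simp
  define e where "e t = \<eta> * exp (- (2 * B / \<epsilon>) * (t + s))" for t
  have e: "0 < e t" for t unfolding e_def using \<eta> by simp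
  have de: "(e has_real_derivative - (2 * B / \<epsilon>) * e z) (at z within S)" for z S
    unfolding e_def using eps by (auto intro!: derivative_eq_intros simp: field_simps)
  have "0 \<le> xdet t - e t"
  proof (rule barrier_nonneg[where D="\<lambda>t. xdet t - e t" and t=t and p="-s" and q="s"
        and D'="\<lambda>t. F (xdet t) t / \<epsilon> - (- (2 * B / \<epsilon>) * e t)"])
    show "((\<lambda>t. xdet t - e t) has_real_derivative F (xdet z) z / \<epsilon> - (- (2 * B / \<epsilon>) * e z)) (at z within {-s..s})"
      if "z \<in> {-s..s}" for z
      by (rule DERIV_diff[OF xdet_derivative_sub[OF sub that] de])
    show "0 \<le> xdet (-s) - e (-s)" unfolding e_def \<eta>_def by simp
    show "0 < F (xdet z) z / \<epsilon> - (- (2 * B / \<epsilon>) * e z)" if z: "z \<in> {-s..s}" "xdet z - e z = 0" for z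
    proof -
      have x: "xdet z = e z" using z by simp
      have "xdet z \<in> {-d..d}" using z sub by (intro xdet_range) auto
      then have "\<bar>F (xdet z) z - F 0 z\<bar> \<le> B * \<bar>xdet z - 0\<bar>" using pos by (intro F_lipschitz) auto
      then have "- (B * e z) \<le> F (xdet z) z" unfolding x F_zero using e[of z] by simp
      moreover have "0 < B * e z" using pos e[of z] by simp
      ultimately have "0 < F (xdet z) z + 2 * B * e z" by linarith
      then have "0 < (F (xdet z) z + 2 * B * e z) / \<epsilon>" using eps by simp
      then show ?thesis by (simp add: add_divide_distrib)
    qed
  qed (use assms in auto)
  then show ?thesis using e[of t] by simp
qed

lemma xdet_pos: "t \<in> {-T..s} \<Longrightarrow> 0 < xdet t"
proof (cases "t \<le> -s")
  case True
  assume t: "t \<in> {-T..s}"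
  have "0 < m / 2 * (- t)" using True s(1) pos(13) by (intro mult_pos_pos) auto
  then show ?thesis using xdet_lower[of t] True t by auto
next
  case False
  assume t: "t \<in> {-T..s}"
  then show ?thesis using False by (intro xdet_pos_inner) auto
qed

definition C2 :: real where "C2 = B / \<tau>\<^sup>2 + A + B * C\<^sup>2"

lemma C2_pos: "0 < C2" unfolding C2_def using pos by (simp add: add_pos_nonneg add_pos_pos)

lemma abar_abs_le:
  assumes t: "t \<in> {-T..s}"
  shows "\<bar>abar d F xdet t\<bar> \<le> C2 * (width t)\<^sup>2"
proof (cases "t \<le> -\<tau>")
  case True
  have tT: "t \<in> {-T..T}" using t s pos by auto
  have "\<tau>\<^sup>2 \<le> (width t)\<^sup>2" using True pos width_ge(2)[of t] by (intro power_mono) auto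
  then have "B / \<tau>\<^sup>2 * \<tau>\<^sup>2 \<le> B / \<tau>\<^sup>2 * (width t)\<^sup>2" using pos by (intro mult_left_mono) auto
  also have "\<dots> \<le> C2 * (width t)\<^sup>2" unfolding C2_def using pos by (intro mult_right_mono) auto
  finally have "B \<le> C2 * (width t)\<^sup>2" using pos by simp
  then show ?thesis using fx_bound[OF xdet_range[OF tT], of t] unfolding abar_def by simp
next
  case False
  have tT: "t \<in> {-T..T}" using t s pos by auto
  have t': "t \<in> {-\<tau>..s}" using t False by auto
  have "\<bar>ddx d F (xdet t) t - ddx d F 0 t\<bar> \<le> B * (xdet t)\<^sup>2" using tT by (intro quad xdet_range) auto
  moreover have "(xdet t)\<^sup>2 \<le> (C * width t)\<^sup>2"
    using xdet_upper[OF t'] xdet_pos[OF t] by (intro power_mono) auto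
  then have "B * (xdet t)\<^sup>2 \<le> B * (C * width t)\<^sup>2" using pos by (intro mult_left_mono) auto
  moreover have "ddx d F 0 t \<le> A * (width t)\<^sup>2" using t tT by (intro a_le_width) auto
  moreover have "0 < ddx d F 0 t" by (rule a_pos)
  ultimately have "\<bar>abar d F xdet t\<bar> \<le> (A + B * C\<^sup>2) * (width t)\<^sup>2"
    unfolding abar_def by (simp add: power_mult_distrib algebra_simps abs_le_iff)
  also have "\<dots> \<le> C2 * (width t)\<^sup>2" unfolding C2_def using pos by (intro mult_right_mono) auto
  finally show ?thesis .
qed

lemma alphabar_outer:
  assumes "-T \<le> u" "u \<le> w" "w \<le> -\<tau>"
  shows "alphabar d F xdet w u \<le> - c3 * w ^ 3 - (- c3 * u ^ 3)"
proof (rule alphabar_le[where H="\<lambda>t. - c3 * t ^ 3" and H'="\<lambda>t. - c3 * (3 * t\<^sup>2)"])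
  fix t assume t: "t \<in> {u..w}"
  show "((\<lambda>t. - c3 * t ^ 3) has_real_derivative - c3 * (3 * t\<^sup>2)) (at t within {u..w})"
    by (auto intro!: derivative_eq_intros)
  have "\<bar>t\<bar> \<le> T" using t assms pos by auto
  then have "\<bar>t\<bar>\<^sup>2 \<le> T\<^sup>2" by (intro power_mono) auto
  then have "6 * c3 * t\<^sup>2 \<le> 6 * c3 * T\<^sup>2" using c3 by (intro mult_left_mono) auto
  then have "6 * c3 * t\<^sup>2 \<le> k * \<tau>\<^sup>2" using c3(2) by linarith
  moreover have "ddx d F (xdet t) t \<le> - (k * \<tau>\<^sup>2) / 2" using t assms by (intro fx_tracking) auto
  ultimately show "abar d F xdet t \<le> - c3 * (3 * t\<^sup>2)" unfolding abar_def by simp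
qed (use assms pos in auto)

text \<open>The first summand integrates to a logarithm, the second one is a definite gain.\<close>

lemma abar_le_log:
  assumes t: "t \<in> {-\<tau>..s}"
  shows "abar d F xdet t \<le> F (xdet t) t / xdet t - c * (xdet t)\<^sup>2"
proof -
  have x0: "0 < xdet t" using t pos by (intro xdet_pos) auto
  have "width t \<le> \<tau>" using t s unfolding width_def by auto
  then have "C * width t \<le> C * \<tau>" using C_pos by simp
  then have "xdet t \<le> x1" using xdet_upper[OF t] C by simp
  then have "xdet t * ddx d F (xdet t) t \<le> F (xdet t) t - c * (xdet t) ^ 3"
    using x0 t s by (intro slope) auto
  then have "ddx d F (xdet t) t \<le> (F (xdet t) t - c * (xdet t) ^ 3) / xdet t"
    using x0 by (simp add: pos_le_divide_eq mult.commute)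
  also have "\<dots> = F (xdet t) t / xdet t - c * (xdet t)\<^sup>2"
    using x0 by (simp add: diff_divide_distrib power2_eq_square power3_eq_cube)
  finally show ?thesis unfolding abar_def .
qed

lemma ln_xdet_derivative:
  assumes "-T \<le> u" "v \<le> s" "t \<in> {u..v}"
  shows "((\<lambda>t. \<epsilon> * ln (xdet t)) has_real_derivative F (xdet t) t / xdet t) (at t within {u..v})"
proof -
  have x0: "0 < xdet t" using assms by (intro xdet_pos) auto
  have d: "(xdet has_real_derivative F (xdet t) t / \<epsilon>) (at t within {u..v})"
    by (rule xdet_derivative_sub[OF window_sub]) (use assms in auto)
  have "((\<lambda>t. \<epsilon> * ln (xdet t)) has_real_derivative \<epsilon> * (F (xdet t) t / \<epsilon> * (1 / xdet t))) (at t within {u..v})"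
    using x0 by (auto intro!: derivative_eq_intros d)
  then show ?thesis using eps by simp
qed

lemma alphabar_middle:
  assumes "-\<tau> \<le> u" "u \<le> w" "w \<le> -s"
  shows "alphabar d F xdet w u \<le> (\<epsilon> * ln (xdet w) - c3 * w ^ 3) - (\<epsilon> * ln (xdet u) - c3 * u ^ 3)"
proof (rule alphabar_le[where H="\<lambda>t. \<epsilon> * ln (xdet t) - c3 * t ^ 3" and H'="\<lambda>t. F (xdet t) t / xdet t - c3 * (3 * t\<^sup>2)"])
  fix t assume t: "t \<in> {u..w}"
  have 1: "((\<lambda>t. c3 * t ^ 3) has_real_derivative c3 * (3 * t\<^sup>2)) (at t within {u..w})"
    by (auto intro!: derivative_eq_intros)
  have 2: "((\<lambda>t. \<epsilon> * ln (xdet t)) has_real_derivative F (xdet t) t / xdet t) (at t within {u..w})"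
    using t assms s pos by (intro ln_xdet_derivative) auto
  show "((\<lambda>t. \<epsilon> * ln (xdet t) - c3 * t ^ 3) has_real_derivative F (xdet t) t / xdet t - c3 * (3 * t\<^sup>2)) (at t within {u..w})"
    by (rule DERIV_diff[OF 2 1])
  have "m / 2 * (- t) \<le> xdet t" using t assms pos by (intro xdet_lower) auto
  moreover have "0 \<le> m / 2 * (- t)" using t assms s(1) pos(13) by (intro mult_nonneg_nonneg) auto
  ultimately have "(m / 2 * (- t))\<^sup>2 \<le> (xdet t)\<^sup>2" by (intro power_mono) auto
  then have "c * (m / 2 * (- t))\<^sup>2 \<le> c * (xdet t)\<^sup>2" using pos by (intro mult_left_mono) auto
  then have "c * m\<^sup>2 * t\<^sup>2 / 4 \<le> c * (xdet t)\<^sup>2" by (simp add: power_mult_distrib power_divide)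
  moreover have "12 * c3 * t\<^sup>2 \<le> c * m\<^sup>2 * t\<^sup>2" using c3 by (intro mult_right_mono) auto
  moreover have "abar d F xdet t \<le> F (xdet t) t / xdet t - c * (xdet t)\<^sup>2" using t assms s by (intro abar_le_log) auto
  ultimately show "abar d F xdet t \<le> F (xdet t) t / xdet t - c3 * (3 * t\<^sup>2)" by simp
qed (use assms pos s in auto)

lemma alphabar_inner:
  assumes "-\<tau> \<le> u" "u \<le> v" "v \<le> s"
  shows "alphabar d F xdet v u \<le> \<epsilon> * ln (xdet v) - \<epsilon> * ln (xdet u)"
proof (rule alphabar_le[where H="\<lambda>t. \<epsilon> * ln (xdet t)" and H'="\<lambda>t. F (xdet t) t / xdet t"])
  fix t assume t: "t \<in> {u..v}"
  show "((\<lambda>t. \<epsilon> * ln (xdet t)) has_real_derivative F (xdet t) t / xdet t) (at t within {u..v})"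
    using t assms s pos by (intro ln_xdet_derivative) auto
  have "0 \<le> c * (xdet t)\<^sup>2" using pos by simp
  moreover have "abar d F xdet t \<le> F (xdet t) t / xdet t - c * (xdet t)\<^sup>2" using t assms s by (intro abar_le_log) auto
  ultimately show "abar d F xdet t \<le> F (xdet t) t / xdet t" by simp
qed (use assms pos s in auto)

definition C0 :: real where "C0 = ln (2 * C / m)"

lemma C0_nonneg: "0 \<le> C0" unfolding C0_def using C pos by simp

text \<open>\<open>xdet\<close> is comparable to its scale, and the scale does not increase.\<close>

lemma ln_ratio:
  assumes "-\<tau> \<le> u" "u \<le> -s" "u \<le> v" "v \<le> s"
  shows "\<epsilon> * ln (xdet v) - \<epsilon> * ln (xdet u) \<le> \<epsilon> * C0"
proof -
  have xv: "0 < xdet v" "xdet v \<le> C * width v" using assms pos by (auto intro!: xdet_pos xdet_upper)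
  have xu: "0 < xdet u" using assms pos s by (intro xdet_pos) auto
  have xu': "m / 2 * (- u) \<le> xdet u" using assms pos s by (intro xdet_lower) auto
  have "width v \<le> - u" using assms unfolding width_def by auto
  then have "C * width v \<le> C * (- u)" using C_pos by (intro mult_left_mono) auto
  also have "\<dots> = 2 * C / m * (m / 2 * (- u))" using pos by simp
  also have "\<dots> \<le> 2 * C / m * xdet u" using xu' C_pos pos by (intro mult_left_mono) auto
  finally have "xdet v \<le> 2 * C / m * xdet u" using xv by simp
  then have "ln (xdet v) \<le> ln (2 * C / m * xdet u)" using xv xu C_pos pos by (intro ln_mono) auto
  also have "\<dots> = C0 + ln (xdet u)" unfolding C0_def using C_pos pos xu by (intro ln_mult_pos) auto
  finally have "\<epsilon> * ln (xdet v) \<le> \<epsilon> * (C0 + ln (xdet u))" using eps by (intro mult_left_mono) auto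
  then show ?thesis by (simp add: algebra_simps)
qed

lemma alphabar_mid_upper:
  assumes "-\<tau> \<le> u" "u \<le> -s" "u \<le> v" "v \<le> s"
  shows "alphabar d F xdet v u \<le> \<epsilon> * C0 - c3 * ((- u) ^ 3 - (width v) ^ 3)"
proof (cases "v \<le> -s")
  case True
  have "width v = - v" using True unfolding width_def by auto
  then show ?thesis using alphabar_middle[of u v] ln_ratio[OF assms] assms True by (simp add: algebra_simps)
next
  case False
  have w: "width v = s" using False unfolding width_def by auto
  have "alphabar d F xdet v u = alphabar d F xdet (-s) u + alphabar d F xdet v (-s)"
    using assms False pos s by (intro alphabar_add) auto
  moreover have "alphabar d F xdet (-s) u \<le> (\<epsilon> * ln (xdet (-s)) - c3 * (-s) ^ 3) - (\<epsilon> * ln (xdet u) - c3 * u ^ 3)"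
    using assms by (intro alphabar_middle) auto
  moreover have "alphabar d F xdet v (-s) \<le> \<epsilon> * ln (xdet v) - \<epsilon> * ln (xdet (-s))"
    using assms False s by (intro alphabar_inner) auto
  ultimately show ?thesis using ln_ratio[OF assms] w by (simp add: algebra_simps)
qed

text \<open>The three regimes (tracking before \<open>-\<tau>\<close>, the cubic region up to \<open>-s\<close>, the window) are added up. In the
window nothing is gained, but the logarithms telescope, so nothing but the
constant \<open>C0\<close> is lost either.\<close>

lemma alphabar_upper:
  assumes "-T \<le> u" "u \<le> -s" "u \<le> v" "v \<le> s"
  shows "alphabar d F xdet v u \<le> \<epsilon> * C0 - c3 * ((- u) ^ 3 - (width v) ^ 3)"
proof (cases "-\<tau> \<le> u")
  case True then show ?thesis using alphabar_mid_upper assms by blast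
next
  case False
  show ?thesis
  proof (cases "v \<le> -\<tau>")
    case True
    then have "width v = - v" using s unfolding width_def by auto
    moreover have "0 \<le> \<epsilon> * C0" using eps C0_nonneg by simp
    ultimately show ?thesis using alphabar_outer[of u v] assms True by (simp add: algebra_simps)
  next
    case v: False
    have "alphabar d F xdet v u = alphabar d F xdet (-\<tau>) u + alphabar d F xdet v (-\<tau>)"
      using assms False v pos s by (intro alphabar_add) auto
    moreover have "alphabar d F xdet (-\<tau>) u \<le> - c3 * (-\<tau>) ^ 3 - (- c3 * u ^ 3)"
      using assms False by (intro alphabar_outer) auto
    moreover have "alphabar d F xdet v (-\<tau>) \<le> \<epsilon> * C0 - c3 * ((- (-\<tau>)) ^ 3 - (width v) ^ 3)"
      using assms v s by (intro alphabar_mid_upper) auto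
    ultimately show ?thesis by (simp add: algebra_simps)
  qed
qed

definition c4 :: real where "c4 = exp (- 8 * C2) * min 1 (T\<^sup>2 / (8 * B))"

lemma c4_pos: "0 < c4" unfolding c4_def using pos by simp

text \<open>Over the relaxation time \<open>q = \<epsilon>/width(t)\<^sup>2\<close> before \<open>t\<close> the scale changes at most by a factor of two,
so \<open>\<zeta>\<close> collects at least a constant times \<open>q/\<epsilon>\<close>. Close to the initial time its initial value serves
instead.\<close>

lemma zeta_lower:
  assumes t: "t \<in> {-T..s}"
  shows "c4 / (width t)\<^sup>2 \<le> \<zeta> t"
proof -
  define q where "q = \<epsilon> / (width t)\<^sup>2"
  have w: "0 < width t" using width_ge by simp
  have q0: "0 < q" unfolding q_def using eps w by simp
  have "s ^ 3 \<le> (width t) ^ 3" using width_ge s by (intro power_mono) auto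
  then have "\<epsilon> \<le> width t * (width t)\<^sup>2" using s by (simp add: power2_eq_square power3_eq_cube mult.assoc)
  then have qw: "q \<le> width t" unfolding q_def using w by (simp add: divide_le_eq)
  have tT: "t \<in> {-T..T}" using t s pos by auto
  have L: "\<bar>abar d F xdet v\<bar> \<le> 4 * C2 * (width t)\<^sup>2" if v: "v \<in> {-T..t}" "t - q \<le> v" for v
  proof -
    have "width v \<le> 2 * width t" using v(2) qw width_ge[of t] unfolding width_def by auto
    then have "(width v)\<^sup>2 \<le> (2 * width t)\<^sup>2" using width_ge(3)[of v] by (intro power_mono) auto
    then have "C2 * (width v)\<^sup>2 \<le> C2 * (2 * width t)\<^sup>2" using C2_pos by (intro mult_left_mono) auto
    moreover have "\<bar>abar d F xdet v\<bar> \<le> C2 * (width v)\<^sup>2" using v t by (intro abar_abs_le) auto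
    ultimately show ?thesis by (simp add: power_mult_distrib)
  qed
  have qe: "4 * C2 * (width t)\<^sup>2 * q / \<epsilon> = 4 * C2" unfolding q_def using w eps by simp
  show ?thesis
  proof (cases "-T \<le> t - q")
    case True
    have "(t - (t - q)) / \<epsilon> * exp (- 2 * (4 * C2 * (width t)\<^sup>2) * (t - (t - q)) / \<epsilon>) \<le> \<zeta> t"
      using True tT q0 by (intro zeta_lower_recent L) auto
    moreover have "- 2 * (4 * C2 * (width t)\<^sup>2) * (t - (t - q)) / \<epsilon> = - 8 * C2" using qe by simp
    ultimately have "q / \<epsilon> * exp (- 8 * C2) \<le> \<zeta> t" by simp
    moreover have "q / \<epsilon> = 1 / (width t)\<^sup>2" unfolding q_def using eps by simp
    moreover have "c4 \<le> exp (- 8 * C2) * 1" unfolding c4_def by (intro mult_left_mono) auto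
    then have "c4 / (width t)\<^sup>2 \<le> exp (- 8 * C2) * 1 / (width t)\<^sup>2" by (intro divide_right_mono) auto
    ultimately show ?thesis by simp
  next
    case False
    have "- t \<le> width t" by (rule width_ge)
    then have Tw: "T \<le> 2 * width t" using False qw by linarith
    then have "T\<^sup>2 \<le> (2 * width t)\<^sup>2" using pos by (intro power_mono) auto
    then have 1: "T\<^sup>2 / (width t)\<^sup>2 \<le> 4" using w by (simp add: divide_le_eq power_mult_distrib)
    have "1 / (2 * B) * exp (- 2 * (4 * C2 * (width t)\<^sup>2) * (t + T) / \<epsilon>) \<le> \<zeta> t"
      using False tT by (intro zeta_lower_start L) auto
    moreover have "4 * C2 * (width t)\<^sup>2 * (t + T) / \<epsilon> \<le> 4 * C2 * (width t)\<^sup>2 * q / \<epsilon>"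
      using False C2_pos eps by (intro divide_right_mono mult_left_mono) auto
    then have "exp (- 8 * C2) \<le> exp (- 2 * (4 * C2 * (width t)\<^sup>2) * (t + T) / \<epsilon>)"
      unfolding qe by simp
    then have "1 / (2 * B) * exp (- 8 * C2) \<le> 1 / (2 * B) * exp (- 2 * (4 * C2 * (width t)\<^sup>2) * (t + T) / \<epsilon>)"
      using pos by (intro mult_left_mono) auto
    moreover have "c4 / (width t)\<^sup>2 \<le> 1 / (2 * B) * exp (- 8 * C2)"
    proof -
      have "c4 \<le> exp (- 8 * C2) * (T\<^sup>2 / (8 * B))" unfolding c4_def by (intro mult_left_mono) auto
      then have "c4 / (width t)\<^sup>2 \<le> exp (- 8 * C2) * (T\<^sup>2 / (8 * B)) / (width t)\<^sup>2" by (intro divide_right_mono) auto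
      also have "\<dots> = exp (- 8 * C2) / (8 * B) * (T\<^sup>2 / (width t)\<^sup>2)" by simp
      also have "\<dots> \<le> exp (- 8 * C2) / (8 * B) * 4" using 1 pos by (intro mult_left_mono) auto
      finally show ?thesis by simp
    qed
    ultimately show ?thesis by linarith
  qed
qed

end

section \<open>Pathwise comparison\<close>

text \<open>One sample path that stays positive, driven by one sample \<open>w\<close> of the Wiener process.\<close>

locale noisy_path = window +
  fixes \<sigma> t0 t1 x0 :: real and w x :: "real \<Rightarrow> real"
  assumes sig: "0 < \<sigma>" "s\<^sup>2 \<le> \<sigma>"
    and times: "-T \<le> t0" "t0 \<le> t1" "t1 \<le> s"
    and x_cont: "continuous_on {t0..t1} x"
    and x_pos: "\<And>v. v \<in> {t0..t1} \<Longrightarrow> 0 < x v"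
    and x_eq: "\<And>v. v \<in> {t0..t1} \<Longrightarrow> set_integrable lborel {t0..v} (\<lambda>u. F (x u) u) \<and>
        x v = x0 + (1/\<epsilon>) * (LBINT u:{t0..v}. F (x u) u) + \<sigma> / sqrt \<epsilon> * (w v - w t0)"
begin

definition N :: "real \<Rightarrow> real" where "N v = \<sigma> / sqrt \<epsilon> * w v"

lemma noise_removed_derivative:
  assumes uv: "t0 \<le> u" "u \<le> v" "v \<le> t1" and x: "\<And>r. r \<in> {u..v} \<Longrightarrow> x r \<le> \<delta>" and z: "z \<in> {u..v}"
  shows "((\<lambda>r. x r - (N r - N u)) has_real_derivative F (x z) z / \<epsilon>) (at z within {u..v})"
proof -
  let ?f = "\<lambda>r. F (x r) r"
  have ii: "?f integrable_on {t0..r}" "(LBINT u:{t0..r}. ?f u) = integral {t0..r} ?f" if "r \<in> {t0..t1}" for r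
    using x_eq[OF that] set_borel_integral_eq_integral[of "{t0..r}" ?f] by auto
  have xin: "x r \<in> {-d..d}" if "r \<in> {u..v}" for r
    using x[OF that] x_pos[of r] that uv pos by auto
  have cx: "continuous_on {u..v} x" by (rule continuous_on_subset[OF x_cont]) (use uv in auto)
  have "continuous_on {u..v} (\<lambda>r. (x r, r))" by (intro continuous_intros cx)
  moreover have "(\<lambda>r. (x r, r)) ` {u..v} \<subseteq> {-d..d} \<times> UNIV" using xin by auto
  ultimately have "continuous_on {u..v} (\<lambda>r. (\<lambda>(x, t). F x t) (x r, r))"
    using continuous_on_compose2[OF F_continuous] by blast
  then have fc: "continuous_on {u..v} ?f" by simp
  have J: "((\<lambda>r. integral {u..r} ?f) has_real_derivative ?f z) (at z within {u..v})"
    by (rule integral_has_real_derivative[OF fc z])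
  have eq: "x r - (N r - N u) = x u + 1 / \<epsilon> * integral {u..r} ?f" if r: "r \<in> {u..v}" for r
  proof -
    have rin: "r \<in> {t0..t1}" "u \<in> {t0..t1}" using r uv by auto
    have "integral {t0..u} ?f + integral {u..r} ?f = integral {t0..r} ?f"
      using r uv by (intro Henstock_Kurzweil_Integration.integral_combine ii(1)[OF rin(1)]) auto
    then have "1/\<epsilon> * integral {t0..r} ?f = 1/\<epsilon> * integral {t0..u} ?f + 1/\<epsilon> * integral {u..r} ?f"
      by (simp only: distrib_left[symmetric])
    moreover have "x r = x0 + 1/\<epsilon> * integral {t0..r} ?f + (N r - N t0)"
      using x_eq[OF rin(1)] ii(2)[OF rin(1)] unfolding N_def by (simp add: algebra_simps)
    moreover have "x u = x0 + 1/\<epsilon> * integral {t0..u} ?f + (N u - N t0)"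
      using x_eq[OF rin(2)] ii(2)[OF rin(2)] unfolding N_def by (simp add: algebra_simps)
    ultimately show ?thesis by linarith
  qed
  have "((\<lambda>r. x u + 1 / \<epsilon> * integral {u..r} ?f) has_real_derivative 1 / \<epsilon> * ?f z) (at z within {u..v})"
    using eps by (auto intro!: derivative_eq_intros J)
  then have "((\<lambda>r. x u + 1 / \<epsilon> * integral {u..r} ?f) has_real_derivative F (x z) z / \<epsilon>) (at z within {u..v})"
    by simp
  then show ?thesis
    by (rule has_field_derivative_transform_within[OF _ zero_less_one z]) (use eq in auto)
qed

text \<open>By concavity \<open>x - xdet\<close> is a subsolution of the linearised equation as long as \<open>x \<le> \<delta>\<close>.\<close>

lemma linear_comparison:
  assumes uv: "t0 \<le> u" "u \<le> v" "v \<le> -s" "v \<le> t1" and x: "\<And>r. r \<in> {u..v} \<Longrightarrow> x r \<le> \<delta>"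
    and xd: "\<And>r. r \<in> {u..v} \<Longrightarrow> xdet r \<le> \<delta>"
    and n: "\<And>r. r \<in> {u..v} \<Longrightarrow> \<bar>N r - N u\<bar> \<le> \<eta>"
    and J: "C2 * ((-u) ^ 3 - (-v) ^ 3) \<le> 3 * \<epsilon> * J"
  shows "x v - xdet v \<le> exp (alphabar d F xdet v u / \<epsilon>) * (x u - xdet u) + \<eta> * (1 + 2 * C / m * J)"
proof -
  define g where "g r = abar d F xdet r / \<epsilon>" for r
  have sub: "{u..v} \<subseteq> {-T..T}" using uv times s pos by auto
  have g: "continuous_on {u..v} g" unfolding g_def
    using continuous_on_subset[OF abar_continuous sub] eps by (intro continuous_intros) auto
  have gi: "integral {r..v} g = alphabar d F xdet v r / \<epsilon>" for r
    unfolding g_def alphabar_def by simp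
  have a3: "((\<lambda>r. C2 * (r\<^sup>2)) has_integral (C2 * (v ^ 3 / 3) - C2 * (u ^ 3 / 3))) {u..v}"
    by (rule fundamental_theorem_of_calculus[OF uv(2)])
      (auto simp: has_real_derivative_iff_has_vector_derivative[symmetric] intro!: derivative_eq_intros)
  have "integral {u..v} (\<lambda>r. \<bar>g r\<bar>) \<le> integral {u..v} (\<lambda>r. 1 / \<epsilon> * (C2 * r\<^sup>2))"
  proof (rule integral_le)
    show "(\<lambda>r. \<bar>g r\<bar>) integrable_on {u..v}" by (intro integrable_continuous_real continuous_on_rabs g)
    show "(\<lambda>r. 1 / \<epsilon> * (C2 * r\<^sup>2)) integrable_on {u..v}" by (intro integrable_continuous_real continuous_intros)
    fix r assume r: "r \<in> {u..v}"
    have "width r = - r" using r uv unfolding width_def by auto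
    then have "\<bar>abar d F xdet r\<bar> \<le> C2 * r\<^sup>2" using abar_abs_le[of r] r uv times s by auto
    then show "\<bar>g r\<bar> \<le> 1 / \<epsilon> * (C2 * r\<^sup>2)" unfolding g_def using eps by (simp add: divide_right_mono)
  qed
  also have "\<dots> = 1 / \<epsilon> * (C2 * (v ^ 3 / 3) - C2 * (u ^ 3 / 3))"
    using integral_unique[OF a3] by simp
  also have "\<dots> \<le> J"
  proof -
    have "(-u) ^ 3 = - (u ^ 3)" "(-v) ^ 3 = - (v ^ 3)" by (simp_all add: power3_eq_cube)
    then have "C2 * (v ^ 3 / 3) - C2 * (u ^ 3 / 3) \<le> \<epsilon> * J" using J by (simp add: algebra_simps)
    then show ?thesis using eps by (simp add: divide_le_eq mult.commute)
  qed
  finally have I: "integral {u..v} (\<lambda>r. \<bar>g r\<bar>) \<le> J" .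
  have Ce: "exp (integral {r..v} g) \<le> 2 * C / m" if r: "r \<in> {u..v}" for r
  proof -
    have "width v \<le> - r" using r uv unfolding width_def by auto
    then have "(width v) ^ 3 \<le> (- r) ^ 3" using width_ge(3)[of v] by (intro power_mono) auto
    then have "0 \<le> c3 * ((- r) ^ 3 - (width v) ^ 3)" using c3 by simp
    moreover have "alphabar d F xdet v r \<le> \<epsilon> * C0 - c3 * ((- r) ^ 3 - (width v) ^ 3)"
      using r uv times s by (intro alphabar_upper) auto
    ultimately have "alphabar d F xdet v r \<le> \<epsilon> * C0" by linarith
    then have "alphabar d F xdet v r / \<epsilon> \<le> C0" using eps by (simp add: divide_le_eq mult.commute)
    then have "exp (integral {r..v} g) \<le> exp C0" unfolding gi by simp
    also have "exp C0 = 2 * C / m" unfolding C0_def using C_pos pos by simp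
    finally show ?thesis .
  qed
  define Y where "Y r = x r - (N r - N u) - xdet r" for r
  have "Y v \<le> exp (integral {u..v} g) * Y u + \<eta> * (2 * C / m) * J"
  proof (rule noisy_gronwall[OF uv(2) g, where Y'="\<lambda>r. F (x r) r / \<epsilon> - F (xdet r) r / \<epsilon>" and n="\<lambda>r. N r - N u"])
    fix r assume r: "r \<in> {u..v}"
    have ut: "v \<le> t1" "t0 \<le> u" using uv by auto
    have "((\<lambda>r. x r - (N r - N u)) has_real_derivative F (x r) r / \<epsilon>) (at r within {u..v})"
      using uv x r by (intro noise_removed_derivative) auto
    then show "(Y has_real_derivative F (x r) r / \<epsilon> - F (xdet r) r / \<epsilon>) (at r within {u..v})"
      unfolding Y_def by (rule DERIV_diff[OF _ xdet_derivative_sub[OF sub r]])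
    have "F (x r) r \<le> F (xdet r) r + ddx d F (xdet r) r * (x r - xdet r)"
    proof (rule tangent)
      show "xdet r \<in> {0..\<delta>}" using xd[OF r] xdet_pos[of r] r uv times s by auto
      show "x r \<in> {0..\<delta>}" using x[OF r] x_pos[of r] r uv by auto
      show "\<bar>r\<bar> \<le> T" using r sub by auto
    qed
    then have "F (x r) r / \<epsilon> \<le> (F (xdet r) r + abar d F xdet r * (x r - xdet r)) / \<epsilon>"
      unfolding abar_def using eps by (intro divide_right_mono) auto
    then show "F (x r) r / \<epsilon> - F (xdet r) r / \<epsilon> \<le> g r * (Y r + (N r - N u))"
      unfolding g_def Y_def by (simp add: add_divide_distrib)
    show "\<bar>N r - N u\<bar> \<le> \<eta>" using n[OF r] .
    show "exp (integral {r..v} g) \<le> 2 * C / m" using Ce[OF r] .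
  qed (rule I)
  moreover have "N v - N u \<le> \<eta>" using n[of v] uv by auto
  ultimately show ?thesis unfolding Y_def gi by (simp add: algebra_simps)
qed

text \<open>The time before the window is cut at \<open>-\<rho> j\<close>. At these times the excess of \<open>x\<close> over \<open>xdet\<close> is the propagated
initial excess \<open>a\<close>, which is below \<open>h sqrt \<zeta> / 2\<close> by \<open>zeta_propagate\<close>, plus the accumulated noise. A chunk at
most halves the noise accumulated so far and adds \<open>\<kappa> q h / \<rho> j\<close>; hence \<open>2 \<kappa> q h / \<rho> j\<close> is preserved as a bound, \<open>\<rho>\<close> being
decreasing. Only the last chunk may be too short to contract.\<close>

lemma approach_bound:
  fixes \<rho> :: "nat \<Rightarrow> real" and n :: nat
  assumes t1: "-s \<le> t1" and h: "0 < h" and q: "0 < q" and J: "0 \<le> J"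
    and p0: "\<rho> 0 = - t0" and pn: "\<rho> n = s" and dec: "\<And>j. j < n \<Longrightarrow> \<rho> (Suc j) \<le> \<rho> j"
    and Jp: "\<And>j. j < n \<Longrightarrow> C2 * ((\<rho> j) ^ 3 - (\<rho> (Suc j)) ^ 3) \<le> 3 * \<epsilon> * J"
    and contr: "\<And>j. Suc j < n \<Longrightarrow> \<epsilon> * (C0 + 1) \<le> c3 * ((\<rho> j) ^ 3 - (\<rho> (Suc j)) ^ 3)"
    and noise: "\<And>j r. j < n \<Longrightarrow> r \<in> {- \<rho> j..- \<rho> (Suc j)} \<Longrightarrow> \<bar>N r - N (- \<rho> j)\<bar> \<le> q * h / \<rho> j"
    and q_small: "4 * (4 * C / m + 1) * (1 + 2 * C / m * J) * q \<le> sqrt c4"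
    and envelope: "\<And>v. v \<in> {t0..-s} \<Longrightarrow> xdet v + h * sqrt (\<zeta> v) < \<delta>"
    and start: "x t0 \<le> xdet t0 + 1/2 * h * sqrt (\<zeta> t0)"
  shows "x (-s) \<le> xdet (-s) + 3/4 * h * sqrt (\<zeta> (-s))"
proof -
  define \<kappa> where "\<kappa> = 1 + 2 * C / m * J"
  have k1: "1 \<le> \<kappa>" unfolding \<kappa>_def using C_pos pos J by simp
  have Cm: "1 \<le> C / m" using C pos by simp
  have p_mono: "\<rho> j \<le> \<rho> i" if "i \<le> j" "j \<le> n" for i j
    using that(1,2)
  proof (induction j rule: dec_induct)
    case (step l)
    then show ?case using dec[of l] by simp
  qed simp
  have p_ge: "s \<le> \<rho> j" if "j \<le> n" for j using p_mono[OF that order_refl] pn by simp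
  have p_le: "\<rho> j \<le> - t0" if "j \<le> n" for j using p_mono[of 0 j] that p0 by simp
  have wp: "width (- \<rho> j) = \<rho> j" if "j \<le> n" for j using p_ge[OF that] unfolding width_def by auto
  have zT: "0 < \<zeta> v" if "v \<in> {t0..s}" for v using that times s pos by (intro zeta_pos) auto
  have xdd: "xdet v \<le> \<delta>" if "v \<in> {t0..-s}" for v
  proof -
    have "0 \<le> h * sqrt (\<zeta> v)" using zT[of v] that h s by (intro mult_nonneg_nonneg) auto
    then show ?thesis using envelope[OF that] by linarith
  qed
  define a where "a v = exp (alphabar d F xdet v t0 / \<epsilon>) * (1/2 * h * sqrt (\<zeta> t0))" for v
  have a_le: "a v \<le> 1/2 * h * sqrt (\<zeta> v)" if v: "v \<in> {t0..-s}" for v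
  proof -
    have "exp (2 * alphabar d F xdet v t0 / \<epsilon>) * \<zeta> t0 \<le> \<zeta> v" using v times s pos by (intro zeta_propagate) auto
    then have "sqrt (exp (2 * alphabar d F xdet v t0 / \<epsilon>) * \<zeta> t0) \<le> sqrt (\<zeta> v)" by (rule real_sqrt_le_mono)
    moreover have "sqrt (exp (2 * alphabar d F xdet v t0 / \<epsilon>)) = exp (alphabar d F xdet v t0 / \<epsilon>)"
    proof -
      have "exp (2 * alphabar d F xdet v t0 / \<epsilon>) = (exp (alphabar d F xdet v t0 / \<epsilon>))\<^sup>2"
        by (simp add: power2_eq_square exp_add[symmetric])
      then show ?thesis by simp
    qed
    ultimately have "exp (alphabar d F xdet v t0 / \<epsilon>) * sqrt (\<zeta> t0) \<le> sqrt (\<zeta> v)" by (simp add: real_sqrt_mult)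
    then have "1/2 * h * (exp (alphabar d F xdet v t0 / \<epsilon>) * sqrt (\<zeta> t0)) \<le> 1/2 * h * sqrt (\<zeta> v)"
      using h by (intro mult_left_mono) auto
    then show ?thesis unfolding a_def by (simp only: mult_ac)
  qed
  have a_mult: "exp (alphabar d F xdet v u / \<epsilon>) * a u = a v" if "t0 \<le> u" "u \<le> v" "v \<le> -s" for u v
  proof -
    have "alphabar d F xdet v t0 = alphabar d F xdet u t0 + alphabar d F xdet v u"
      using that times s pos by (intro alphabar_add) auto
    then have "exp (alphabar d F xdet v u / \<epsilon>) * exp (alphabar d F xdet u t0 / \<epsilon>) = exp (alphabar d F xdet v t0 / \<epsilon>)"
      by (simp add: exp_add[symmetric] add_divide_distrib[symmetric] add.commute)
    then show ?thesis unfolding a_def by (simp only: mult.assoc[symmetric])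
  qed
  have width_zeta: "q * h / \<rho> j * ((4 * C / m + 1) * \<kappa>) \<le> 1/4 * h * sqrt (\<zeta> v)"
    if j: "j \<le> n" and v: "- \<rho> j \<le> v" "v \<le> - s" for j v
  proof -
    have vT: "v \<in> {-T..s}" using v p_le[OF j] times s by auto
    have "sqrt (c4 / (width v)\<^sup>2) \<le> sqrt (\<zeta> v)" by (rule real_sqrt_le_mono[OF zeta_lower[OF vT]])
    then have "sqrt c4 / width v \<le> sqrt (\<zeta> v)" using width_ge(3)[of v] by (simp add: real_sqrt_divide)
    moreover have "sqrt c4 / \<rho> j \<le> sqrt c4 / width v"
    proof (rule divide_left_mono)
      show "width v \<le> \<rho> j" using width_antimono[OF v(1)] wp[OF j] by simp
      show "0 < \<rho> j * width v" using p_ge[OF j] s(1) width_ge(3)[of v] by (intro mult_pos_pos) auto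
    qed (use c4_pos in simp)
    ultimately have "sqrt c4 / \<rho> j \<le> sqrt (\<zeta> v)" by linarith
    then have 1: "h * (sqrt c4 / \<rho> j) \<le> h * sqrt (\<zeta> v)" using h by (intro mult_left_mono) auto
    have "0 < \<rho> j" using p_ge[OF j] s by simp
    then have "h / \<rho> j * (4 * (4 * C / m + 1) * \<kappa> * q) \<le> h / \<rho> j * sqrt c4"
      using q_small h unfolding \<kappa>_def by (intro mult_left_mono) auto
    then show ?thesis using 1 by (simp add: algebra_simps)
  qed
  have main: "(\<forall>v\<in>{t0..- \<rho> j}. x v < \<delta>) \<and> (j < n \<longrightarrow> x (- \<rho> j) \<le> xdet (- \<rho> j) + a (- \<rho> j) + 2 * \<kappa> * (q * h / \<rho> j))
      \<and> x (- \<rho> j) \<le> xdet (- \<rho> j) + 3/4 * h * sqrt (\<zeta> (- \<rho> j))"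
    if "j \<le> n" for j
    using that
  proof (induction j)
    case 0
    have z0: "0 < sqrt (\<zeta> t0)" using zT[of t0] times by simp
    have tin: "t0 \<in> {t0..-s}" using p_ge[of 0] p0 by simp
    have "a t0 = 1/2 * h * sqrt (\<zeta> t0)" unfolding a_def alphabar_self by simp
    moreover have "0 \<le> 2 * \<kappa> * (q * h / \<rho> 0)" using k1 q h p_ge[of 0] s by simp
    moreover have "1/2 * h * sqrt (\<zeta> t0) \<le> 3/4 * h * sqrt (\<zeta> t0)" "1/2 * h * sqrt (\<zeta> t0) < h * sqrt (\<zeta> t0)"
      using h z0 by (auto intro!: mult_right_mono mult_strict_right_mono)
    ultimately show ?case using start envelope[OF tin] p0 by auto
  next
    case (Suc j)
    then have jn: "j < n" "j \<le> n" by auto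
    note IH = Suc.IH[OF jn(2)]
    let ?u = "- \<rho> j" and ?v = "- \<rho> (Suc j)"
    have uv: "?u \<le> ?v" "t0 \<le> ?u" "?v \<le> -s" using dec[OF jn(1)] p_le[OF jn(2)] p_ge[OF Suc.prems] by auto
    have pj: "0 < \<rho> j" using p_ge[OF jn(2)] s by simp
    have IHu: "x ?u \<le> xdet ?u + a ?u + 2 * \<kappa> * (q * h / \<rho> j)" "\<And>v. v \<in> {t0..?u} \<Longrightarrow> x v < \<delta>"
      using IH jn by auto
    have e0: "0 \<le> q * h / \<rho> j" using q h pj by simp
    have step: "x v \<le> xdet v + a v + exp (alphabar d F xdet v ?u / \<epsilon>) * (2 * \<kappa> * (q * h / \<rho> j)) + \<kappa> * (q * h / \<rho> j)"
      if v: "v \<in> {?u..?v}" and below: "\<And>r. r \<in> {?u..v} \<Longrightarrow> x r \<le> \<delta>" for v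
    proof -
      have "x v - xdet v \<le> exp (alphabar d F xdet v ?u / \<epsilon>) * (x ?u - xdet ?u) + q * h / \<rho> j * (1 + 2 * C / m * J)"
      proof (rule linear_comparison)
        show "t0 \<le> ?u" "?u \<le> v" "v \<le> -s" "v \<le> t1" using v uv t1 by auto
        show "x r \<le> \<delta>" if "r \<in> {?u..v}" for r using below[OF that] .
        show "xdet r \<le> \<delta>" if "r \<in> {?u..v}" for r using that v uv by (intro xdd) auto
        show "\<bar>N r - N ?u\<bar> \<le> q * h / \<rho> j" if "r \<in> {?u..v}" for r using that v by (intro noise[OF jn(1)]) auto
        have "\<rho> (Suc j) \<le> - v" using v by auto
        then have "(\<rho> (Suc j)) ^ 3 \<le> (- v) ^ 3" using p_ge[OF Suc.prems] s by (intro power_mono) auto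
        then have "C2 * ((- ?u) ^ 3 - (- v) ^ 3) \<le> C2 * ((\<rho> j) ^ 3 - (\<rho> (Suc j)) ^ 3)"
          using C2_pos by (intro mult_left_mono) auto
        then show "C2 * ((- ?u) ^ 3 - (- v) ^ 3) \<le> 3 * \<epsilon> * J" using Jp[OF jn(1)] by linarith
      qed
      also have "exp (alphabar d F xdet v ?u / \<epsilon>) * (x ?u - xdet ?u)
          \<le> exp (alphabar d F xdet v ?u / \<epsilon>) * (a ?u + 2 * \<kappa> * (q * h / \<rho> j))"
        using IHu(1) by (intro mult_left_mono) auto
      also have "\<dots> = a v + exp (alphabar d F xdet v ?u / \<epsilon>) * (2 * \<kappa> * (q * h / \<rho> j))"
        using a_mult[of ?u v] v uv by (simp add: distrib_left)
      finally show ?thesis unfolding \<kappa>_def by (simp add: mult.commute)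
    qed
    have cap: "x v \<le> xdet v + 3/4 * h * sqrt (\<zeta> v)"
      if v: "v \<in> {?u..?v}" and below: "\<And>r. r \<in> {?u..v} \<Longrightarrow> x r \<le> \<delta>" for v
    proof -
      have "exp (alphabar d F xdet v ?u / \<epsilon>) \<le> 2 * C / m"
      proof -
        have "width v \<le> - ?u" using v uv p_ge[OF jn(2)] unfolding width_def by auto
        then have "(width v) ^ 3 \<le> (- ?u) ^ 3" using width_ge(3)[of v] by (intro power_mono) auto
        then have "0 \<le> c3 * ((- ?u) ^ 3 - (width v) ^ 3)" using c3 by simp
        moreover have "alphabar d F xdet v ?u \<le> \<epsilon> * C0 - c3 * ((- ?u) ^ 3 - (width v) ^ 3)"
          using v uv times s p_ge[OF jn(2)] by (intro alphabar_upper) auto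
        ultimately have "alphabar d F xdet v ?u \<le> \<epsilon> * C0" by linarith
        then have "alphabar d F xdet v ?u / \<epsilon> \<le> C0" using eps by (simp add: divide_le_eq mult.commute)
        then have "exp (alphabar d F xdet v ?u / \<epsilon>) \<le> exp C0" by simp
        then show ?thesis unfolding C0_def using C_pos pos by simp
      qed
      then have "exp (alphabar d F xdet v ?u / \<epsilon>) * (2 * \<kappa> * (q * h / \<rho> j)) \<le> 2 * C / m * (2 * \<kappa> * (q * h / \<rho> j))"
        using k1 e0 by (intro mult_right_mono mult_nonneg_nonneg) auto
      then have "x v \<le> xdet v + a v + (2 * C / m * (2 * \<kappa> * (q * h / \<rho> j)) + \<kappa> * (q * h / \<rho> j))"
        using step[OF v below] by linarith
      also have "2 * C / m * (2 * \<kappa> * (q * h / \<rho> j)) + \<kappa> * (q * h / \<rho> j) = q * h / \<rho> j * ((4 * C / m + 1) * \<kappa>)"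
        by (simp add: algebra_simps)
      also have "\<dots> \<le> 1/4 * h * sqrt (\<zeta> v)" using v uv by (intro width_zeta jn) auto
      finally show ?thesis using a_le[of v] v uv by auto
    qed
    have lt: "x v < \<delta>" if v: "v \<in> {?u..?v}" for v
    proof (rule ccontr)
      assume "\<not> x v < \<delta>"
      then have ge: "\<delta> \<le> x v" by simp
      have c: "continuous_on {?u..v} x" by (rule continuous_on_subset[OF x_cont]) (use v uv t1 in auto)
      have "x ?u < \<delta>" using IHu(2)[of ?u] uv by auto
      then obtain t where t: "?u < t" "t \<le> v" "x t = \<delta>" "\<And>r. ?u \<le> r \<Longrightarrow> r < t \<Longrightarrow> x r < \<delta>"
        using first_passage[OF c _ _ ge] v by auto
      have tin: "t \<in> {?u..?v}" "t \<in> {t0..-s}" using t v uv by auto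
      have "x t \<le> xdet t + 3/4 * h * sqrt (\<zeta> t)"
      proof (rule cap[OF tin(1)])
        show "x r \<le> \<delta>" if "r \<in> {?u..t}" for r using t(3) t(4)[of r] that by (cases "r = t") auto
      qed
      moreover have "0 \<le> 1/4 * h * sqrt (\<zeta> t)" using zT[of t] tin s h by (intro mult_nonneg_nonneg) auto
      ultimately show False using envelope[OF tin(2)] t(3) by linarith
    qed
    have all: "\<forall>v\<in>{t0..?v}. x v < \<delta>"
    proof
      fix v assume "v \<in> {t0..?v}"
      then show "x v < \<delta>" using IHu(2)[of v] lt[of v] by (cases "v \<le> ?u") auto
    qed
    have below: "x r \<le> \<delta>" if "r \<in> {?u..?v}" for r using lt[OF that] by simp
    have vin: "?v \<in> {?u..?v}" using uv by simp
    have "x ?v \<le> xdet ?v + a ?v + 2 * \<kappa> * (q * h / \<rho> (Suc j))" if sj: "Suc j < n"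
    proof -
      have "alphabar d F xdet ?v ?u \<le> \<epsilon> * C0 - c3 * ((- ?u) ^ 3 - (width ?v) ^ 3)"
        using uv times s p_ge[OF jn(2)] by (intro alphabar_upper) auto
      also have "\<dots> \<le> - \<epsilon>" using contr[OF sj] wp[OF Suc.prems] by (simp add: algebra_simps)
      finally have "alphabar d F xdet ?v ?u / \<epsilon> \<le> -1" using eps by (simp add: divide_le_eq)
      then have "exp (alphabar d F xdet ?v ?u / \<epsilon>) \<le> exp (-1)" by simp
      also have "exp (-1) \<le> (1/2::real)" using exp_ge_add_one_self[of 1] by (simp add: exp_minus field_simps)
      finally have "exp (alphabar d F xdet ?v ?u / \<epsilon>) * (2 * \<kappa> * (q * h / \<rho> j)) \<le> 1/2 * (2 * \<kappa> * (q * h / \<rho> j))"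
        using k1 e0 by (intro mult_right_mono mult_nonneg_nonneg) auto
      moreover have "x ?v \<le> xdet ?v + a ?v + exp (alphabar d F xdet ?v ?u / \<epsilon>) * (2 * \<kappa> * (q * h / \<rho> j)) + \<kappa> * (q * h / \<rho> j)"
        by (rule step[OF vin]) (rule below)
      moreover have "X' \<le> P' + Z'" if "V' \<le> 1/2 * Z'" "X' \<le> P' + V' + Y'" "Z' = 2 * Y'" for X' P' V' Y' Z' :: real
        using that by linarith
      moreover have "2 * \<kappa> * (q * h / \<rho> j) = 2 * (\<kappa> * (q * h / \<rho> j))" by simp
      ultimately have "x ?v \<le> xdet ?v + a ?v + 2 * \<kappa> * (q * h / \<rho> j)"
        by blast
      moreover have "q * h / \<rho> j \<le> q * h / \<rho> (Suc j)"
        using dec[OF jn(1)] p_ge[OF Suc.prems] s q h pj by (intro divide_left_mono mult_pos_pos) auto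
      then have "2 * \<kappa> * (q * h / \<rho> j) \<le> 2 * \<kappa> * (q * h / \<rho> (Suc j))" using k1 by (intro mult_left_mono) auto
      ultimately show ?thesis by linarith
    qed
    then show ?case using all cap[OF vin below] by blast
  qed
  show ?thesis using main[of n] pn by simp
qed

lemma drift_inner:
  assumes z: "z \<in> {-s..s}" and y: "y \<in> {0..\<delta>}"
  shows "F y z \<le> A * s\<^sup>2 * y - c * y ^ 3"
proof -
  have "width z = s" using z s unfolding width_def by auto
  then have "ddx d F 0 z \<le> A * s\<^sup>2" using a_le_width[of z] z s pos by auto
  then have "ddx d F 0 z * y \<le> A * s\<^sup>2 * y" using y by (intro mult_right_mono) auto
  moreover have "F y z \<le> ddx d F 0 z * y - c * y ^ 3" using y z s by (intro cubic) auto
  ultimately show ?thesis by linarith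
qed

lemma drift_inner_cubic:
  assumes z: "z \<in> {-s..s}" and y: "y \<in> {0..\<delta>}" and big: "2 * A * s\<^sup>2 \<le> c * y\<^sup>2"
  shows "F y z \<le> - (c / 2) * y ^ 3"
proof -
  have "2 * A * s\<^sup>2 * y \<le> c * y\<^sup>2 * y" using big y by (intro mult_right_mono) auto
  then show ?thesis using drift_inner[OF z y] by (simp add: power2_eq_square power3_eq_cube mult.assoc)
qed

end

text \<open>Blocks of length \<open>ell = lam \<epsilon>/\<sigma>\<close> inside the window. \<open>lam\<close> is so small that the linear drift changes
the path by a bounded factor within a block; \<open>Kb\<close> and \<open>kap\<close> belong to the cubic descent.\<close>

locale blocks = noisy_path +
  fixes lam kap Kb :: real
  assumes lam: "0 < lam" "8 * A * lam \<le> 1"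
    and Kb: "6 * sqrt lam \<le> Kb" "8 * A \<le> c * Kb\<^sup>2"
    and kap: "0 < kap" "16 * kap \<le> c" "kap * lam * Kb\<^sup>2 \<le> 1/2"
    and sig_small: "\<sigma> * Kb\<^sup>2 \<le> \<delta>\<^sup>2 / 2" "\<sigma> < c * \<delta>\<^sup>2 * lam / 2"
    and s_small: "8 * A * s\<^sup>2 \<le> c * \<delta>\<^sup>2"
begin

definition ell :: real where "ell = lam * \<epsilon> / \<sigma>"
definition Kp :: real where "Kp = 1 / sqrt (kap * lam) + 3 * sqrt lam"
text \<open>The fall, in units of \<open>sqrt ell\<close>, that brings a path from \<open>Kp sqrt \<sigma>\<close> below zero.\<close>

definition q :: real where "q = (4 * Kp + 1) / sqrt lam"

lemma ell_pos: "0 < ell" unfolding ell_def using lam eps sig by simp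

lemma Kp_ge: "3 * sqrt lam \<le> Kp" "0 < Kp"
  unfolding Kp_def using lam kap by (auto intro!: add_pos_pos)

text \<open>At heights above \<open>\<delta>/2\<close> the drift is at most \<open>-C\<close>, so in the time \<open>ell\<close>, which is long compared with
\<open>\<epsilon>\<close>, the path follows a line descending from \<open>7/8 \<delta>\<close> to \<open>3/4 \<delta>\<close> up to noise of size \<open>\<delta>/32\<close>. The bound at the
end of the block is the one at its start, which permits iteration.\<close>

lemma block_no_exit:
  assumes u: "t0 \<le> u" "-s \<le> u" "u + ell \<le> t1" and xu: "x u \<le> 7/8 * \<delta>"
    and n: "\<And>z. z \<in> {u..u+ell} \<Longrightarrow> \<bar>N z - N u\<bar> \<le> \<delta> / 32"
  shows "\<And>z. z \<in> {u..u+ell} \<Longrightarrow> x z < \<delta>" and "x (u + ell) \<le> 7/8 * \<delta>"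
proof -
  define U where "U z = 7/8 * \<delta> - \<delta> / (8 * ell) * (z - u)" for z
  have U: "3/4 * \<delta> \<le> U z" "U z \<le> 7/8 * \<delta>" if "z \<in> {u..u+ell}" for z
  proof -
    have a: "0 \<le> (z - u) / ell" "(z - u) / ell \<le> 1" using that ell_pos by auto
    have "U z = 7/8 * \<delta> - \<delta> / 8 * ((z - u) / ell)" unfolding U_def by simp
    moreover have "\<delta> / 8 * ((z - u) / ell) \<le> \<delta> / 8 * 1" by (rule mult_left_mono[OF a(2)]) (use pos(4) in simp)
    moreover have "0 \<le> \<delta> / 8 * ((z - u) / ell)" by (rule mult_nonneg_nonneg[OF _ a(1)]) (use pos(4) in simp)
    ultimately show "3/4 * \<delta> \<le> U z" "U z \<le> 7/8 * \<delta>" by linarith+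
  qed
  have bound: "x z - (N z - N u) \<le> U z"
    if z: "z \<in> {u..u+ell}" and below: "\<And>y. y \<in> {u..z} \<Longrightarrow> x y \<le> \<delta>" for z
  proof -
    have "0 \<le> U z - (x z - (N z - N u))"
    proof (rule barrier_nonneg[where D="\<lambda>y. U y - (x y - (N y - N u))" and t=z and p=u and q=z
          and D'="\<lambda>y. - (\<delta> / (8 * ell)) - F (x y) y / \<epsilon>"])
      show "((\<lambda>y. U y - (x y - (N y - N u))) has_real_derivative - (\<delta> / (8 * ell)) - F (x y) y / \<epsilon>) (at y within {u..z})"
        if y: "y \<in> {u..z}" for y
      proof (rule DERIV_diff)
        show "(U has_real_derivative - (\<delta> / (8 * ell))) (at y within {u..z})"
          unfolding U_def using ell_pos by (auto intro!: derivative_eq_intros)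
        show "((\<lambda>y. x y - (N y - N u)) has_real_derivative F (x y) y / \<epsilon>) (at y within {u..z})"
          using u z y below by (intro noise_removed_derivative) auto
      qed
      show "0 \<le> U u - (x u - (N u - N u))" unfolding U_def using xu by simp
      show "0 < - (\<delta> / (8 * ell)) - F (x y) y / \<epsilon>" if y: "y \<in> {u..z}" "U y - (x y - (N y - N u)) = 0" for y
      proof -
        have yb: "y \<in> {u..u+ell}" using y z by auto
        have "\<bar>N y - N u\<bar> \<le> \<delta> / 32" by (rule n[OF yb])
        then have xl: "\<delta> / 2 \<le> x y" using U(1)[OF yb] y(2) pos(4) unfolding abs_le_iff by linarith
        have "(\<delta> / 2)\<^sup>2 \<le> (x y)\<^sup>2" using xl pos by (intro power_mono) auto
        then have "c * (\<delta> / 2)\<^sup>2 \<le> c * (x y)\<^sup>2" using pos by (intro mult_left_mono) auto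
        then have "2 * A * s\<^sup>2 \<le> c * (x y)\<^sup>2" using s_small by (simp add: power_divide)
        then have "F (x y) y \<le> - (c / 2) * (x y) ^ 3"
          using y(1) z u times below[of y] xl pos by (intro drift_inner_cubic) auto
        also have "\<dots> \<le> - (c / 2) * (\<delta> / 2) ^ 3"
        proof -
          have "(\<delta> / 2) ^ 3 \<le> (x y) ^ 3" using xl pos by (intro power_mono) auto
          then have "c / 2 * (\<delta> / 2) ^ 3 \<le> c / 2 * (x y) ^ 3" using pos by (intro mult_left_mono) auto
          then show ?thesis by simp
        qed
        also have "\<dots> < - (\<delta> * \<sigma> / (8 * lam))"
        proof -
          have "\<delta> * \<sigma> / (8 * lam) < \<delta> * (c * \<delta>\<^sup>2 * lam / 2) / (8 * lam)"
            using sig_small(2) pos lam by (intro divide_strict_right_mono mult_strict_left_mono) auto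
          also have "\<dots> = c / 2 * (\<delta> / 2) ^ 3" using lam by (simp add: power2_eq_square power3_eq_cube)
          finally show ?thesis by simp
        qed
        finally have "F (x y) y / \<epsilon> < - (\<delta> * \<sigma> / (8 * lam)) / \<epsilon>" using eps by (intro divide_strict_right_mono) auto
        also have "\<dots> = - (\<delta> / (8 * ell))" unfolding ell_def using lam eps sig by simp
        finally show ?thesis by simp
      qed
    qed (use z in auto)
    then show ?thesis by simp
  qed
  have lt: "x z < \<delta>" if z: "z \<in> {u..u+ell}" for z
  proof (rule ccontr)
    assume "\<not> x z < \<delta>"
    then have ge: "\<delta> \<le> x z" by simp
    have c: "continuous_on {u..z} x" by (rule continuous_on_subset[OF x_cont]) (use z u in auto)
    have "x u < \<delta>" using xu pos(4) by linarith
    then obtain t where t: "u < t" "t \<le> z" "x t = \<delta>" "\<And>y. u \<le> y \<Longrightarrow> y < t \<Longrightarrow> x y < \<delta>"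
      using first_passage[OF c _ _ ge] z by auto
    have tb: "t \<in> {u..u+ell}" using t z by auto
    have "x y \<le> \<delta>" if "y \<in> {u..t}" for y using t(3) t(4)[of y] that by (cases "y = t") auto
    from bound[OF tb this] have "x t - (N t - N u) \<le> 7/8 * \<delta>" using U(2)[OF tb] by linarith
    then show False using n[OF tb] t(3) pos(4) unfolding abs_le_iff by linarith
  qed
  then show "x z < \<delta>" if "z \<in> {u..u+ell}" for z using that .
  have e: "u + ell \<in> {u..u+ell}" using ell_pos by simp
  have "x (u + ell) - (N (u + ell) - N u) \<le> U (u + ell)"
    by (rule bound[OF e]) (use lt in \<open>auto intro: less_imp_le\<close>)
  moreover have "U (u + ell) = 3/4 * \<delta>" unfolding U_def using ell_pos by (simp add: field_simps)
  ultimately show "x (u + ell) \<le> 7/8 * \<delta>" using n[OF e] pos(4) unfolding abs_le_iff by linarith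
qed

text \<open>\<open>U' = - kap/(2\<epsilon>) U^3\<close> with \<open>U(u) = \<delta>\<close>; starting from an arbitrary height, a cubic descent is at height
\<open>sqrt (\<epsilon>/(kap ell))\<close>, which is of order \<open>sqrt \<sigma>\<close>, after the time \<open>ell\<close>.\<close>

lemma descent:
  assumes u: "t0 \<le> u" "-s \<le> u" "u + ell \<le> t1" and below: "\<And>z. z \<in> {u..u+ell} \<Longrightarrow> x z \<le> \<delta>"
    and n: "\<And>z. z \<in> {u..u+ell} \<Longrightarrow> \<bar>N z - N u\<bar> \<le> 3 * sqrt lam * sqrt \<sigma>"
  shows "x (u + ell) \<le> Kp * sqrt \<sigma>"
proof -
  \<comment> \<open>\<open>V = 1/U\<^sup>2\<close> grows linearly. The supersolution is valid only as long as it dominates the noise;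
    \<open>kap\<close> is so small that this is the case up to the end of the block.\<close>
  define V where "V z = 1 / \<delta>\<^sup>2 + kap / \<epsilon> * (z - u)" for z
  define U where "U z = 1 / sqrt (V z)" for z
  have V: "0 < V z" if "z \<in> {u..u+ell}" for z
    unfolding V_def using that pos kap eps by (intro add_pos_nonneg) auto
  have Kb0: "0 < Kb" using Kb(1) lam by (intro less_le_trans[OF _ Kb(1)]) auto
  have Ul: "Kb * sqrt \<sigma> \<le> U z" if z: "z \<in> {u..u+ell}" for z
  proof -
    have "kap / \<epsilon> * (z - u) \<le> kap / \<epsilon> * ell" using z kap eps by (intro mult_left_mono) auto
    also have "\<dots> = kap * lam / \<sigma>" unfolding ell_def using eps by simp
    finally have "V z \<le> 1 / \<delta>\<^sup>2 + kap * lam / \<sigma>" unfolding V_def by simp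
    then have "V z * (\<sigma> * Kb\<^sup>2) \<le> (1 / \<delta>\<^sup>2 + kap * lam / \<sigma>) * (\<sigma> * Kb\<^sup>2)"
      using sig by (intro mult_right_mono) auto
    also have "\<dots> = \<sigma> * Kb\<^sup>2 / \<delta>\<^sup>2 + kap * lam * Kb\<^sup>2" using sig by (simp add: distrib_right)
    also have "\<dots> \<le> 1/2 + 1/2"
      using sig_small(1) kap(3) pos by (intro add_mono) (auto simp: divide_le_eq)
    finally have 1: "V z * (\<sigma> * Kb\<^sup>2) \<le> 1" by simp
    have "sqrt (V z * (\<sigma> * Kb\<^sup>2)) \<le> sqrt 1" by (rule real_sqrt_le_mono[OF 1])
    then have "sqrt (V z) * (Kb * sqrt \<sigma>) \<le> 1" using Kb0 by (simp add: real_sqrt_mult mult_ac)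
    then show ?thesis unfolding U_def using V[OF z] by (simp add: le_divide_eq mult.commute)
  qed
  have dU: "(U has_real_derivative - (kap / (2 * \<epsilon>)) * (U z) ^ 3) (at z within S)" if z: "z \<in> {u..u+ell}" for z S
  proof -
    have 1: "(V has_real_derivative kap / \<epsilon>) (at z within S)" unfolding V_def
      using eps by (auto intro!: derivative_eq_intros)
    have "((\<lambda>z. sqrt (V z)) has_real_derivative inverse (sqrt (V z)) / 2 * (kap / \<epsilon>)) (at z within S)"
      by (rule DERIV_chain2[OF DERIV_real_sqrt[OF V[OF z]] 1])
    then have "((\<lambda>z. inverse (sqrt (V z))) has_real_derivative
        - (inverse (sqrt (V z)) * (inverse (sqrt (V z)) / 2 * (kap / \<epsilon>)) * inverse (sqrt (V z)))) (at z within S)"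
      using V[OF z] by (intro DERIV_inverse') auto
    moreover have "- (inverse y * (inverse y / 2 * (kap / \<epsilon>)) * inverse y) = - (kap / (2 * \<epsilon>)) * (inverse y) ^ 3" for y :: real
      by (simp add: power3_eq_cube)
    moreover have "U = (\<lambda>z. inverse (sqrt (V z)))" by (rule ext) (simp add: U_def inverse_eq_divide)
    ultimately show ?thesis by (simp only:)
  qed
  have e: "u + ell \<in> {u..u+ell}" using ell_pos by simp
  have "0 \<le> U (u + ell) - (x (u + ell) - (N (u + ell) - N u))"
  proof (rule barrier_nonneg[where D="\<lambda>y. U y - (x y - (N y - N u))" and t="u+ell" and p=u and q="u+ell"
        and D'="\<lambda>y. - (kap / (2 * \<epsilon>)) * (U y) ^ 3 - F (x y) y / \<epsilon>"])
    show "((\<lambda>y. U y - (x y - (N y - N u))) has_real_derivative - (kap / (2 * \<epsilon>)) * (U y) ^ 3 - F (x y) y / \<epsilon>) (at y within {u..u+ell})"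
      if y: "y \<in> {u..u+ell}" for y
    proof (rule DERIV_diff[OF dU[OF y]])
      show "((\<lambda>y. x y - (N y - N u)) has_real_derivative F (x y) y / \<epsilon>) (at y within {u..u+ell})"
        using u y below ell_pos by (intro noise_removed_derivative) auto
    qed
    have "U u = \<delta>" unfolding U_def V_def using pos by (simp add: real_sqrt_divide)
    then show "0 \<le> U u - (x u - (N u - N u))" using below[of u] ell_pos by simp
    show "0 < - (kap / (2 * \<epsilon>)) * (U y) ^ 3 - F (x y) y / \<epsilon>"
      if y: "y \<in> {u..u+ell}" "U y - (x y - (N y - N u)) = 0" for y
    proof -
      have U0: "0 < U y" unfolding U_def using V[OF y(1)] by simp
      have "3 * sqrt lam * sqrt \<sigma> \<le> Kb / 2 * sqrt \<sigma>" using Kb(1) sig by (intro mult_right_mono) auto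
      moreover have "Kb / 2 * sqrt \<sigma> = Kb * sqrt \<sigma> / 2" by simp
      ultimately have xl: "U y / 2 \<le> x y" using n[OF y(1)] Ul[OF y(1)] y(2) unfolding abs_le_iff by linarith
      have "Kb * sqrt \<sigma> / 2 \<le> x y" using xl Ul[OF y(1)] by linarith
      then have "(Kb * sqrt \<sigma> / 2)\<^sup>2 \<le> (x y)\<^sup>2" using Kb0 sig by (intro power_mono) auto
      then have "c * (Kb * sqrt \<sigma> / 2)\<^sup>2 \<le> c * (x y)\<^sup>2" using pos by (intro mult_left_mono) auto
      moreover have "c * (Kb * sqrt \<sigma> / 2)\<^sup>2 = c * Kb\<^sup>2 * \<sigma> / 4" using sig by (simp add: power_mult_distrib power_divide)
      moreover have "8 * A * \<sigma> \<le> c * Kb\<^sup>2 * \<sigma>" using Kb(2) sig by (intro mult_right_mono) auto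
      moreover have "2 * A * s\<^sup>2 \<le> 2 * A * \<sigma>" using sig(2) pos by (intro mult_left_mono) auto
      ultimately have "2 * A * s\<^sup>2 \<le> c * (x y)\<^sup>2" by linarith
      then have "F (x y) y \<le> - (c / 2) * (x y) ^ 3"
        using y(1) u times below[of y] xl U0 by (intro drift_inner_cubic) auto
      also have "\<dots> \<le> - (c / 2) * (U y / 2) ^ 3"
      proof -
        have "(U y / 2) ^ 3 \<le> (x y) ^ 3" using xl U0 by (intro power_mono) auto
        then have "c / 2 * (U y / 2) ^ 3 \<le> c / 2 * (x y) ^ 3" using pos by (intro mult_left_mono) auto
        then show ?thesis by simp
      qed
      also have "\<dots> = - (c / 16) * (U y) ^ 3" by (simp add: power_divide)
      also have "\<dots> \<le> - kap * (U y) ^ 3" using kap(2) U0 by (intro mult_right_mono) auto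
      finally have "F (x y) y / \<epsilon> \<le> - kap * (U y) ^ 3 / \<epsilon>" using eps by (intro divide_right_mono) auto
      moreover have "0 < kap * (U y) ^ 3 / (2 * \<epsilon>)" using kap U0 eps by simp
      moreover have "- kap * (U y) ^ 3 / \<epsilon> = - 2 * (kap * (U y) ^ 3 / (2 * \<epsilon>))" by simp
      moreover have "- (kap / (2 * \<epsilon>)) * (U y) ^ 3 = - (kap * (U y) ^ 3 / (2 * \<epsilon>))" by simp
      ultimately show ?thesis by linarith
    qed
  qed (use e in auto)
  moreover have "U (u + ell) \<le> 1 / sqrt (kap * lam) * sqrt \<sigma>"
  proof -
    have "kap * lam / \<sigma> \<le> V (u + ell)" unfolding V_def ell_def using eps by simp
    then have "sqrt (kap * lam / \<sigma>) \<le> sqrt (V (u + ell))" by (rule real_sqrt_le_mono)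
    moreover have "0 < sqrt (kap * lam / \<sigma>)" using kap lam sig by simp
    ultimately have "U (u + ell) \<le> 1 / sqrt (kap * lam / \<sigma>)" unfolding U_def
      using V[OF e] by (intro divide_left_mono mult_pos_pos) auto
    then show ?thesis by (simp add: real_sqrt_divide)
  qed
  ultimately show ?thesis using n[OF e] unfolding Kp_def abs_le_iff distrib_right by linarith
qed

text \<open>With the linear part of the drift alone the path at the end of the block is at most
\<open>2 Kp sqrt \<sigma> + \<eta>/4\<close> plus the fall of the noise, which is negative.\<close>

lemma no_hit_while_positive:
  assumes u: "t0 \<le> u" "-s \<le> u" "u + ell \<le> t1" and below: "\<And>z. z \<in> {u..u+ell} \<Longrightarrow> x z \<le> \<delta>"
    and xu: "x u \<le> Kp * sqrt \<sigma>"
    and n: "\<And>z. z \<in> {u..u+ell} \<Longrightarrow> N z - N u \<le> 2 * (4 * Kp + 1) * sqrt \<sigma>"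
    and fall: "N (u + ell) - N u \<le> - (4 * Kp + 1) * sqrt \<sigma>"
  shows False
proof -
  define g where "g = A * s\<^sup>2 / \<epsilon>"
  define \<eta> where "\<eta> = 2 * (4 * Kp + 1) * sqrt \<sigma>"
  have g0: "0 \<le> g" unfolding g_def using pos eps by simp
  have eta0: "0 < \<eta>" unfolding \<eta>_def using Kp_ge sig by simp
  have gl: "g * ell \<le> 1/8"
  proof -
    have "A * s\<^sup>2 / \<epsilon> * ell = A * lam * (s\<^sup>2 / \<sigma>)" unfolding ell_def using eps by simp
    also have "\<dots> \<le> A * lam * 1" using sig pos lam by (intro mult_left_mono) auto
    also have "\<dots> \<le> 1/8" using lam(2) by simp
    finally show ?thesis unfolding g_def .
  qed
  have ex: "exp y \<le> 2" if "y \<le> 1/8" for y :: real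
  proof -
    have "exp y \<le> exp (1/8)" using that by simp
    also have "\<dots> \<le> 1 + 1/8 + (1/8)\<^sup>2" by (rule exp_bound) auto
    finally show ?thesis by (simp add: power2_eq_square)
  qed
  define Y where "Y z = x z - (N z - N u)" for z
  have e: "u \<le> u + ell" using ell_pos by simp
  have "Y (u + ell) \<le> exp (integral {u..u+ell} (\<lambda>_. g)) * Y u + \<eta> * 2 * (1/8)"
  proof (rule noisy_gronwall[OF e, where Y'="\<lambda>z. F (x z) z / \<epsilon>" and n="\<lambda>_. \<eta>"])
    fix z assume z: "z \<in> {u..u+ell}"
    show "(Y has_real_derivative F (x z) z / \<epsilon>) (at z within {u..u+ell})"
      unfolding Y_def using u z below ell_pos by (intro noise_removed_derivative) auto
    have xz: "0 < x z" "x z \<le> \<delta>" using x_pos[of z] below[OF z] z u by auto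
    have "F (x z) z \<le> A * s\<^sup>2 * x z - c * (x z) ^ 3" using xz z u times by (intro drift_inner) auto
    moreover have "0 \<le> c * (x z) ^ 3" using xz pos by simp
    ultimately have "F (x z) z \<le> A * s\<^sup>2 * x z" by linarith
    then have "F (x z) z / \<epsilon> \<le> A * s\<^sup>2 * x z / \<epsilon>" using eps by (intro divide_right_mono) auto
    also have "\<dots> = g * x z" unfolding g_def by simp
    also have "\<dots> \<le> g * (Y z + \<eta>)" using n[OF z] g0 unfolding Y_def \<eta>_def by (intro mult_left_mono) auto
    finally show "F (x z) z / \<epsilon> \<le> g * (Y z + \<eta>)" .
    have "g * (u + ell - z) \<le> g * ell" using z g0 by (intro mult_left_mono) auto
    then show "exp (integral {z..u+ell} (\<lambda>_. g)) \<le> 2" using z gl by (intro ex) (simp add: mult.commute)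
    show "\<bar>\<eta>\<bar> \<le> \<eta>" using eta0 by simp
  next
    show "continuous_on {u..u+ell} (\<lambda>_. g)" by simp
    show "integral {u..u+ell} (\<lambda>_. \<bar>g\<bar>) \<le> 1/8" using gl g0 ell_pos by (simp add: mult.commute)
  qed
  also have "exp (integral {u..u+ell} (\<lambda>_. g)) * Y u \<le> 2 * (Kp * sqrt \<sigma>)"
  proof (rule mult_mono)
    show "exp (integral {u..u+ell} (\<lambda>_. g)) \<le> 2" using gl ell_pos by (intro ex) (simp add: mult.commute)
    show "Y u \<le> Kp * sqrt \<sigma>" unfolding Y_def using xu by simp
    show "0 \<le> Y u" unfolding Y_def using x_pos[of u] u ell_pos by (simp add: less_imp_le)
  qed auto
  finally have "x (u + ell) \<le> 2 * (Kp * sqrt \<sigma>) + \<eta> / 4 + (N (u + ell) - N u)" unfolding Y_def by simp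
  also have "\<dots> \<le> 2 * (Kp * sqrt \<sigma>) + \<eta> / 4 - (4 * Kp + 1) * sqrt \<sigma>" using fall by (simp add: algebra_simps)
  also have "\<dots> = - (1/2) * sqrt \<sigma>" unfolding \<eta>_def by (simp add: algebra_simps)
  also have "\<dots> < 0" using sig by simp
  finally show False using x_pos[of "u + ell"] u ell_pos by simp
qed

lemma noise_scale: "\<sigma> / sqrt \<epsilon> * sqrt ell = sqrt lam * sqrt \<sigma>"
proof -
  have "sqrt ell = sqrt lam * sqrt \<epsilon> / sqrt \<sigma>" unfolding ell_def by (simp add: real_sqrt_mult real_sqrt_divide)
  then have "\<sigma> / sqrt \<epsilon> * sqrt ell = sqrt lam * (\<sigma> / sqrt \<sigma>)" using eps by simp
  also have "\<sigma> / sqrt \<sigma> = sqrt \<sigma>" using sig by (intro real_div_sqrt) simp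
  finally show ?thesis .
qed

lemma survival_avoids_hits:
  fixes n i :: nat
  assumes u: "t0 \<le> u" "-s \<le> u" "u + 2 * ell * real n \<le> t1" and xu: "x u \<le> 7/8 * \<delta>"
    and F: "\<And>j z. j < 2 * n \<Longrightarrow> z \<in> {u + ell * real j..u + ell * real j + ell} \<Longrightarrow>
        \<bar>w z - w (u + ell * real j)\<bar> \<le> \<delta> / 32 * sqrt \<epsilon> / \<sigma>"
    and k: "i < n"
  shows "\<not> noise_hit w (u + 2 * ell * real i) ell q"
proof
  assume hit: "noise_hit w (u + 2 * ell * real i) ell q"
  have sc: "0 < \<sigma> / sqrt \<epsilon>" using sig eps by simp
  have inside: "u + ell * real j + ell \<le> t1" if "j < 2 * n" for j
  proof -
    have "ell * (real j + 1) \<le> ell * (2 * real n)" using that ell_pos by (intro mult_left_mono) auto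
    then show ?thesis using u(3) by (simp add: algebra_simps)
  qed
  have left: "t0 \<le> u + ell * real j" "-s \<le> u + ell * real j" for j
  proof -
    have "0 \<le> ell * real j" using ell_pos by simp
    then show "t0 \<le> u + ell * real j" "-s \<le> u + ell * real j" using u by linarith+
  qed
  have nb: "\<bar>N z - N (u + ell * real j)\<bar> \<le> \<delta> / 32"
    if "j < 2 * n" "z \<in> {u + ell * real j..u + ell * real j + ell}" for j z
  proof -
    have "\<bar>N z - N (u + ell * real j)\<bar> = \<sigma> / sqrt \<epsilon> * \<bar>w z - w (u + ell * real j)\<bar>"
      unfolding N_def right_diff_distrib[symmetric] by (simp only: abs_mult abs_of_pos[OF sc])
    also have "\<dots> \<le> \<sigma> / sqrt \<epsilon> * (\<delta> / 32 * sqrt \<epsilon> / \<sigma>)" using F[OF that] sc by (intro mult_left_mono) auto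
    also have "\<dots> = \<delta> / 32" using sig eps by simp
    finally show ?thesis .
  qed
  have xb: "x (u + ell * real j) \<le> 7/8 * \<delta>" if "j \<le> 2 * n" for j
    using that
  proof (induction j)
    case 0 then show ?case using xu by simp
  next
    case (Suc j)
    then have "x (u + ell * real j + ell) \<le> 7/8 * \<delta>"
      using inside[of j] left[of j] nb[of j] by (intro block_no_exit(2)) auto
    then show ?case by (simp add: algebra_simps)
  qed
  have below: "x z \<le> \<delta>" if "j < 2 * n" "z \<in> {u + ell * real j..u + ell * real j + ell}" for j z
  proof -
    have "x z < \<delta>"
      using inside[OF that(1)] left[of j] xb[of j] nb[OF that(1)] that by (intro block_no_exit(1)[of "u + ell * real j"]) auto
    then show ?thesis by simp
  qed
  let ?a = "u + ell * real (2 * i)" and ?b = "u + ell * real (2 * i + 1)"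
  have ab: "?b = ?a + ell" "u + 2 * ell * real i = ?a" by (simp_all add: algebra_simps)
  have k2: "2 * i < 2 * n" "2 * i + 1 < 2 * n" using k by auto
  have para: "\<exists>\<tau>'\<in>{0..1}. z = y + ell * \<tau>'" if "z \<in> {y..y + ell}" for y z
    using that ell_pos by (intro bexI[of _ "(z - y) / ell"]) (auto simp: field_simps)
  have Ndiff: "N z - N y = \<sigma> / sqrt \<epsilon> * (w z - w y)" for z y unfolding N_def by (simp add: right_diff_distrib)
  have "x (?a + ell) \<le> Kp * sqrt \<sigma>"
  proof (rule descent)
    show "t0 \<le> ?a" "-s \<le> ?a" by (rule left)+
    show "?a + ell \<le> t1" using inside[OF k2(1)] .
    show "x z \<le> \<delta>" if "z \<in> {?a..?a+ell}" for z using below[OF k2(1) that] .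
    show "\<bar>N z - N ?a\<bar> \<le> 3 * sqrt lam * sqrt \<sigma>" if z: "z \<in> {?a..?a+ell}" for z
    proof -
      obtain \<tau>' where "\<tau>' \<in> {0..1}" "z = ?a + ell * \<tau>'" using para[OF z] by blast
      then have "\<bar>w z - w ?a\<bar> \<le> 3 * sqrt ell" using hit unfolding noise_hit_def ab(2) by blast
      then have "\<sigma> / sqrt \<epsilon> * \<bar>w z - w ?a\<bar> \<le> \<sigma> / sqrt \<epsilon> * (3 * sqrt ell)" using sc by (intro mult_left_mono) auto
      also have "\<dots> = 3 * (\<sigma> / sqrt \<epsilon> * sqrt ell)" by simp
      also have "\<dots> = 3 * sqrt lam * sqrt \<sigma>" unfolding noise_scale by simp
      finally show ?thesis unfolding Ndiff abs_mult abs_of_pos[OF sc] .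
    qed
  qed
  have qs: "\<sigma> / sqrt \<epsilon> * (q * sqrt ell) = (4 * Kp + 1) * sqrt \<sigma>"
  proof -
    have "\<sigma> / sqrt \<epsilon> * (q * sqrt ell) = q * (\<sigma> / sqrt \<epsilon> * sqrt ell)" by simp
    also have "\<dots> = (4 * Kp + 1) * sqrt \<sigma>" unfolding noise_scale q_def using lam by simp
    finally show ?thesis .
  qed
  show False
  proof (rule no_hit_while_positive[of ?b])
    show "t0 \<le> ?b" "-s \<le> ?b" using left by blast+
    show "?b + ell \<le> t1" using inside[OF k2(2)] .
    show "x z \<le> \<delta>" if "z \<in> {?b..?b+ell}" for z using below[OF k2(2) that] .
    show "x ?b \<le> Kp * sqrt \<sigma>" using \<open>x (?a + ell) \<le> Kp * sqrt \<sigma>\<close> unfolding ab(1) .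
    show "N z - N ?b \<le> 2 * (4 * Kp + 1) * sqrt \<sigma>" if z: "z \<in> {?b..?b+ell}" for z
    proof -
      obtain \<tau>' where "\<tau>' \<in> {0..1}" "z = ?b + ell * \<tau>'" using para[OF z] by blast
      then have "w z - w ?b \<le> 2 * q * sqrt ell" using hit unfolding noise_hit_def ab(2) ab(1) by blast
      then have "\<sigma> / sqrt \<epsilon> * (w z - w ?b) \<le> \<sigma> / sqrt \<epsilon> * (2 * q * sqrt ell)" using sc by (intro mult_left_mono) auto
      also have "\<dots> = 2 * (\<sigma> / sqrt \<epsilon> * (q * sqrt ell))" by simp
      also have "\<dots> = 2 * (4 * Kp + 1) * sqrt \<sigma>" unfolding qs by simp
      finally show ?thesis unfolding Ndiff .
    qed
    have "w (?b + ell) - w ?b \<le> - q * sqrt ell" using hit unfolding noise_hit_def ab(2) ab(1) by blast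
    then have "\<sigma> / sqrt \<epsilon> * (w (?b + ell) - w ?b) \<le> \<sigma> / sqrt \<epsilon> * (- q * sqrt ell)" using sc by (intro mult_left_mono) auto
    also have "\<dots> = - (\<sigma> / sqrt \<epsilon> * (q * sqrt ell))" by simp
    also have "\<dots> = - (4 * Kp + 1) * sqrt \<sigma>" unfolding qs by (simp only: mult_minus_left)
    finally show "N (?b + ell) - N ?b \<le> - (4 * Kp + 1) * sqrt \<sigma>" unfolding Ndiff .
  qed
qed

end

section \<open>The survival probability\<close>

text \<open>The integral of \<open>t\<^sup>2\<close> measures time in units of contraction; equal steps in
\<open>t^3\<close> are chunks of equal contraction.\<close>

lemma cube_partition:
  fixes a b \<Delta> :: real
  assumes b: "0 < b" "b \<le> a" and D: "0 < \<Delta>"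
  obtains \<rho> :: "nat \<Rightarrow> real" and n :: nat where
    "\<rho> 0 = a" "\<rho> n = b" "\<And>j. j < n \<Longrightarrow> \<rho> (Suc j) < \<rho> j" "\<And>j. b \<le> \<rho> j" "\<And>j. \<rho> j \<le> a"
    "\<And>j. j < n \<Longrightarrow> \<rho> j ^ 3 - \<rho> (Suc j) ^ 3 \<le> \<Delta>"
    "\<And>j. Suc j < n \<Longrightarrow> \<rho> j ^ 3 - \<rho> (Suc j) ^ 3 = \<Delta>"
    "real n \<le> (a ^ 3 - b ^ 3) / \<Delta> + 1"
proof -
  define g where "g j = max (a ^ 3 - real j * \<Delta>) (b ^ 3)" for j
  define \<rho> where "\<rho> j = root 3 (g j)" for j
  define n where "n = nat \<lceil>(a ^ 3 - b ^ 3) / \<Delta>\<rceil>"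
  have ab: "b ^ 3 \<le> a ^ 3" using b by (intro power_mono) auto
  have g0: "0 \<le> g j" for j unfolding g_def using b by (simp add: le_max_iff_disj)
  have cube: "\<rho> j ^ 3 = g j" for j unfolding \<rho>_def using g0[of j] by (intro real_root_pow_pos2) auto
  have rc: "root 3 (b ^ 3) = b" "root 3 (a ^ 3) = a" using b by (auto intro!: real_root_power_cancel)
  have q0: "0 \<le> (a ^ 3 - b ^ 3) / \<Delta>" using ab D by simp
  have n1: "(a ^ 3 - b ^ 3) / \<Delta> \<le> real n" "real n < (a ^ 3 - b ^ 3) / \<Delta> + 1" unfolding n_def using q0 by linarith+
  have before: "b ^ 3 < a ^ 3 - real j * \<Delta>" if "j < n" for j
  proof -
    have "real j + 1 \<le> real n" using that by linarith
    then have "real j < (a ^ 3 - b ^ 3) / \<Delta>" using n1 by linarith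
    then show ?thesis using D by (simp add: less_divide_eq)
  qed
  have gj: "g j = a ^ 3 - real j * \<Delta>" if "j < n" for j using before[OF that] unfolding g_def by simp
  show thesis
  proof (rule that[of \<rho> n])
    show "\<rho> 0 = a" unfolding \<rho>_def g_def using ab rc by (simp add: max_def)
    have "a ^ 3 - real n * \<Delta> \<le> b ^ 3" using n1(1) D by (simp add: divide_le_eq)
    then show "\<rho> n = b" unfolding \<rho>_def g_def using rc by (simp add: max_def)
    fix j
    show "\<rho> (Suc j) < \<rho> j" if "j < n"
    proof -
      have "g (Suc j) < g j" using before[OF that] gj[OF that] D unfolding g_def[of "Suc j"] by (simp add: algebra_simps)
      then show ?thesis unfolding \<rho>_def by simp
    qed
    show "b \<le> \<rho> j"
    proof -
      have "root 3 (b ^ 3) \<le> \<rho> j" unfolding \<rho>_def g_def by simp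
      then show ?thesis using rc by simp
    qed
    show "\<rho> j \<le> a"
    proof -
      have "g j \<le> a ^ 3" unfolding g_def using ab D by simp
      then have "\<rho> j \<le> root 3 (a ^ 3)" unfolding \<rho>_def by simp
      then show ?thesis using rc by simp
    qed
    show "\<rho> j ^ 3 - \<rho> (Suc j) ^ 3 \<le> \<Delta>" if "j < n"
      unfolding cube using gj[OF that] unfolding g_def[of "Suc j"] by (simp add: algebra_simps max_def)
    show "\<rho> j ^ 3 - \<rho> (Suc j) ^ 3 = \<Delta>" if "Suc j < n"
      unfolding cube using gj[OF that] gj[of j] that by (simp add: algebra_simps)
    show "real n \<le> (a ^ 3 - b ^ 3) / \<Delta> + 1" using n1 by simp
  qed
qed

text \<open>The numerical conditions of \<open>blocks\<close> without a path, so that the constants below are available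
before a path is chosen.\<close>

locale regime = window +
  fixes \<sigma> lam kap Kb :: real
  assumes sig: "0 < \<sigma>" "s\<^sup>2 \<le> \<sigma>"
    and lam: "0 < lam" "8 * A * lam \<le> 1"
    and Kb: "6 * sqrt lam \<le> Kb" "8 * A \<le> c * Kb\<^sup>2"
    and kap: "0 < kap" "16 * kap \<le> c" "kap * lam * Kb\<^sup>2 \<le> 1/2"
    and sig_small: "\<sigma> * Kb\<^sup>2 \<le> \<delta>\<^sup>2 / 2" "\<sigma> < c * \<delta>\<^sup>2 * lam / 2"
    and s_small: "8 * A * s\<^sup>2 \<le> c * \<delta>\<^sup>2" "8 * C * s \<le> \<delta>"
begin

text \<open>The decrease of \<open>t^3\<close> over a chunk that makes \<open>alphabar\<close> decrease by \<open>\<epsilon>\<close>.\<close>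

definition step :: real where "step = \<epsilon> * (C0 + 1) / c3"
definition J where "J = C2 * (C0 + 1) / (3 * c3)"
text \<open>The admissible noise per chunk, relative to \<open>h/\<rho>\<close>.\<close>

definition qn where "qn = sqrt c4 / (4 * (4 * C / m + 1) * (1 + 2 * C / m * J))"
definition \<kappa>1 where "\<kappa>1 = qn\<^sup>2 * c3 / (2 * (C0 + 1))"
definition \<kappa>2 where "\<kappa>2 = \<delta>\<^sup>2 / (2048 * lam)"
definition bl where "bl = lam * \<epsilon> / \<sigma>"
definition qh where "qh = (4 * (1 / sqrt (kap * lam) + 3 * sqrt lam) + 1) / sqrt lam"

lemma step_pos: "0 < step" unfolding step_def using eps C0_nonneg c3 by simp

lemma bl_pos: "0 < bl" unfolding bl_def using lam eps sig by simp

lemma J_nonneg: "0 \<le> J" unfolding J_def using C2_pos C0_nonneg c3 by simp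

lemma qn_pos: "0 < qn" unfolding qn_def using c4_pos C_pos pos J_nonneg
  by (intro divide_pos_pos mult_pos_pos add_pos_nonneg add_nonneg_pos) auto

lemma \<kappa>1_pos: "0 < \<kappa>1" unfolding \<kappa>1_def using qn_pos c3 C0_nonneg by simp

lemma \<kappa>2_pos: "0 < \<kappa>2" unfolding \<kappa>2_def using pos lam by simp

lemma qh_ge: "3 \<le> qh"
proof -
  have "0 \<le> 1 / sqrt (kap * lam)" using kap lam by simp
  moreover have "0 < sqrt lam" using lam by simp
  moreover have "3 * y \<le> 4 * (z + 3 * y) + 1" if "0 \<le> z" "0 < y" for y z :: real using that by simp
  ultimately have "3 * sqrt lam \<le> 4 * (1 / sqrt (kap * lam) + 3 * sqrt lam) + 1" by blast
  then show ?thesis unfolding qh_def using lam by (simp add: le_divide_eq)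
qed

lemma blocksI:
  assumes t: "-T \<le> t0" "t0 \<le> t1" "t1 \<le> s"
    and "continuous_on {t0..t1} x" "\<And>v. v \<in> {t0..t1} \<Longrightarrow> 0 < x v"
    and "\<And>v. v \<in> {t0..t1} \<Longrightarrow> set_integrable lborel {t0..v} (\<lambda>u. F (x u) u) \<and>
        x v = x0 + (1/\<epsilon>) * (LBINT u:{t0..v}. F (x u) u) + \<sigma> / sqrt \<epsilon> * (w v - w t0)"
  shows "blocks F ft X d T r \<delta> B \<tau> x1 c A m k \<epsilon> xdet p K s C c3 \<sigma> t0 t1 x0 w x lam kap Kb"
  by unfold_locales (use assms sig lam Kb kap sig_small s_small in \<open>blast+\<close>)

text \<open>The two stages combined: either the path starts inside the window, or \<open>approach_bound\<close> brings it
there; in both cases it enters the window below \<open>7/8 \<delta>\<close>.\<close>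

lemma good_path_has_no_hit:
  fixes n i :: nat
  assumes bl: "blocks F ft X d T r \<delta> B \<tau> x1 c A m k \<epsilon> xdet p K s C c3 \<sigma> t0 t1 x0 w x lam kap Kb"
    and t1: "-s \<le> t1" and h: "0 < h"
    and envelope: "\<And>v. v \<in> {t0..t1} \<Longrightarrow> xdet v + h * sqrt (zeta d F T \<epsilon> xdet v) < \<delta>"
    and start: "x0 \<le> xdet t0 + 1/2 * h * sqrt (zeta d F T \<epsilon> xdet t0)"
    and n: "max t0 (-s) + 2 * bl * real n \<le> t1"
    and chunks: "t0 \<le> -s \<Longrightarrow> \<rho> 0 = - t0" "t0 \<le> -s \<Longrightarrow> \<rho> N = s" "\<And>j. t0 \<le> -s \<Longrightarrow> j < N \<Longrightarrow> \<rho> (Suc j) < \<rho> j"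
      "\<And>j. t0 \<le> -s \<Longrightarrow> j < N \<Longrightarrow> \<rho> j ^ 3 - \<rho> (Suc j) ^ 3 \<le> step"
      "\<And>j. t0 \<le> -s \<Longrightarrow> Suc j < N \<Longrightarrow> \<rho> j ^ 3 - \<rho> (Suc j) ^ 3 = step"
    and noise1: "\<And>j z. t0 \<le> -s \<Longrightarrow> j < N \<Longrightarrow> z \<in> {- \<rho> j..- \<rho> (Suc j)} \<Longrightarrow>
        \<bar>w z - w (- \<rho> j)\<bar> \<le> qn * h / \<rho> j * sqrt \<epsilon> / \<sigma>"
    and noise2: "\<And>j z. j < 2 * n \<Longrightarrow> z \<in> {max t0 (-s) + bl * real j..max t0 (-s) + bl * real j + bl} \<Longrightarrow>
        \<bar>w z - w (max t0 (-s) + bl * real j)\<bar> \<le> \<delta> / 32 * sqrt \<epsilon> / \<sigma>"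
    and i: "i < n"
  shows "\<not> noise_hit w (max t0 (-s) + 2 * bl * real i) bl qh"
proof -
  note Cs = s_small(2)
  interpret blocks F ft X d T r \<delta> B \<tau> x1 c A m k \<epsilon> xdet p K s C c3 \<sigma> t0 t1 x0 w x lam kap Kb by (rule bl)
  have ell: "ell = bl" unfolding ell_def bl_def ..
  have q: "q = qh" unfolding q_def Kp_def qh_def ..
  have sc: "0 < \<sigma> / sqrt \<epsilon>" using sig eps by simp
  have t0in: "t0 \<in> {t0..t1}" using times by simp
  have xt0: "x t0 = x0"
  proof -
    have "(LBINT u:{t0..t0}. F (x u) u) = integral {t0..t0} (\<lambda>u. F (x u) u)"
      using x_eq[OF t0in] by (intro set_borel_integral_eq_integral) auto
    then show ?thesis using x_eq[OF t0in] by simp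
  qed
  have inner: "xdet v \<le> \<delta> / 8" if "v \<in> {-s..s}" for v using xdet_upper_right[OF that] Cs by linarith
  have hz: "h * sqrt (zeta d F T \<epsilon> xdet v) < \<delta>" if "v \<in> {t0..t1}" for v
    using envelope[OF that] xdet_pos[of v] that times by auto
  have xu: "x (max t0 (-s)) \<le> 7/8 * \<delta>"
  proof (cases "t0 \<le> -s")
    case True
    have ms: "-s \<in> {t0..t1}" "-s \<in> {-s..s}" using True t1 s by auto
    have "x (-s) \<le> xdet (-s) + 3/4 * h * sqrt (zeta d F T \<epsilon> xdet (-s))"
    proof (rule approach_bound[where \<rho>=\<rho> and n=N and q=qn and J=J])
      show "C2 * (\<rho> j ^ 3 - \<rho> (Suc j) ^ 3) \<le> 3 * \<epsilon> * J" if "j < N" for j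
      proof -
        have "C2 * (\<rho> j ^ 3 - \<rho> (Suc j) ^ 3) \<le> C2 * step" using chunks(4)[OF True that] C2_pos by (intro mult_left_mono) auto
        also have "\<dots> = 3 * \<epsilon> * J" unfolding step_def J_def using c3 by simp
        finally show ?thesis .
      qed
      show "\<epsilon> * (C0 + 1) \<le> c3 * (\<rho> j ^ 3 - \<rho> (Suc j) ^ 3)" if "Suc j < N" for j
        using chunks(5)[OF True that] c3 unfolding step_def by simp
      show "\<bar>noisy_path.N \<epsilon> \<sigma> w z - noisy_path.N \<epsilon> \<sigma> w (- \<rho> j)\<bar> \<le> qn * h / \<rho> j" if "j < N" "z \<in> {- \<rho> j..- \<rho> (Suc j)}" for j z
      proof -
        have "\<bar>local.N z - local.N (- \<rho> j)\<bar> = \<sigma> / sqrt \<epsilon> * \<bar>w z - w (- \<rho> j)\<bar>"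
          unfolding N_def right_diff_distrib[symmetric] by (simp only: abs_mult abs_of_pos[OF sc])
        also have "\<dots> \<le> \<sigma> / sqrt \<epsilon> * (qn * h / \<rho> j * sqrt \<epsilon> / \<sigma>)" using noise1[OF True that] sc by (intro mult_left_mono) auto
        also have "\<dots> = qn * h / \<rho> j" using sig eps by simp
        finally show ?thesis .
      qed
      have "0 < 4 * (4 * C / m + 1) * (1 + 2 * C / m * J)"
        using C_pos pos J_nonneg by (intro mult_pos_pos add_pos_nonneg add_nonneg_pos) auto
      moreover have "D * (v / D) \<le> v" if "0 < D" for D v :: real using that by simp
      ultimately show "4 * (4 * C / m + 1) * (1 + 2 * C / m * J) * qn \<le> sqrt c4" unfolding qn_def by blast
      show "\<rho> (Suc j) \<le> \<rho> j" if "j < N" for j using chunks(3)[OF True that] by simp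
      show "xdet v + h * sqrt (zeta d F T \<epsilon> xdet v) < \<delta>" if "v \<in> {t0..- s}" for v using envelope[of v] that t1 by auto
      show "x t0 \<le> xdet t0 + 1 / 2 * h * sqrt (zeta d F T \<epsilon> xdet t0)" using start xt0 by simp
    qed (use t1 h qn_pos J_nonneg chunks(1,2) True in auto)
    moreover have "3/4 * h * sqrt (zeta d F T \<epsilon> xdet (-s)) \<le> 3/4 * \<delta>" using hz[OF ms(1)] by linarith
    ultimately have "x (-s) \<le> 7/8 * \<delta>" using inner[OF ms(2)] by linarith
    then show ?thesis using True by (simp add: max_def)
  next
    case False
    have "x0 \<le> \<delta> / 8 + 1/2 * \<delta>" using start inner[of t0] hz[OF t0in] False times by auto
    then have "x t0 \<le> 7/8 * \<delta>" using xt0 pos(4) by linarith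
    then show ?thesis using False by (simp add: max_def)
  qed
  have "\<not> noise_hit w (max t0 (-s) + 2 * ell * real i) ell q"
  proof (rule survival_avoids_hits[where n=n])
    show "t0 \<le> max t0 (-s)" "-s \<le> max t0 (-s)" by auto
    show "max t0 (-s) + 2 * ell * real n \<le> t1" using n unfolding ell .
    show "\<bar>w z - w (max t0 (-s) + ell * real j)\<bar> \<le> \<delta> / 32 * sqrt \<epsilon> / \<sigma>"
      if "j < 2 * n" "z \<in> {max t0 (-s) + ell * real j..max t0 (-s) + ell * real j + ell}" for j z
      using noise2 that unfolding ell .
  qed (rule xu, rule i)
  then show ?thesis unfolding ell q .
qed

text \<open>Union bound over the chunks, the blocks and the avoidance of all hits. The noise in chunk \<open>j\<close>
has a variance proportional to the length of the chunk, which is at most \<open>step/\<rho>(j)\<^sup>2\<close>; this is what makes all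
chunks contribute equally.\<close>

lemma survival_probability:
  fixes M :: "'w measure" and n :: nat
  assumes t: "-T \<le> t0" "t0 \<le> t1" "-s \<le> t1" "t1 \<le> s" and h: "0 < h"
    and envelope: "\<And>v. v \<in> {t0..t1} \<Longrightarrow> xdet v + h * sqrt (zeta d F T \<epsilon> xdet v) < \<delta>"
    and start: "x0 \<le> xdet t0 + 1/2 * h * sqrt (zeta d F T \<epsilon> xdet t0)"
    and W: "standard_wiener M t0 W" and sol: "sde_solution F \<epsilon> \<sigma> t0 t1 x0 M W x"
    and n: "max t0 (-s) + 2 * bl * real n \<le> t1"
    and Nc: "1 \<le> Nc" "t0 \<le> -s \<Longrightarrow> ((- t0) ^ 3 - s ^ 3) / step + 1 \<le> Nc"
  shows "measure M {\<omega>\<in>space M. \<forall>v\<in>{t0..t1}. 0 < x v \<omega>}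
    \<le> Nc * (4 * exp (- \<kappa>1 * (h\<^sup>2 / \<sigma>\<^sup>2))) + 2 * real n * (4 * exp (- \<kappa>2 / \<sigma>)) + (1 - hit_prob qh) ^ n"
proof -
  interpret prob_space M using W by (simp add: standard_wiener_def)
  let ?u = "max t0 (-s)"
  obtain \<rho> N where part: "t0 \<le> -s \<Longrightarrow> \<rho> 0 = - t0" "t0 \<le> -s \<Longrightarrow> \<rho> N = s" "\<And>j. t0 \<le> -s \<Longrightarrow> j < N \<Longrightarrow> \<rho> (Suc j) < \<rho> j"
      "\<And>j. t0 \<le> -s \<Longrightarrow> s \<le> \<rho> j" "\<And>j. t0 \<le> -s \<Longrightarrow> \<rho> j \<le> - t0"
      "\<And>j. t0 \<le> -s \<Longrightarrow> j < N \<Longrightarrow> \<rho> j ^ 3 - \<rho> (Suc j) ^ 3 \<le> step"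
      "\<And>j. t0 \<le> -s \<Longrightarrow> Suc j < N \<Longrightarrow> \<rho> j ^ 3 - \<rho> (Suc j) ^ 3 = step"
      "real N \<le> Nc" "\<not> t0 \<le> -s \<Longrightarrow> N = 0"
  proof (cases "t0 \<le> -s")
    case True
    then have st: "s \<le> - t0" by simp
    obtain \<rho> :: "nat \<Rightarrow> real" and N where P: "\<rho> 0 = - t0" "\<rho> N = s" "\<And>j. j < N \<Longrightarrow> \<rho> (Suc j) < \<rho> j" "\<And>j. s \<le> \<rho> j" "\<And>j. \<rho> j \<le> - t0"
      "\<And>j. j < N \<Longrightarrow> \<rho> j ^ 3 - \<rho> (Suc j) ^ 3 \<le> step"
      "\<And>j. Suc j < N \<Longrightarrow> \<rho> j ^ 3 - \<rho> (Suc j) ^ 3 = step"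
      "real N \<le> ((- t0) ^ 3 - s ^ 3) / step + 1"
      using cube_partition[OF s(1) st step_pos] by blast
    show thesis
    proof (rule that[of \<rho> N])
      show "real N \<le> Nc" by (rule order_trans[OF P(8) Nc(2)[OF True]])
    qed (use P True in blast)+
  next
    case False
    then show thesis using that[of "\<lambda>_. 0" 0] Nc(1) by simp
  qed
  let ?R = "\<lambda>j. qn * h / \<rho> j * sqrt \<epsilon> / \<sigma>"
  define PE where "PE j E \<longleftrightarrow> E \<in> events \<and> prob E \<le> 4 * exp (- \<kappa>1 * (h\<^sup>2 / \<sigma>\<^sup>2)) \<and>
      (AE \<omega> in M. \<omega> \<notin> E \<longrightarrow> (\<forall>v\<in>{- \<rho> j..- \<rho> (Suc j)}. \<bar>W v \<omega> - W (- \<rho> j) \<omega>\<bar> \<le> ?R j))" for j E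
  have exE: "\<exists>E. PE j E" if j: "j < N" for j
  proof -
    have le: "t0 \<le> -s" using part(9) j by (cases "t0 \<le> -s") auto
    have rj: "0 < \<rho> j" "0 < \<rho> (Suc j)" using part(4)[OF le, of j] part(4)[OF le, of "Suc j"] s by auto
    define l where "l = \<rho> j - \<rho> (Suc j)"
    have l: "0 < l" unfolding l_def using part(3)[OF le j] by simp
    have u: "t0 \<le> - \<rho> j" using part(5)[OF le, of j] by simp
    have R: "0 \<le> ?R j" using qn_pos h rj sig eps by simp
    obtain E where E: "E \<in> events" "prob E \<le> 4 * exp (- (?R j)\<^sup>2 / (2 * l))"
      "AE \<omega> in M. \<omega> \<notin> E \<longrightarrow> (\<forall>v\<in>{- \<rho> j..- \<rho> j + l}. \<bar>W v \<omega> - W (- \<rho> j) \<omega>\<bar> \<le> ?R j)"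
      by (rule wiener_maximal_inequality[OF W u l R])
    have e: "- \<rho> j + l = - \<rho> (Suc j)" unfolding l_def by simp
    have "\<kappa>1 * (h\<^sup>2 / \<sigma>\<^sup>2) \<le> (?R j)\<^sup>2 / (2 * l)"
    proof -
      have "l * (\<rho> j)\<^sup>2 \<le> \<rho> j ^ 3 - \<rho> (Suc j) ^ 3"
      proof -
        have "\<rho> (Suc j) * (\<rho> (Suc j))\<^sup>2 \<le> \<rho> (Suc j) * (\<rho> j)\<^sup>2"
          using rj part(3)[OF le j] by (intro mult_left_mono power_mono) auto
        then show ?thesis unfolding l_def by (simp add: power2_eq_square power3_eq_cube algebra_simps)
      qed
      also have "\<dots> \<le> step" by (rule part(6)[OF le j])
      finally have ls: "l * (\<rho> j)\<^sup>2 \<le> step" .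
      have "\<kappa>1 * (h\<^sup>2 / \<sigma>\<^sup>2) = (qn\<^sup>2 * h\<^sup>2 * \<epsilon> / \<sigma>\<^sup>2) / (2 * step)"
        
      proof -
        have "u * v / (2 * w) * (y / z) = u * y * e / z / (2 * (e * w / v))"
          if "0 < e" "0 < v" for u v w y z e :: real
          using that by (simp add: field_simps)
        from this[OF eps c3(1)] show ?thesis unfolding \<kappa>1_def step_def .
      qed
      also have "\<dots> \<le> (qn\<^sup>2 * h\<^sup>2 * \<epsilon> / \<sigma>\<^sup>2) / (2 * (l * (\<rho> j)\<^sup>2))"
        using ls l rj eps step_pos by (intro divide_left_mono) auto
      also have "\<dots> = (?R j)\<^sup>2 / (2 * l)"
        using eps by (simp add: power_mult_distrib power_divide)
      finally show ?thesis .
    qed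
    then have "exp (- (?R j)\<^sup>2 / (2 * l)) \<le> exp (- \<kappa>1 * (h\<^sup>2 / \<sigma>\<^sup>2))" by simp
    then have "prob E \<le> 4 * exp (- \<kappa>1 * (h\<^sup>2 / \<sigma>\<^sup>2))" using E(2) by linarith
    then show ?thesis unfolding PE_def by (intro exI[of _ E] conjI E(1) E(3)[unfolded e])
  qed
  have "\<forall>j. \<exists>E. j < N \<longrightarrow> PE j E" using exE by blast
  from choice[OF this] obtain E where PE: "\<forall>j. j < N \<longrightarrow> PE j (E j)" ..
  then have E: "\<And>j. j < N \<Longrightarrow> E j \<in> events" "\<And>j. j < N \<Longrightarrow> prob (E j) \<le> 4 * exp (- \<kappa>1 * (h\<^sup>2 / \<sigma>\<^sup>2))"
    "\<And>j. j < N \<Longrightarrow> AE \<omega> in M. \<omega> \<notin> E j \<longrightarrow> (\<forall>v\<in>{- \<rho> j..- \<rho> (Suc j)}. \<bar>W v \<omega> - W (- \<rho> j) \<omega>\<bar> \<le> ?R j)"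
    unfolding PE_def by blast+
  have ut0: "t0 \<le> ?u" by simp
  let ?Q = "\<delta> / 32 * sqrt \<epsilon> / \<sigma>"
  define PG where "PG j G \<longleftrightarrow> G \<in> events \<and> prob G \<le> 4 * exp (- \<kappa>2 / \<sigma>) \<and>
      (AE \<omega> in M. \<omega> \<notin> G \<longrightarrow> (\<forall>v\<in>{?u + bl * real j..?u + bl * real j + bl}. \<bar>W v \<omega> - W (?u + bl * real j) \<omega>\<bar> \<le> ?Q))" for j :: nat and G
  have exG: "\<exists>G. PG j G" for j
  proof -
    have u: "t0 \<le> ?u + bl * real j" using bl_pos by (intro add_increasing2 ut0) auto
    have Q: "0 \<le> ?Q" using pos sig eps by simp
    obtain G where G: "G \<in> events" "prob G \<le> 4 * exp (- ?Q\<^sup>2 / (2 * bl))"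
      "AE \<omega> in M. \<omega> \<notin> G \<longrightarrow> (\<forall>v\<in>{?u + bl * real j..?u + bl * real j + bl}. \<bar>W v \<omega> - W (?u + bl * real j) \<omega>\<bar> \<le> ?Q)"
      by (rule wiener_maximal_inequality[OF W u bl_pos Q])
    have e: "- ?Q\<^sup>2 / (2 * bl) = - \<kappa>2 / \<sigma>"
    proof -
      have "- (a / 32 * sqrt e / v)\<^sup>2 / (2 * (l * e / v)) = - (a\<^sup>2 / (2048 * l)) / v"
        if "0 < e" "0 < v" "0 < l" for a e v l :: real
      proof -
        have "(a / 32 * sqrt e / v)\<^sup>2 = a\<^sup>2 * e / (1024 * (v * v))"
          using that by (simp add: power_mult_distrib power_divide power2_eq_square[of v])
        then show ?thesis using that by simp
      qed
      from this[OF eps sig(1) lam(1)] show ?thesis unfolding bl_def \<kappa>2_def .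
    qed
    show ?thesis unfolding PG_def by (intro exI[of _ G] conjI G(1) G(2)[unfolded e] G(3))
  qed
  have "\<forall>j. \<exists>G. PG j G" using exG by blast
  from choice[OF this] obtain G where PG: "\<forall>j. PG j (G j)" ..
  then have G: "\<And>j::nat. G j \<in> events" "\<And>j::nat. prob (G j) \<le> 4 * exp (- \<kappa>2 / \<sigma>)"
    "\<And>j::nat. AE \<omega> in M. \<omega> \<notin> G j \<longrightarrow> (\<forall>v\<in>{?u + bl * real j..?u + bl * real j + bl}. \<bar>W v \<omega> - W (?u + bl * real j) \<omega>\<bar> \<le> ?Q)"
    unfolding PG_def by blast+
  obtain H where H: "H \<in> events" "prob H \<le> (1 - hit_prob qh) ^ n"
    "AE \<omega> in M. (\<forall>i<n. \<not> noise_hit (\<lambda>t. W t \<omega>) (?u + 2 * bl * real i) bl qh) \<longrightarrow> \<omega> \<in> H"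
    by (rule wiener_hit_avoidance[OF W ut0 bl_pos qh_ge])
  let ?bad = "((\<Union>j\<in>{..<N}. E j) \<union> (\<Union>j\<in>{..<2*n}. G j)) \<union> H"
  have UE: "(\<Union>j\<in>{..<N}. E j) \<in> events" by (rule sets.finite_UN) (use E(1) in auto)
  have UG: "(\<Union>j\<in>{..<2*n}. G j) \<in> events" by (rule sets.finite_UN) (use G(1) in auto)
  have bad: "?bad \<in> events" by (rule sets.Un[OF sets.Un[OF UE UG] H(1)])
  have pE: "prob (\<Union>j\<in>{..<N}. E j) \<le> Nc * (4 * exp (- \<kappa>1 * (h\<^sup>2 / \<sigma>\<^sup>2)))"
  proof -
    have "prob (\<Union>j\<in>{..<N}. E j) \<le> (\<Sum>j<N. prob (E j))"
      by (rule finite_measure_subadditive_finite) (use E(1) in auto)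
    also have "\<dots> \<le> (\<Sum>j<N. 4 * exp (- \<kappa>1 * (h\<^sup>2 / \<sigma>\<^sup>2)))" by (rule sum_mono) (use E(2) in auto)
    also have "\<dots> = real N * (4 * exp (- \<kappa>1 * (h\<^sup>2 / \<sigma>\<^sup>2)))" by simp
    also have "\<dots> \<le> Nc * (4 * exp (- \<kappa>1 * (h\<^sup>2 / \<sigma>\<^sup>2)))" using part(8) by (intro mult_right_mono) auto
    finally show ?thesis .
  qed
  have pG: "prob (\<Union>j\<in>{..<2*n}. G j) \<le> 2 * real n * (4 * exp (- \<kappa>2 / \<sigma>))"
  proof -
    have "prob (\<Union>j\<in>{..<2*n}. G j) \<le> (\<Sum>j<2*n. prob (G j))"
      by (rule finite_measure_subadditive_finite) (use G(1) in auto)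
    also have "\<dots> \<le> (\<Sum>j<2*n. 4 * exp (- \<kappa>2 / \<sigma>))" by (rule sum_mono) (use G(2) in auto)
    finally show ?thesis by simp
  qed
  have AE_E: "AE \<omega> in M. \<forall>j\<in>{..<N}. \<omega> \<notin> E j \<longrightarrow> (\<forall>v\<in>{- \<rho> j..- \<rho> (Suc j)}. \<bar>W v \<omega> - W (- \<rho> j) \<omega>\<bar> \<le> ?R j)"
    by (subst AE_ball_countable) (use E(3) in auto)
  have AE_G: "AE \<omega> in M. \<forall>j\<in>{..<2*n}. \<omega> \<notin> G j \<longrightarrow> (\<forall>v\<in>{?u + bl * real j..?u + bl * real j + bl}. \<bar>W v \<omega> - W (?u + bl * real j) \<omega>\<bar> \<le> ?Q)"
    by (subst AE_ball_countable) (use G(3) in auto)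
  have AE_x: "AE \<omega> in M. \<forall>v\<in>{t0..t1}. set_integrable lborel {t0..v} (\<lambda>u. F (x u \<omega>) u) \<and>
        x v \<omega> = x0 + (1/\<epsilon>) * (LBINT u:{t0..v}. F (x u \<omega>) u) + \<sigma> / sqrt \<epsilon> * (W v \<omega> - W t0 \<omega>)"
    using sol unfolding sde_solution_def by blast
  have xc: "continuous_on {t0..t1} (\<lambda>v. x v \<omega>)" if "\<omega> \<in> space M" for \<omega>
    using sol that unfolding sde_solution_def by blast
  let ?S = "{\<omega>\<in>space M. \<forall>v\<in>{t0..t1}. 0 < x v \<omega>}"
  have "AE \<omega> in M. \<omega> \<in> ?S \<longrightarrow> \<omega> \<in> ?bad"
    using AE_E AE_G AE_x H(3)
  proof eventually_elim
    case (elim \<omega>)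
    note cE = elim(1) and cG = elim(2) and cx = elim(3) and cH = elim(4)
    show ?case
    proof (intro impI, rule ccontr)
      assume S: "\<omega> \<in> ?S" and nb: "\<omega> \<notin> ?bad"
      have bl: "blocks F ft X d T r \<delta> B \<tau> x1 c A m k \<epsilon> xdet p K s C c3 \<sigma> t0 t1 x0 (\<lambda>t. W t \<omega>) (\<lambda>t. x t \<omega>) lam kap Kb"
        by (rule blocksI) (use t S xc cx in auto)
      have n1: "\<bar>W z \<omega> - W (- \<rho> j) \<omega>\<bar> \<le> ?R j" if "j < N" "z \<in> {- \<rho> j..- \<rho> (Suc j)}" for j z
        using cE nb that by auto
      have n2: "\<bar>W z \<omega> - W (?u + bl * real j) \<omega>\<bar> \<le> ?Q" if "j < 2 * n" "z \<in> {?u + bl * real j..?u + bl * real j + bl}" for j z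
        using cG nb that by blast
      have "\<not> noise_hit (\<lambda>t. W t \<omega>) (?u + 2 * bl * real i) bl qh" if i: "i < n" for i
        by (rule good_path_has_no_hit[OF bl t(3) h envelope start n part(1,2,3,6,7) n1 n2 i])
      then have "\<omega> \<in> H" using cH by blast
      then show False using nb by blast
    qed
  qed
  then have "prob ?S \<le> prob ?bad" by (rule finite_measure_mono_AE[OF _ bad])
  also have "\<dots> \<le> prob ((\<Union>j\<in>{..<N}. E j) \<union> (\<Union>j\<in>{..<2*n}. G j)) + prob H"
    by (rule measure_Un_le[OF sets.Un[OF UE UG] H(1)])
  also have "\<dots> \<le> prob (\<Union>j\<in>{..<N}. E j) + prob (\<Union>j\<in>{..<2*n}. G j) + prob H"
    using measure_Un_le[OF UE UG] by simp
  finally show ?thesis using pE pG H(2) by linarith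
qed

end

section \<open>Absorbing constants and choosing the number of blocks\<close>

text \<open>If \<open>\<kappa> y \<le> 1/2\<close>, the right-hand side exceeds one. Otherwise \<open>exp (-\<kappa> Cb y)\<close> absorbs
the constant.\<close>

lemma absorb_constant:
  fixes y L Cb \<kappa>0 \<kappa> P R :: real
  assumes P1: "P \<le> 1" and P2: "P \<le> Cb * L * exp (- \<kappa>0 * y) + R" and R: "0 \<le> R"
    and L: "1 \<le> L" and Cb: "1 \<le> Cb" and k: "0 < \<kappa>" "\<kappa> * (Cb + 1) \<le> \<kappa>0" and y: "0 \<le> y"
  shows "P \<le> 5/2 * L * exp (- \<kappa> * y) + R"
proof (cases "\<kappa> * y \<le> 1/2")
  case True
  have "1 - \<kappa> * y \<le> exp (- (\<kappa> * y))" using exp_ge_add_one_self[of "- (\<kappa> * y)"] by simp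
  then have "1/2 \<le> exp (- \<kappa> * y)" using True by simp
  then have "5/2 * 1 * (1/2) \<le> 5/2 * L * exp (- \<kappa> * y)" using L by (intro mult_mono) auto
  then show ?thesis using P1 R by linarith
next
  case False
  have "\<kappa> * (Cb + 1) * y \<le> \<kappa>0 * y" using k(2) y by (rule mult_right_mono)
  then have "exp (- \<kappa>0 * y) \<le> exp (- (\<kappa> * y) - Cb * (\<kappa> * y))" by (simp add: algebra_simps)
  also have "\<dots> = exp (- \<kappa> * y) * exp (- (Cb * (\<kappa> * y)))" by (simp add: exp_diff exp_minus field_simps)
  finally have 1: "exp (- \<kappa>0 * y) \<le> exp (- \<kappa> * y) * exp (- (Cb * (\<kappa> * y)))" .
  have "Cb * (1/2) \<le> Cb * (\<kappa> * y)" using False Cb by (intro mult_left_mono) auto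
  then have "2/5 * Cb \<le> exp (Cb * (\<kappa> * y))" using exp_ge_add_one_self[of "Cb * (\<kappa> * y)"] Cb by linarith
  then have 2: "Cb * exp (- (Cb * (\<kappa> * y))) \<le> 5/2" by (simp add: exp_minus field_simps)
  have "Cb * L * exp (- \<kappa>0 * y) \<le> Cb * L * (exp (- \<kappa> * y) * exp (- (Cb * (\<kappa> * y))))"
    using 1 Cb L by (intro mult_left_mono) auto
  also have "\<dots> = (Cb * exp (- (Cb * (\<kappa> * y)))) * (L * exp (- \<kappa> * y))" by (simp add: mult_ac)
  also have "\<dots> \<le> 5/2 * (L * exp (- \<kappa> * y))" using 2 L by (intro mult_right_mono) auto
  finally show ?thesis using P2 by simp
qed

lemma linear_times_exp_le:
  fixes y k :: real
  assumes "0 < k" "0 \<le> y"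
  shows "(y + 1) * exp (- k * y) \<le> (2 / k + 1) * exp (- (k / 2) * y)"
proof -
  have "k / 2 * y \<le> exp (k / 2 * y)" using exp_ge_add_one_self[of "k / 2 * y"] by linarith
  then have 1: "y \<le> 2 / k * exp (k / 2 * y)" using assms by (simp add: field_simps)
  have 2: "1 \<le> 1 * exp (k / 2 * y)" using assms by simp
  have "y + 1 \<le> (2 / k + 1) * exp (k / 2 * y)" unfolding distrib_right by (rule add_mono[OF 1 2])
  then have "(y + 1) * exp (- k * y) \<le> (2 / k + 1) * exp (k / 2 * y) * exp (- k * y)" by (intro mult_right_mono) auto
  also have "\<dots> = (2 / k + 1) * (exp (k / 2 * y) * exp (- k * y))" by simp
  also have "exp (k / 2 * y) * exp (- k * y) = exp (- (k / 2) * y)" by (simp add: exp_add[symmetric])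
  finally show ?thesis .
qed

context regime begin

definition \<kappa>3 :: real where "\<kappa>3 = min \<kappa>1 (min (\<kappa>2 / 2) (hit_prob qh) * c4 / \<delta>\<^sup>2)"
definition Cbig :: real where "Cbig = 8 + 8 * (2 / \<kappa>2 + 1) + 1"

text \<open>The number \<open>n\<close> of pairs of blocks is as large as the window permits, but not larger than
about \<open>1/\<sigma>\<close>. In the first case \<open>(1-p)^n\<close> yields the second term of the bound, in the second case it is of order
\<open>exp (-p/\<sigma>)\<close> and belongs to the first term, like the exits from the blocks, because \<open>h\<^sup>2/\<sigma>\<^sup>2\<close> is at most of
order \<open>1/\<sigma>\<close>.\<close>

lemma survival_bound:
  fixes M :: "'w measure"
  assumes t: "-T \<le> t0" "t0 \<le> t1" "-s \<le> t1" "t1 \<le> s" and h: "2 * \<sigma> < h"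
    and envelope: "\<And>v. v \<in> {t0..t1} \<Longrightarrow> xdet v + h * sqrt (zeta d F T \<epsilon> xdet v) < \<delta>"
    and start: "x0 \<le> xdet t0 + 1/2 * h * sqrt (zeta d F T \<epsilon> xdet t0)"
    and W: "standard_wiener M t0 W" and sol: "sde_solution F \<epsilon> \<sigma> t0 t1 x0 M W x"
    and \<kappa>: "0 < \<kappa>" "\<kappa> * (Cbig + 1) \<le> \<kappa>3" "\<kappa> \<le> hit_prob qh"
  shows "measure M {\<omega>\<in>space M. \<forall>v\<in>{t0..t1}. 0 < x v \<omega>}
    \<le> 5/2 * (\<bar>alphabar d F xdet t1 t0\<bar> / \<epsilon> + 1) * exp (- \<kappa> * h\<^sup>2 / \<sigma>\<^sup>2)
      + 2 * exp (- \<kappa> * (1 / ln (h / \<sigma>)) * (alpha d F t1 (max t0 (-s)) / \<epsilon>))"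
proof -
  interpret prob_space M using W by (simp add: standard_wiener_def)
  define L where "L = \<bar>alphabar d F xdet t1 t0\<bar> / \<epsilon> + 1"
  define y where "y = h\<^sup>2 / \<sigma>\<^sup>2"
  define P where "P = hit_prob qh"
  have P: "0 < P" "P \<le> 1/2" unfolding P_def using hit_prob_bounds[OF qh_ge] by auto
  have L1: "1 \<le> L" unfolding L_def using eps by simp
  have h0: "0 < h" using h sig by linarith
  let ?u = "max t0 (-s)"
  have ut1: "?u \<le> t1" using t by auto
  define n1 where "n1 = nat \<lfloor>(t1 - ?u) / (2 * bl)\<rfloor>"
  define n2 where "n2 = nat \<lceil>1 / \<sigma>\<rceil>"
  define n where "n = min n1 n2"
  have q0: "0 \<le> (t1 - ?u) / (2 * bl)" using ut1 bl_pos by simp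
  have n1: "real n1 \<le> (t1 - ?u) / (2 * bl)" "(t1 - ?u) / (2 * bl) \<le> real n1 + 1" unfolding n1_def using q0 by linarith+
  have s0: "0 \<le> 1 / \<sigma>" using sig by simp
  have n2: "1 / \<sigma> \<le> real n2" "real n2 \<le> 1 / \<sigma> + 1" unfolding n2_def using s0 by linarith+
  have nb: "?u + 2 * bl * real n \<le> t1"
  proof -
    have "real n \<le> (t1 - ?u) / (2 * bl)" using n1(1) unfolding n_def by simp
    then have "real n * (2 * bl) \<le> t1 - ?u" using bl_pos by (simp add: le_divide_eq)
    then show ?thesis by (simp add: mult_ac)
  qed
  have Nc: "((- t0) ^ 3 - s ^ 3) / step + 1 \<le> 2 * L" if le: "t0 \<le> -s"
  proof -
    have "width t1 = s" using t unfolding width_def by auto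
    then have "alphabar d F xdet t1 t0 \<le> \<epsilon> * C0 - c3 * ((- t0) ^ 3 - s ^ 3)" using alphabar_upper[of t0 t1] le t by simp
    then have "c3 * ((- t0) ^ 3 - s ^ 3) \<le> \<bar>alphabar d F xdet t1 t0\<bar> + \<epsilon> * C0" by linarith
    then have "c3 * ((- t0) ^ 3 - s ^ 3) / \<epsilon> \<le> (\<bar>alphabar d F xdet t1 t0\<bar> + \<epsilon> * C0) / \<epsilon>" using eps by (intro divide_right_mono) auto
    also have "\<dots> = \<bar>alphabar d F xdet t1 t0\<bar> / \<epsilon> + C0" using eps by (simp add: add_divide_distrib)
    also have "\<dots> \<le> L * (C0 + 1)"
    proof -
      have "v + C' \<le> (v + 1) * (C' + 1)" if "0 \<le> v" "0 \<le> C'" for v C' :: real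
        using mult_nonneg_nonneg[OF that] that by (simp add: algebra_simps)
      then show ?thesis unfolding L_def using eps C0_nonneg by simp
    qed
    finally have le': "c3 * ((- t0) ^ 3 - s ^ 3) / \<epsilon> \<le> L * (C0 + 1)" .
    have "0 < C0 + 1" using C0_nonneg by simp
    from le' have "c3 * ((- t0) ^ 3 - s ^ 3) / \<epsilon> / (C0 + 1) \<le> L"
      unfolding pos_divide_le_eq[OF \<open>0 < C0 + 1\<close>] .
    moreover have "((- t0) ^ 3 - s ^ 3) / step = c3 * ((- t0) ^ 3 - s ^ 3) / \<epsilon> / (C0 + 1)"
      unfolding step_def by simp
    ultimately show ?thesis using L1 by linarith
  qed
  let ?S = "{\<omega>\<in>space M. \<forall>v\<in>{t0..t1}. 0 < x v \<omega>}"
  have main: "prob ?S \<le> 2 * L * (4 * exp (- \<kappa>1 * y)) + 2 * real n * (4 * exp (- \<kappa>2 / \<sigma>)) + (1 - P) ^ n"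
    unfolding y_def P_def
    by (rule survival_probability[OF t(1,2,3,4) h0 envelope start W sol nb _ Nc]) (use L1 in auto)
  have sy: "c4 / \<delta>\<^sup>2 * y \<le> 1 / \<sigma>"
  proof -
    have t1in: "t1 \<in> {-T..s}" "t1 \<in> {t0..t1}" using t by auto
    have "width t1 = s" using t unfolding width_def by auto
    then have z: "c4 / s\<^sup>2 \<le> zeta d F T \<epsilon> xdet t1" using zeta_lower[OF t1in(1)] by simp
    have z0: "0 \<le> zeta d F T \<epsilon> xdet t1" by (rule order_trans[OF _ z]) (use c4_pos s in simp)
    have "h * sqrt (zeta d F T \<epsilon> xdet t1) \<le> \<delta>" using envelope[OF t1in(2)] xdet_pos[OF t1in(1)] by simp
    then have "(h * sqrt (zeta d F T \<epsilon> xdet t1))\<^sup>2 \<le> \<delta>\<^sup>2" using h0 z0 by (intro power_mono) auto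
    then have "h\<^sup>2 * zeta d F T \<epsilon> xdet t1 \<le> \<delta>\<^sup>2" using z0 by (simp add: power_mult_distrib)
    moreover have "h\<^sup>2 * (c4 / s\<^sup>2) \<le> h\<^sup>2 * zeta d F T \<epsilon> xdet t1" using z by (intro mult_left_mono) auto
    ultimately have "h\<^sup>2 * (c4 / s\<^sup>2) \<le> \<delta>\<^sup>2" by linarith
    then have "h\<^sup>2 * c4 \<le> \<delta>\<^sup>2 * s\<^sup>2" using s by (simp add: divide_le_eq)
    also have "\<dots> \<le> \<delta>\<^sup>2 * \<sigma>" using sig by (intro mult_left_mono) auto
    finally show ?thesis unfolding y_def using sig pos by (simp add: field_simps power2_eq_square)
  qed
  have y0: "0 \<le> y" unfolding y_def by simp
  have k3: "\<kappa>3 \<le> \<kappa>1" "\<kappa>3 * y \<le> \<kappa>2 / 2 * (1 / \<sigma>)" "\<kappa>3 * y \<le> P * (1 / \<sigma>)"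
  proof -
    show "\<kappa>3 \<le> \<kappa>1" unfolding \<kappa>3_def by simp
    have "\<kappa>3 \<le> min (\<kappa>2 / 2) P * (c4 / \<delta>\<^sup>2)" unfolding \<kappa>3_def P_def by simp
    then have "\<kappa>3 * y \<le> min (\<kappa>2 / 2) P * (c4 / \<delta>\<^sup>2) * y" using y0 by (rule mult_right_mono)
    also have "\<dots> = min (\<kappa>2 / 2) P * (c4 / \<delta>\<^sup>2 * y)" by simp
    also have "\<dots> \<le> min (\<kappa>2 / 2) P * (1 / \<sigma>)" using sy \<kappa>2_pos P by (intro mult_left_mono) auto
    finally have 1: "\<kappa>3 * y \<le> min (\<kappa>2 / 2) P * (1 / \<sigma>)" .
    have "min (\<kappa>2 / 2) P * (1 / \<sigma>) \<le> \<kappa>2 / 2 * (1 / \<sigma>)" "min (\<kappa>2 / 2) P * (1 / \<sigma>) \<le> P * (1 / \<sigma>)"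
      by (rule mult_right_mono[OF min.cobounded1 s0], rule mult_right_mono[OF min.cobounded2 s0])
    with 1 show "\<kappa>3 * y \<le> \<kappa>2 / 2 * (1 / \<sigma>)" "\<kappa>3 * y \<le> P * (1 / \<sigma>)" by linarith+
  qed
  have T1: "2 * L * (4 * exp (- \<kappa>1 * y)) \<le> 8 * L * exp (- \<kappa>3 * y)"
  proof -
    have "\<kappa>3 * y \<le> \<kappa>1 * y" using k3(1) y0 by (rule mult_right_mono)
    then have "exp (- \<kappa>1 * y) \<le> exp (- \<kappa>3 * y)" by simp
    then have "8 * L * exp (- \<kappa>1 * y) \<le> 8 * L * exp (- \<kappa>3 * y)" using L1 by (intro mult_left_mono) auto
    then show ?thesis by simp
  qed
  have T2: "2 * real n * (4 * exp (- \<kappa>2 / \<sigma>)) \<le> 8 * (2 / \<kappa>2 + 1) * L * exp (- \<kappa>3 * y)"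
  proof -
    have "real n \<le> 1 / \<sigma> + 1" using n2(2) unfolding n_def by simp
    then have "2 * real n * (4 * exp (- \<kappa>2 / \<sigma>)) \<le> 2 * (1 / \<sigma> + 1) * (4 * exp (- \<kappa>2 / \<sigma>))"
      by (intro mult_right_mono) auto
    also have "\<dots> = 8 * ((1 / \<sigma> + 1) * exp (- \<kappa>2 * (1 / \<sigma>)))" by simp
    also have "\<dots> \<le> 8 * ((2 / \<kappa>2 + 1) * exp (- (\<kappa>2 / 2) * (1 / \<sigma>)))"
      using linear_times_exp_le[OF \<kappa>2_pos s0] by simp
    also have "\<dots> \<le> 8 * ((2 / \<kappa>2 + 1) * exp (- \<kappa>3 * y))"
      using k3(2) \<kappa>2_pos by (intro mult_left_mono) auto
    also have "\<dots> \<le> 8 * ((2 / \<kappa>2 + 1) * exp (- \<kappa>3 * y)) * L"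
      using L1 \<kappa>2_pos mult_left_mono[OF L1, of "8 * ((2 / \<kappa>2 + 1) * exp (- \<kappa>3 * y))"] by simp
    also have "8 * (e * e') * L = 8 * e * L * e'" for e e' :: real by simp
    finally show ?thesis .
  qed
  have pw: "(1 - P) ^ i \<le> exp (- P * real i)" for i
  proof -
    have "1 - P \<le> exp (- P)" using exp_ge_add_one_self[of "- P"] by simp
    then have "(1 - P) ^ i \<le> exp (- P) ^ i" using P by (intro power_mono) auto
    then show ?thesis by (simp add: exp_of_nat_mult[symmetric] mult.commute)
  qed
  have T4: "(1 - P) ^ n2 \<le> L * exp (- \<kappa>3 * y)"
  proof -
    have "\<kappa>3 * y \<le> P * real n2" using k3(3) mult_left_mono[OF n2(1), of P] P by simp
    then have "exp (- P * real n2) \<le> exp (- \<kappa>3 * y)" by simp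
    then have "(1 - P) ^ n2 \<le> exp (- \<kappa>3 * y)" using pw[of n2] by linarith
    also have "\<dots> \<le> L * exp (- \<kappa>3 * y)" using L1 by simp
    finally show ?thesis .
  qed
  define R where "R = 2 * exp (- \<kappa> * (1 / ln (h / \<sigma>)) * (alpha d F t1 ?u / \<epsilon>))"
  have T3: "(1 - P) ^ n1 \<le> R"
  proof -
    have al: "alpha d F t1 ?u \<le> A * s\<^sup>2 * (t1 - ?u)"
    proof -
      have ai: "(\<lambda>v. ddx d F 0 v) integrable_on {?u..t1}"
      proof (rule integrable_continuous_real)
        have "continuous_on {?u..t1} (\<lambda>v. (0::real, v))" by (intro continuous_intros)
        moreover have "(\<lambda>v. (0::real, v)) ` {?u..t1} \<subseteq> {-d..d} \<times> UNIV" using pos by auto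
        ultimately have "continuous_on {?u..t1} (\<lambda>v. (\<lambda>(x, t). ddx d F x t) (0, v))"
          using continuous_on_compose2[OF fx_continuous] by blast
        then show "continuous_on {?u..t1} (\<lambda>v. ddx d F 0 v)" by simp
      qed
      have "integral {?u..t1} (\<lambda>v. ddx d F 0 v) \<le> integral {?u..t1} (\<lambda>_. A * s\<^sup>2)"
      proof (rule integral_le[OF ai])
        fix v assume v: "v \<in> {?u..t1}"
        then have "width v = s" unfolding width_def by auto
        then show "ddx d F 0 v \<le> A * s\<^sup>2" using a_le_width[of v] v t s pos by auto
      qed auto
      also have "\<dots> = A * s\<^sup>2 * (t1 - ?u)" using ut1 by simp
      finally show ?thesis unfolding alpha_def .
    qed
    have "A * s\<^sup>2 * (t1 - ?u) \<le> A * \<sigma> * (2 * bl * (real n1 + 1))"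
    proof (rule mult_mono)
      show "t1 - ?u \<le> 2 * bl * (real n1 + 1)" using n1(2) bl_pos by (simp add: divide_le_eq mult_ac)
    qed (use sig pos ut1 in auto)
    also have "\<dots> = 2 * (A * lam) * (real n1 + 1) * \<epsilon>" unfolding bl_def using sig by simp
    also have "\<dots> \<le> 1/4 * (real n1 + 1) * \<epsilon>" using lam(2) eps by (intro mult_right_mono) auto
    finally have "alpha d F t1 ?u \<le> 1/4 * (real n1 + 1) * \<epsilon>" using al by linarith
    then have ae: "alpha d F t1 ?u / \<epsilon> \<le> 1/4 * (real n1 + 1)" using eps by (simp add: divide_le_eq)
    have lnh: "1/2 \<le> ln (h / \<sigma>)"
    proof -
      have "2 \<le> h / \<sigma>" using h sig by (simp add: le_divide_eq)
      then have "ln 2 \<le> ln (h / \<sigma>)" by (intro ln_mono) auto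
      moreover have "1/2 \<le> ln (2::real)" using ln_add_one_self_le_self2[of "-1/2"] by (simp add: ln_div)
      ultimately show ?thesis by linarith
    qed
    then have "1 / ln (h / \<sigma>) \<le> 2" "0 \<le> 1 / ln (h / \<sigma>)" by (auto simp: divide_le_eq)
    moreover have "\<kappa> * (1 / ln (h / \<sigma>)) * (alpha d F t1 ?u / \<epsilon>) \<le> \<kappa> * (1 / ln (h / \<sigma>)) * (1/4 * (real n1 + 1))"
      using ae \<kappa> calculation(2) by (intro mult_left_mono) auto
    moreover have "\<kappa> * (1 / ln (h / \<sigma>)) * (1/4 * (real n1 + 1)) \<le> \<kappa> * 2 * (1/4 * (real n1 + 1))"
      using calculation(1) \<kappa> by (intro mult_right_mono mult_left_mono) auto
    ultimately have ex: "\<kappa> * (1 / ln (h / \<sigma>)) * (alpha d F t1 ?u / \<epsilon>) \<le> \<kappa> / 2 * (real n1 + 1)" by simp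
    have kP: "\<kappa> \<le> P" using \<kappa>(3) unfolding P_def .
    have "\<kappa> / 2 * real n1 \<le> P * real n1" using kP \<kappa>(1) by (intro mult_right_mono) auto
    then have "- (P * real n1) \<le> 1/2 + - (\<kappa> * (1 / ln (h / \<sigma>)) * (alpha d F t1 ?u / \<epsilon>))"
      using ex kP P(2) by (simp add: distrib_left)
    then have "exp (- P * real n1) \<le> exp (1/2 + - (\<kappa> * (1 / ln (h / \<sigma>)) * (alpha d F t1 ?u / \<epsilon>)))" by simp
    also have "\<dots> = exp (1/2) * exp (- \<kappa> * (1 / ln (h / \<sigma>)) * (alpha d F t1 ?u / \<epsilon>))" by (simp only: exp_add mult_minus_left)
    also have "\<dots> \<le> R"
    proof -
      have "exp (1/2::real) \<le> 1 + 1/2 + (1/2)\<^sup>2" by (rule exp_bound) auto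
      then have "exp (1/2::real) \<le> 2" by (simp add: power2_eq_square)
      then show ?thesis unfolding R_def by (intro mult_right_mono) auto
    qed
    finally show ?thesis using pw[of n1] by linarith
  qed
  have n_le: "(1 - P) ^ n \<le> (1 - P) ^ n1 + (1 - P) ^ n2"
    unfolding n_def using P by (cases "n1 \<le> n2") (auto simp: min_def)
  have R0: "0 \<le> R" unfolding R_def by simp
  have Cb1: "1 \<le> Cbig" unfolding Cbig_def using \<kappa>2_pos by (simp add: add_nonneg_nonneg)
  have "prob ?S \<le> Cbig * L * exp (- \<kappa>3 * y) + R"
    using main T1 T2 T3 T4 n_le unfolding Cbig_def by (simp add: distrib_right)
  from absorb_constant[OF prob_le_1 this R0 L1 Cb1 \<kappa>(1,2) y0]
  show ?thesis unfolding L_def R_def y_def by simp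
qed

text \<open>It does not depend on \<open>r\<close>, \<open>\<epsilon>\<close>, \<open>\<sigma>\<close> or \<open>s\<close>, and can therefore be chosen before them.\<close>

definition K0 :: real where "K0 = min (\<kappa>3 / (Cbig + 1)) (hit_prob qh)"

lemma Cbig_ge: "1 \<le> Cbig" unfolding Cbig_def using \<kappa>2_pos by (simp add: add_nonneg_nonneg)

lemma K0_pos: "0 < K0"
  unfolding K0_def \<kappa>3_def using \<kappa>1_pos \<kappa>2_pos hit_prob_bounds(1)[OF qh_ge] c4_pos pos Cbig_ge by simp

lemma K0_le: "\<kappa> \<le> K0 \<Longrightarrow> \<kappa> * (Cbig + 1) \<le> \<kappa>3" "\<kappa> \<le> K0 \<Longrightarrow> \<kappa> \<le> hit_prob qh"
  unfolding K0_def using Cbig_ge by (auto simp: le_divide_eq)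

end

section \<open>Uniform constants for the symmetric drift\<close>

text \<open>The \<open>x\<close>-derivative along the strip is a partial derivative of any function \<open>G\<close> that extends \<open>h\<close>; applied
to \<open>h = ddx d g\<close> this identifies the iterated derivatives with the ones provided by \<open>Ck_bounded\<close>.\<close>

lemma ddx_eq:
  assumes d: "0 < d" and x: "x \<in> {-d..d}"
    and D: "(G has_derivative (\<lambda>v. gx * fst v + gt * snd v)) (at (x, t) within {-d..d} \<times> UNIV)"
    and eq: "\<And>y. y \<in> {-d..d} \<Longrightarrow> h y t = G (y, t)"
  shows "ddx d h x t = gx" and "((\<lambda>y. h y t) has_real_derivative gx) (at x within {-d..d})"
proof -
  have g: "((\<lambda>y. (y, t)) has_derivative (\<lambda>v. (v, 0))) (at x within {-d..d})"
    by (auto intro!: derivative_eq_intros)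
  have "(G has_derivative (\<lambda>v. gx * fst v + gt * snd v)) (at (x, t) within (\<lambda>y. (y, t)) ` {-d..d})"
    by (rule has_derivative_subset[OF D]) auto
  from has_derivative_in_compose[OF g this]
  have "((\<lambda>y. G (y, t)) has_real_derivative gx) (at x within {-d..d})" by (simp add: has_field_derivative_def)
  then show 1: "((\<lambda>y. h y t) has_real_derivative gx) (at x within {-d..d})"
    by (rule has_field_derivative_transform_within[OF _ zero_less_one x]) (use eq in auto)
  then have "((\<lambda>y. h y t) has_vector_derivative gx) (at x within {-d..d})"
    by (simp add: has_real_derivative_iff_has_vector_derivative)
  then show "ddx d h x t = gx" unfolding ddx_def
    using d x by (intro vector_derivative_within_closed_interval) auto
qed

lemma smooth_partials:
  assumes d: "0 < d" and g: "Ck_bounded 4 B ({-d..d} \<times> UNIV) (\<lambda>(x, t). g x t)"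
  obtains ft where
    "\<And>x t. x \<in> {-d..d} \<Longrightarrow>
      ((\<lambda>(x, t). g x t) has_derivative (\<lambda>v. ddx d g x t * fst v + ft x t * snd v)) (at (x, t) within {-d..d} \<times> UNIV)"
    "\<And>x t. x \<in> {-d..d} \<Longrightarrow> \<bar>ddx d g x t\<bar> \<le> B"
    "\<And>x t. x \<in> {-d..d} \<Longrightarrow> \<bar>ft x t\<bar> \<le> B"
    "\<And>x t. x \<in> {-d..d} \<Longrightarrow> ((\<lambda>y. ddx d g y t) has_real_derivative (ddx d ^^ 2) g x t) (at x within {-d..d})"
    "\<And>x t. x \<in> {-d..d} \<Longrightarrow> \<bar>(ddx d ^^ 2) g x t\<bar> \<le> B"
    "\<And>x t. x \<in> {-d..d} \<Longrightarrow> ((\<lambda>y. (ddx d ^^ 2) g y t) has_real_derivative (ddx d ^^ 3) g x t) (at x within {-d..d})"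
    "\<And>x t. x \<in> {-d..d} \<Longrightarrow> \<bar>(ddx d ^^ 3) g x t\<bar> \<le> B"
    "continuous_on ({-d..d} \<times> UNIV) (\<lambda>(x, t). ddx d g x t)"
    "\<And>x t. x \<in> {-d..d} \<Longrightarrow> \<bar>(ddx d ^^ 3) g x t - (ddx d ^^ 3) g 0 0\<bar> \<le> 2 * B * (\<bar>x\<bar> + \<bar>t\<bar>)"
proof -
  let ?S = "{-d..d} \<times> (UNIV :: real set)"
  let ?g = "\<lambda>(x, t). g x t"
  have four: "4 = Suc (Suc (Suc (Suc 0)))" by simp
  obtain gx gt where 1: "\<forall>p\<in>?S. (?g has_derivative (\<lambda>v. gx p * fst v + gt p * snd v)) (at p within ?S)"
      "Ck_bounded (Suc (Suc (Suc 0))) B ?S gx" "Ck_bounded (Suc (Suc (Suc 0))) B ?S gt"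
    using g unfolding four Ck_bounded.simps(2)[of "Suc (Suc (Suc 0))"] by blast
  obtain gxx gxt where 2: "\<forall>p\<in>?S. (gx has_derivative (\<lambda>v. gxx p * fst v + gxt p * snd v)) (at p within ?S)"
      "Ck_bounded (Suc (Suc 0)) B ?S gxx" "\<forall>p\<in>?S. \<bar>gx p\<bar> \<le> B"
    using 1(2) unfolding Ck_bounded.simps(2)[of "Suc (Suc 0)"] by blast
  obtain gxxx gxxt where 3: "\<forall>p\<in>?S. (gxx has_derivative (\<lambda>v. gxxx p * fst v + gxxt p * snd v)) (at p within ?S)"
      "Ck_bounded (Suc 0) B ?S gxxx" "\<forall>p\<in>?S. \<bar>gxx p\<bar> \<le> B"
    using 2(2) unfolding Ck_bounded.simps(2)[of "Suc 0"] by blast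
  obtain h k where 4: "\<forall>p\<in>?S. (gxxx has_derivative (\<lambda>v. h p * fst v + k p * snd v)) (at p within ?S)"
      "\<forall>p\<in>?S. \<bar>h p\<bar> \<le> B" "\<forall>p\<in>?S. \<bar>k p\<bar> \<le> B" "\<forall>p\<in>?S. \<bar>gxxx p\<bar> \<le> B"
    using 3(2) unfolding Ck_bounded.simps by blast
  have gtb: "\<forall>p\<in>?S. \<bar>gt p\<bar> \<le> B" using 1(3) unfolding Ck_bounded.simps(2)[of "Suc (Suc 0)"] by blast
  have mem: "(x, t) \<in> ?S" if "x \<in> {-d..d}" for x t using that by simp
  have D1: "((\<lambda>(x, t). g x t) has_derivative (\<lambda>v. gx (x, t) * fst v + gt (x, t) * snd v)) (at (x, t) within ?S)"
    if "x \<in> {-d..d}" for x t using 1(1) mem[OF that] by blast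
  have e1: "ddx d g x t = gx (x, t)" if "x \<in> {-d..d}" for x t
    by (rule ddx_eq(1)[OF d that D1[OF that]]) simp
  have D2: "(gx has_derivative (\<lambda>v. gxx (x, t) * fst v + gxt (x, t) * snd v)) (at (x, t) within ?S)"
    if "x \<in> {-d..d}" for x t using 2(1) mem[OF that] by blast
  have two: "(ddx d ^^ 2) g = ddx d (ddx d g)" by (simp add: numeral_2_eq_2)
  have e2: "(ddx d ^^ 2) g x t = gxx (x, t)"
    and d2: "((\<lambda>y. ddx d g y t) has_real_derivative gxx (x, t)) (at x within {-d..d})" if "x \<in> {-d..d}" for x t
    unfolding two by (rule ddx_eq[OF d that D2[OF that]], rule e1, assumption)+
  have D3: "(gxx has_derivative (\<lambda>v. gxxx (x, t) * fst v + gxxt (x, t) * snd v)) (at (x, t) within ?S)"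
    if "x \<in> {-d..d}" for x t using 3(1) mem[OF that] by blast
  have three: "(ddx d ^^ 3) g = ddx d ((ddx d ^^ 2) g)" by (simp add: numeral_3_eq_3 numeral_2_eq_2)
  have e3: "(ddx d ^^ 3) g x t = gxxx (x, t)"
    and d3: "((\<lambda>y. (ddx d ^^ 2) g y t) has_real_derivative gxxx (x, t)) (at x within {-d..d})" if "x \<in> {-d..d}" for x t
    unfolding three by (rule ddx_eq[OF d that D3[OF that]], rule e2, assumption)+
  have cont: "continuous_on ?S (\<lambda>(x, t). ddx d g x t)"
  proof -
    have "continuous_on ?S gx"
      by (rule has_derivative_continuous_on[where f'="\<lambda>p v. gxx p * fst v + gxt p * snd v"]) (use 2(1) in blast)
    then show ?thesis
      by (rule continuous_on_eq) (use e1 in auto)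
  qed
  have lip: "\<bar>(ddx d ^^ 3) g x t - (ddx d ^^ 3) g 0 0\<bar> \<le> 2 * B * (\<bar>x\<bar> + \<bar>t\<bar>)" if x: "x \<in> {-d..d}" for x t
  proof -
    have zero: "(0::real) \<in> {-d..d}" using d by simp
    have B0: "0 \<le> B" using 4(2) mem[OF x] by (meson abs_ge_zero order_trans)
    have "norm (gxxx (x, t) - gxxx (0, 0)) \<le> 2 * B * norm ((x, t) - (0, 0))"
    proof (rule differentiable_bound[where S="?S" and f'="\<lambda>p v. h p * fst v + k p * snd v"])
      show "convex ?S" by (intro convex_Times) auto
      show "(gxxx has_derivative (\<lambda>v. h p * fst v + k p * snd v)) (at p within ?S)" if "p \<in> ?S" for p
        using 4(1) that by blast
      show "onorm (\<lambda>v. h p * fst v + k p * snd v) \<le> 2 * B" if p: "p \<in> ?S" for p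
      proof (rule onorm_le)
        fix v :: "real \<times> real"
        have "\<bar>fst v\<bar> \<le> norm v" "\<bar>snd v\<bar> \<le> norm v"
          using norm_fst_le[of "fst v" "snd v"] norm_snd_le[of "snd v" "fst v"] by auto
        then have "\<bar>h p\<bar> * \<bar>fst v\<bar> \<le> B * norm v" "\<bar>k p\<bar> * \<bar>snd v\<bar> \<le> B * norm v"
          using 4(2,3) p B0 by (auto intro!: mult_mono)
        then show "norm (h p * fst v + k p * snd v) \<le> 2 * B * norm v"
          unfolding real_norm_def abs_mult[symmetric] by linarith
      qed
    qed (use mem[OF x] mem[OF zero] in auto)
    also have "norm ((x, t) - (0, 0)) \<le> \<bar>x\<bar> + \<bar>t\<bar>"
      using norm_Pair_le[of x t] by simp
    finally show ?thesis using e3[OF x] e3[OF zero] B0 by (simp add: mult_left_mono)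
  qed
  show thesis
  proof (rule that[of "\<lambda>x t. gt (x, t)"])
    fix x t :: real assume x: "x \<in> {-d..d}"
    show "((\<lambda>(x, t). g x t) has_derivative (\<lambda>v. ddx d g x t * fst v + gt (x, t) * snd v)) (at (x, t) within ?S)"
      using D1[OF x] unfolding e1[OF x] .
    show "\<bar>ddx d g x t\<bar> \<le> B" using 2(3) mem[OF x] unfolding e1[OF x] by blast
    show "\<bar>gt (x, t)\<bar> \<le> B" using gtb mem[OF x] by blast
    show "((\<lambda>y. ddx d g y t) has_real_derivative (ddx d ^^ 2) g x t) (at x within {-d..d})"
      using d2[OF x] unfolding e2[OF x] .
    show "\<bar>(ddx d ^^ 2) g x t\<bar> \<le> B" using 3(3) mem[OF x] unfolding e2[OF x] by blast
    show "((\<lambda>y. (ddx d ^^ 2) g y t) has_real_derivative (ddx d ^^ 3) g x t) (at x within {-d..d})"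
      using d3[OF x] unfolding e3[OF x] .
    show "\<bar>(ddx d ^^ 3) g x t\<bar> \<le> B" using 4(4) mem[OF x] unfolding e3[OF x] by blast
    show "\<bar>(ddx d ^^ 3) g x t - (ddx d ^^ 3) g 0 0\<bar> \<le> 2 * B * (\<bar>x\<bar> + \<bar>t\<bar>)" by (rule lip[OF x])
  qed (rule cont)
qed

lemma nonpos_from_zero:
  fixes \<phi> :: "real \<Rightarrow> real"
  assumes "0 \<le> y" "y \<le> d" and D: "\<And>z. z \<in> {0..y} \<Longrightarrow> (\<phi> has_real_derivative \<phi>' z) (at z within {-d..d})"
    and "\<phi> 0 \<le> 0" "\<And>z. z \<in> {0..y} \<Longrightarrow> \<phi>' z \<le> 0"
  shows "\<phi> y \<le> 0"
proof -
  have "\<phi> y \<le> \<phi> 0"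
  proof (rule nonincreasing_within[OF assms(1)])
    show "(\<phi> has_real_derivative \<phi>' z) (at z within {0..y})" if "z \<in> {0..y}" for z
      by (rule has_field_derivative_subset[OF D[OF that]]) (use assms(1,2) in auto)
  qed (use assms(5) in auto)
  then show ?thesis using assms(4) by simp
qed

lemma lipschitz_of_derivative:
  fixes \<phi> :: "real \<Rightarrow> real"
  assumes D: "\<And>z. z \<in> {-d..d} \<Longrightarrow> (\<phi> has_real_derivative \<phi>' z) (at z within {-d..d})"
    and b: "\<And>z. z \<in> {-d..d} \<Longrightarrow> \<bar>\<phi>' z\<bar> \<le> B" and xy: "x \<in> {-d..d}" "y \<in> {-d..d}"
  shows "\<bar>\<phi> x - \<phi> y\<bar> \<le> B * \<bar>x - y\<bar>"
  using field_differentiable_bound[of "{-d..d}" \<phi> \<phi>' B y x] assms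
  by (auto simp: abs_minus_commute)

text \<open>The sign condition forces the second \<open>x\<close>-derivative to vanish at \<open>x = 0\<close>, and in the region where the third
one is at most \<open>b/2\<close> three integrations give the cubic bounds. Concavity extends the
upper bound from \<open>[0,x1]\<close> to \<open>[0,\<delta>]\<close>, with the smaller constant \<open>c\<close>: the quotient \<open>g(x,t)/x\<close> is nonincreasing.\<close>

lemma slice_from_drift:
  fixes g :: "real \<Rightarrow> real \<Rightarrow> real"
  assumes d: "0 < d" and Ck: "Ck_bounded 4 B ({-d..d} \<times> UNIV) (\<lambda>(x, t). g x t)"
    and odd: "\<And>x t. x \<in> {-d..d} \<Longrightarrow> g x t = - g (- x) t"
    and Xc: "continuous_on UNIV X" and Xr: "\<And>t. 0 < X t" "\<And>t. X t \<le> d"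
    and zeros: "\<And>x t. x \<in> {-d..d} \<Longrightarrow> g x t = 0 \<longleftrightarrow> x = 0 \<or> x = X t \<or> x = - X t"
    and apos: "\<And>t. 0 < ddx d g 0 t"
    and third: "(ddx d ^^ 3) g 0 0 = b" and b: "b < 0"
    and sgn: "\<And>x t. \<bar>x\<bar> \<le> \<delta> \<Longrightarrow> \<bar>t\<bar> \<le> T \<Longrightarrow> x * (ddx d ^^ 2) g x t \<le> 0"
    and ps: "0 < T" "0 < r" "0 < \<delta>" "\<delta> \<le> d" "0 < B" "0 < \<tau>" "\<tau> < T" "0 < x1" "x1 \<le> \<delta>" "0 < A" "0 < m" "0 < k"
    and small: "x1 \<le> - b / (8 * B)" "\<tau> \<le> - b / (8 * B)"
    and c: "c = - b / 12 * (x1 / \<delta>)\<^sup>2"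
    and rs: "sqrt r \<le> \<tau>"
    and aup: "\<And>t. \<bar>t\<bar> \<le> T \<Longrightarrow> ddx d g 0 t \<le> A * max r (t\<^sup>2)"
    and Xlo: "\<And>t. sqrt r \<le> \<bar>t\<bar> \<Longrightarrow> \<bar>t\<bar> \<le> T \<Longrightarrow> m * \<bar>t\<bar> \<le> X t"
    and Xup: "\<And>t. sqrt r \<le> \<bar>t\<bar> \<Longrightarrow> \<bar>t\<bar> \<le> T \<Longrightarrow> X t \<le> A * \<bar>t\<bar>"
    and Xsl: "\<And>t. sqrt r \<le> \<bar>t\<bar> \<Longrightarrow> \<bar>t\<bar> \<le> T \<Longrightarrow> ddx d g (X t) t \<le> - k * t\<^sup>2"
  shows "\<exists>ft. slice g ft X d T r \<delta> B \<tau> x1 c A m k"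
proof -
  obtain ft where
    F: "\<And>x t. x \<in> {-d..d} \<Longrightarrow>
      ((\<lambda>(x, t). g x t) has_derivative (\<lambda>v. ddx d g x t * fst v + ft x t * snd v)) (at (x, t) within {-d..d} \<times> UNIV)"
    and gxb: "\<And>x t. x \<in> {-d..d} \<Longrightarrow> \<bar>ddx d g x t\<bar> \<le> B"
    and gtb: "\<And>x t. x \<in> {-d..d} \<Longrightarrow> \<bar>ft x t\<bar> \<le> B"
    and D2: "\<And>x t. x \<in> {-d..d} \<Longrightarrow> ((\<lambda>y. ddx d g y t) has_real_derivative (ddx d ^^ 2) g x t) (at x within {-d..d})"
    and b2: "\<And>x t. x \<in> {-d..d} \<Longrightarrow> \<bar>(ddx d ^^ 2) g x t\<bar> \<le> B"
    and D3: "\<And>x t. x \<in> {-d..d} \<Longrightarrow> ((\<lambda>y. (ddx d ^^ 2) g y t) has_real_derivative (ddx d ^^ 3) g x t) (at x within {-d..d})"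
    and b3: "\<And>x t. x \<in> {-d..d} \<Longrightarrow> \<bar>(ddx d ^^ 3) g x t\<bar> \<le> B"
    and cont: "continuous_on ({-d..d} \<times> UNIV) (\<lambda>(x, t). ddx d g x t)"
    and lip3: "\<And>x t. x \<in> {-d..d} \<Longrightarrow> \<bar>(ddx d ^^ 3) g x t - (ddx d ^^ 3) g 0 0\<bar> \<le> 2 * B * (\<bar>x\<bar> + \<bar>t\<bar>)"
    using smooth_partials[OF d Ck] by blast
  define g1 where "g1 = ddx d g"
  define g2 where "g2 = (ddx d ^^ 2) g"
  define g3 where "g3 = (ddx d ^^ 3) g"
  note D2' = D2[folded g1_def g2_def] and D3' = D3[folded g2_def g3_def]
  note b2' = b2[folded g2_def] and b3' = b3[folded g3_def]
  have zero: "(0::real) \<in> {-d..d}" using d by simp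
  have g0: "g 0 t = 0" for t using odd[OF zero, of t] by simp
  have D1: "((\<lambda>y. g y t) has_real_derivative g1 x t) (at x within {-d..d})" if "x \<in> {-d..d}" for x t
    unfolding g1_def by (rule ddx_eq(2)[OF d that F[OF that]]) simp
  have g1lip: "\<bar>g1 x t - g1 y t\<bar> \<le> B * \<bar>x - y\<bar>" if "x \<in> {-d..d}" "y \<in> {-d..d}" for x y t
    by (rule lipschitz_of_derivative[OF D2' b2' that])
  have g2lip: "\<bar>g2 x t - g2 y t\<bar> \<le> B * \<bar>x - y\<bar>" if "x \<in> {-d..d}" "y \<in> {-d..d}" for x y t
    by (rule lipschitz_of_derivative[OF D3' b3' that])
  have g2sgn: "g2 x t \<le> 0" if "0 < x" "x \<le> \<delta>" "\<bar>t\<bar> \<le> T" for x t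
    using sgn[of x t] that unfolding g2_def by (simp add: mult_le_0_iff)
  have g2sgn': "0 \<le> g2 (- x) t" if "0 < x" "x \<le> \<delta>" "\<bar>t\<bar> \<le> T" for x t
    using sgn[of "- x" t] that unfolding g2_def by (simp add: zero_le_mult_iff)
  have g20: "g2 0 t = 0" if t: "\<bar>t\<bar> \<le> T" for t
  proof (rule ccontr)
    assume ne: "g2 0 t \<noteq> 0"
    \<comment> \<open>Within the distance \<open>y\<close> of the origin, \<open>g2\<close> would keep the sign of \<open>g2 0 t\<close> on both sides.\<close>
    define y where "y = min \<delta> (\<bar>g2 0 t\<bar> / (2 * B))"
    have y: "0 < y" "y \<le> \<delta>" "y \<le> \<bar>g2 0 t\<bar> / (2 * B)" unfolding y_def using ne ps by auto
    have "B * y \<le> B * (\<bar>g2 0 t\<bar> / (2 * B))" using y ps by (intro mult_left_mono) auto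
    then have By: "B * y \<le> \<bar>g2 0 t\<bar> / 2" using ps by simp
    have yd: "y \<in> {-d..d}" "- y \<in> {-d..d}" using y ps d by auto
    have "\<bar>g2 0 t - g2 y t\<bar> \<le> B * y" using g2lip[OF zero yd(1), of t] y by simp
    moreover have "\<bar>g2 0 t - g2 (- y) t\<bar> \<le> B * y" using g2lip[OF zero yd(2), of t] y by simp
    ultimately show False using g2sgn[OF y(1,2) t] g2sgn'[OF y(1,2) t] By ne by linarith
  qed
  have g2np: "g2 x t \<le> 0" if "x \<in> {0..\<delta>}" "\<bar>t\<bar> \<le> T" for x t
    using g2sgn[of x t] g20[of t] that by (cases "x = 0") auto
  have g1anti: "g1 y t \<le> g1 x t" if xy: "x \<le> y" "x \<in> {0..\<delta>}" "y \<in> {0..\<delta>}" and t: "\<bar>t\<bar> \<le> T" for x y t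
  proof (rule nonincreasing_within[OF xy(1)])
    show "((\<lambda>y. g1 y t) has_real_derivative g2 z t) (at z within {x..y})" if "z \<in> {x..y}" for z
      by (rule has_field_derivative_subset[OF D2']) (use that xy ps in auto)
    show "g2 z t \<le> 0" if "x < z" "z < y" for z using that xy by (intro g2np t) auto
  qed
  have tang: "g y t \<le> g x t + g1 x t * (y - x)" if x: "x \<in> {0..\<delta>}" and y: "y \<in> {0..\<delta>}" and t: "\<bar>t\<bar> \<le> T" for x y t
  proof (cases "x \<le> y")
    case True
    have "g y t - g1 x t * y \<le> g x t - g1 x t * x"
    proof (rule nonincreasing_within[OF True])
      show "((\<lambda>y. g y t - g1 x t * y) has_real_derivative g1 z t - g1 x t) (at z within {x..y})" if "z \<in> {x..y}" for z
      proof -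
        have "((\<lambda>y. g y t) has_real_derivative g1 z t) (at z within {x..y})"
          by (rule has_field_derivative_subset[OF D1]) (use that x y ps in auto)
        then show ?thesis by (auto intro!: derivative_eq_intros)
      qed
      show "g1 z t - g1 x t \<le> 0" if "x < z" "z < y" for z using g1anti[of x z t] that x y t by auto
    qed
    then show ?thesis by (simp add: algebra_simps)
  next
    case False
    then have yx: "y \<le> x" by simp
    have "- (g x t - g1 x t * x) \<le> - (g y t - g1 x t * y)"
    proof (rule nonincreasing_within[OF yx])
      show "((\<lambda>y. - (g y t - g1 x t * y)) has_real_derivative - (g1 z t - g1 x t)) (at z within {y..x})" if "z \<in> {y..x}" for z
      proof -
        have "((\<lambda>y. g y t) has_real_derivative g1 z t) (at z within {y..x})"
          by (rule has_field_derivative_subset[OF D1]) (use that x y ps in auto)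
        then show ?thesis by (auto intro!: derivative_eq_intros)
      qed
      show "- (g1 z t - g1 x t) \<le> 0" if "y < z" "z < x" for z using g1anti[of z x t] that x y t by auto
    qed
    then show ?thesis by (simp add: algebra_simps)
  qed
  define e where "e = - b / 2"
  have e: "0 < e" unfolding e_def using b by simp
  have g3le: "g3 x t \<le> - e" if x: "x \<in> {0..x1}" and t: "\<bar>t\<bar> \<le> \<tau>" for x t
  proof -
    have "\<bar>g3 x t - b\<bar> \<le> 2 * B * (\<bar>x\<bar> + \<bar>t\<bar>)" using lip3[of x t] x ps third unfolding g3_def by auto
    also have "\<dots> \<le> 2 * B * (- b / (8 * B) + - b / (8 * B))" using x t small ps by (intro mult_left_mono) auto
    also have "\<dots> = e" unfolding e_def using ps by simp
    finally have 1: "\<bar>g3 x t - b\<bar> \<le> e" .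
    show ?thesis using 1 unfolding e_def abs_le_iff by linarith
  qed
  have g2le: "g2 x t \<le> - e * x" if x: "x \<in> {0..x1}" and t: "\<bar>t\<bar> \<le> \<tau>" for x t
  proof -
    have "g2 x t + e * x \<le> 0"
    proof (rule nonpos_from_zero[where d=d and \<phi>="\<lambda>x. g2 x t + e * x" and \<phi>'="\<lambda>x. g3 x t + e"])
      show "((\<lambda>x. g2 x t + e * x) has_real_derivative g3 z t + e) (at z within {-d..d})" if "z \<in> {0..x}" for z
      proof -
        have "z \<in> {-d..d}" using that x ps by auto
        from D3'[OF this, of t] show ?thesis by (auto intro!: derivative_eq_intros)
      qed
      show "g3 z t + e \<le> 0" if "z \<in> {0..x}" for z using g3le[of z t] that x t by auto
    qed (use x ps t g20[of t] in auto)
    then show ?thesis by simp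
  qed
  have g1le: "g1 x t \<le> g1 0 t - e / 2 * x\<^sup>2" if x: "x \<in> {0..x1}" and t: "\<bar>t\<bar> \<le> \<tau>" for x t
  proof -
    have "g1 x t - g1 0 t + e / 2 * x\<^sup>2 \<le> 0"
    proof (rule nonpos_from_zero[where d=d and \<phi>="\<lambda>x. g1 x t - g1 0 t + e / 2 * x\<^sup>2" and \<phi>'="\<lambda>x. g2 x t + e * x"])
      show "((\<lambda>x. g1 x t - g1 0 t + e / 2 * x\<^sup>2) has_real_derivative g2 z t + e * z) (at z within {-d..d})" if "z \<in> {0..x}" for z
      proof -
        have "z \<in> {-d..d}" using that x ps by auto
        from D2'[OF this, of t] show ?thesis by (auto intro!: derivative_eq_intros)
      qed
      show "g2 z t + e * z \<le> 0" if "z \<in> {0..x}" for z using g2le[of z t] that x t by auto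
    qed (use x ps in auto)
    then show ?thesis by simp
  qed
  have cub0: "g x t \<le> g1 0 t * x - e / 6 * x ^ 3" if x: "x \<in> {0..x1}" and t: "\<bar>t\<bar> \<le> \<tau>" for x t
  proof -
    have "g x t - g1 0 t * x + e / 6 * x ^ 3 \<le> 0"
    proof (rule nonpos_from_zero[where d=d and \<phi>="\<lambda>x. g x t - g1 0 t * x + e / 6 * x ^ 3" and \<phi>'="\<lambda>x. g1 x t - g1 0 t + e / 2 * x\<^sup>2"])
      show "((\<lambda>x. g x t - g1 0 t * x + e / 6 * x ^ 3) has_real_derivative g1 z t - g1 0 t + e / 2 * z\<^sup>2) (at z within {-d..d})" if "z \<in> {0..x}" for z
      proof -
        have "z \<in> {-d..d}" using that x ps by auto
        from D1[OF this, of t] show ?thesis by (auto intro!: derivative_eq_intros)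
      qed
      show "g1 z t - g1 0 t + e / 2 * z\<^sup>2 \<le> 0" if "z \<in> {0..x}" for z using g1le[of z t] that x t by auto
    qed (use x ps g0 in auto)
    then show ?thesis by simp
  qed
  have slope0: "x * g1 x t \<le> g x t - e / 3 * x ^ 3" if x: "x \<in> {0..x1}" and t: "\<bar>t\<bar> \<le> \<tau>" for x t
  proof -
    have "x * g1 x t - g x t + e / 3 * x ^ 3 \<le> 0"
    proof (rule nonpos_from_zero[where d=d and \<phi>="\<lambda>x. x * g1 x t - g x t + e / 3 * x ^ 3" and \<phi>'="\<lambda>x. x * g2 x t + e * x\<^sup>2"])
      show "((\<lambda>x. x * g1 x t - g x t + e / 3 * x ^ 3) has_real_derivative z * g2 z t + e * z\<^sup>2) (at z within {-d..d})" if "z \<in> {0..x}" for z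
      proof -
        have "z \<in> {-d..d}" using that x ps by auto
        from D1[OF this, of t] D2'[OF this, of t] show ?thesis by (auto intro!: derivative_eq_intros)
      qed
      show "z * g2 z t + e * z\<^sup>2 \<le> 0" if "z \<in> {0..x}" for z
      proof -
        have "z * g2 z t \<le> z * (- e * z)" using g2le[of z t] that x t by (intro mult_left_mono) auto
        then show ?thesis by (simp add: power2_eq_square mult_ac)
      qed
    qed (use x ps g0 in auto)
    then show ?thesis by simp
  qed
  have ratio: "(x1 / \<delta>)\<^sup>2 \<le> 1" using ps by (simp add: power_le_one)
  have c6: "c = e / 6 * (x1 / \<delta>)\<^sup>2" unfolding c e_def by simp
  have cpos: "0 < c" unfolding c6 using e ps by simp
  have cle: "c \<le> e / 6" unfolding c6 using ratio e by (simp add: mult_left_le)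
  have cub: "g x t \<le> g1 0 t * x - c * x ^ 3" if x: "x \<in> {0..\<delta>}" and t: "\<bar>t\<bar> \<le> \<tau>" for x t
  proof (cases "x \<le> x1")
    case True
    have "c * x ^ 3 \<le> e / 6 * x ^ 3" using cle x by (intro mult_right_mono) auto
    then show ?thesis using cub0[of x t] True x t by auto
  next
    case False
    have x1in: "x1 \<in> {0..x1}" "x1 \<in> {0..\<delta>}" using ps by auto
    have tT: "\<bar>t\<bar> \<le> T" using t ps by simp
    have "x1 * g1 x1 t \<le> g x1 t - e / 3 * x1 ^ 3" by (rule slope0[OF x1in(1) t])
    also have "\<dots> \<le> g x1 t" using e ps by simp
    finally have s1: "x1 * g1 x1 t \<le> g x1 t" .
    have "x1 * g x t \<le> x1 * (g x1 t + g1 x1 t * (x - x1))" using tang[OF x1in(2) x tT] ps by (intro mult_left_mono) auto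
    also have "\<dots> = x1 * g x1 t + (x1 * g1 x1 t) * (x - x1)" by (simp add: algebra_simps)
    also have "\<dots> \<le> x1 * g x1 t + g x1 t * (x - x1)" using s1 False by (intro add_left_mono mult_right_mono) auto
    also have "\<dots> = x * g x1 t" by (simp add: algebra_simps)
    also have "\<dots> \<le> x * (g1 0 t * x1 - e / 6 * x1 ^ 3)" using cub0[OF x1in(1) t] x by (intro mult_left_mono) auto
    also have "\<dots> = x1 * (g1 0 t * x - e / 6 * x1\<^sup>2 * x)" by (simp add: algebra_simps power2_eq_square power3_eq_cube)
    finally have "g x t \<le> g1 0 t * x - e / 6 * x1\<^sup>2 * x" using ps by simp
    moreover have "c * x ^ 3 \<le> e / 6 * x1\<^sup>2 * x"
    proof -
      have "x\<^sup>2 \<le> \<delta>\<^sup>2" using x by (intro power_mono) auto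
      then have "x\<^sup>2 / \<delta>\<^sup>2 \<le> 1" using ps by simp
      then have "e / 6 * x1\<^sup>2 * x * (x\<^sup>2 / \<delta>\<^sup>2) \<le> e / 6 * x1\<^sup>2 * x * 1" using e x by (intro mult_left_mono) auto
      then show ?thesis unfolding c6 by (simp add: power_divide power2_eq_square power3_eq_cube mult_ac)
    qed
    ultimately show ?thesis by linarith
  qed
  have slp: "x * g1 x t \<le> g x t - c * x ^ 3" if x: "x \<in> {0..x1}" and t: "\<bar>t\<bar> \<le> \<tau>" for x t
  proof -
    have "c * x ^ 3 \<le> e / 3 * x ^ 3" using cle e x by (intro mult_right_mono) auto
    then show ?thesis using slope0[OF x t] by linarith
  qed
  have quad: "\<bar>g1 x t - g1 0 t\<bar> \<le> B * x\<^sup>2" if x: "x \<in> {-d..d}" and t: "\<bar>t\<bar> \<le> T" for x t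
  proof -
    have sub: "{-\<bar>x\<bar>..\<bar>x\<bar>} \<subseteq> {-d..d}" using x by auto
    have "\<bar>g1 x t - g1 0 t\<bar> \<le> (B * \<bar>x\<bar>) * \<bar>x - 0\<bar>"
    proof (rule lipschitz_of_derivative[where d="\<bar>x\<bar>" and \<phi>'="\<lambda>z. g2 z t"])
      fix z assume z: "z \<in> {-\<bar>x\<bar>..\<bar>x\<bar>}"
      then have zd: "z \<in> {-d..d}" using sub by auto
      show "((\<lambda>x. g1 x t) has_real_derivative g2 z t) (at z within {-\<bar>x\<bar>..\<bar>x\<bar>})"
        by (rule has_field_derivative_subset[OF D2'[OF zd] sub])
      have "\<bar>g2 z t - g2 0 t\<bar> \<le> B * \<bar>z - 0\<bar>" by (rule g2lip[OF zd zero])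
      also have "\<dots> \<le> B * \<bar>x\<bar>" using z ps by (intro mult_left_mono) auto
      finally show "\<bar>g2 z t\<bar> \<le> B * \<bar>x\<bar>" using g20[OF t] by simp
    qed auto
    then show ?thesis by (simp add: power2_eq_square abs_mult_self_eq mult.assoc)
  qed
  have Fp: "0 < g x t" if x: "0 < x" "x < X t" for x t
  proof (rule ccontr)
    assume "\<not> 0 < g x t"
    have xd: "x \<in> {-d..d}" using x Xr(2)[of t] d by auto
    have "g x t \<noteq> 0" using zeros[OF xd, of t] x Xr(1)[of t] by auto
    then have neg: "g x t < 0" using \<open>\<not> 0 < g x t\<close> by simp
    obtain \<eta> where \<eta>: "0 < \<eta>" "\<And>h. 0 < h \<Longrightarrow> 0 + h \<in> {-d..d} \<Longrightarrow> h < \<eta> \<Longrightarrow> g 0 t < g (0 + h) t"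
      using has_real_derivative_pos_inc_right[OF D1[OF zero, of t]] apos[of t] unfolding g1_def by blast
    define h where "h = min (\<eta> / 2) (x / 2)"
    have h: "0 < h" "h < \<eta>" "h < x" unfolding h_def using \<eta>(1) x by auto
    have gh: "0 < g h t" using \<eta>(2)[of h] h xd g0[of t] by auto
    have "continuous_on {-d..d} (\<lambda>y. g y t)" by (rule DERIV_continuous_on[OF D1])
    then have "continuous_on {h..x} (\<lambda>y. g y t)" by (rule continuous_on_subset) (use h xd in auto)
    then obtain z where z: "h \<le> z" "z \<le> x" "g z t = 0"
      using IVT2'[of "\<lambda>y. g y t" x 0 h] neg gh h by auto
    then have "z \<in> {-d..d}" using h xd by auto
    then show False using zeros[of z t] z h x Xr(1)[of t] by auto
  qed
  have Xin: "X t \<in> {-d..d}" for t using Xr(1)[of t] Xr(2)[of t] by auto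
  have "slice g ft X d T r \<delta> B \<tau> x1 c A m k"
  proof
    show "0 < d" "0 < T" "0 < r" "0 < \<delta>" "\<delta> \<le> d" "0 < B" "0 < \<tau>" "\<tau> < T" "0 < x1" "x1 \<le> \<delta>"
      "0 < c" "0 < A" "0 < m" "0 < k" by fact+
    show "sqrt r \<le> \<tau>" by fact
    show "continuous_on ({- d..d} \<times> UNIV) (\<lambda>(x, t). ddx d g x t)" by fact
    show "continuous_on UNIV X" by fact
    fix x y t :: real
    show "x \<in> {- d..d} \<Longrightarrow> ((\<lambda>(x, t). g x t) has_derivative (\<lambda>v. ddx d g x t * fst v + ft x t * snd v)) (at (x, t) within {- d..d} \<times> UNIV)"
      by (rule F)
    show "x \<in> {- d..d} \<Longrightarrow> \<bar>ddx d g x t\<bar> \<le> B" by (rule gxb)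
    show "x \<in> {- d..d} \<Longrightarrow> \<bar>ft x t\<bar> \<le> B" by (rule gtb)
    show "x \<in> {- d..d} \<Longrightarrow> y \<in> {- d..d} \<Longrightarrow> \<bar>ddx d g x t - ddx d g y t\<bar> \<le> B * \<bar>x - y\<bar>" by (rule g1lip[unfolded g1_def])
    show "g 0 t = 0" by (rule g0)
    show "x \<in> {0..\<delta>} \<Longrightarrow> y \<in> {0..\<delta>} \<Longrightarrow> \<bar>t\<bar> \<le> T \<Longrightarrow> g y t \<le> g x t + ddx d g x t * (y - x)" by (rule tang[unfolded g1_def])
    show "x \<in> {0..\<delta>} \<Longrightarrow> \<bar>t\<bar> \<le> \<tau> \<Longrightarrow> g x t \<le> ddx d g 0 t * x - c * x ^ 3" by (rule cub[unfolded g1_def])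
    show "x \<in> {0..x1} \<Longrightarrow> \<bar>t\<bar> \<le> \<tau> \<Longrightarrow> x * ddx d g x t \<le> g x t - c * x ^ 3" by (rule slp[unfolded g1_def])
    show "x \<in> {- d..d} \<Longrightarrow> \<bar>t\<bar> \<le> T \<Longrightarrow> \<bar>ddx d g x t - ddx d g 0 t\<bar> \<le> B * x\<^sup>2" by (rule quad[unfolded g1_def])
    show "0 < ddx d g 0 t" by (rule apos)
    show "\<bar>t\<bar> \<le> T \<Longrightarrow> ddx d g 0 t \<le> A * max r (t\<^sup>2)" by (rule aup)
    show "0 < X t" "X t \<le> d" by (rule Xr)+
    show "g (X t) t = 0" using zeros[OF Xin] by simp
    show "0 < x \<Longrightarrow> x < X t \<Longrightarrow> 0 < g x t" by (rule Fp)
    show "sqrt r \<le> \<bar>t\<bar> \<Longrightarrow> \<bar>t\<bar> \<le> T \<Longrightarrow> m * \<bar>t\<bar> \<le> X t" by (rule Xlo)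
    show "sqrt r \<le> \<bar>t\<bar> \<Longrightarrow> \<bar>t\<bar> \<le> T \<Longrightarrow> X t \<le> A * \<bar>t\<bar>" by (rule Xup)
    show "sqrt r \<le> \<bar>t\<bar> \<Longrightarrow> \<bar>t\<bar> \<le> T \<Longrightarrow> ddx d g (X t) t \<le> - k * t\<^sup>2" by (rule Xsl)
  qed
  then show ?thesis by blast
qed

text \<open>None of the constants depends on \<open>r\<close>. \<open>\<tau>\<close> is chosen last, so that the envelope \<open>C |t|\<close> stays
below \<open>x1\<close> for \<open>|t| \<le> \<tau>\<close>.\<close>

lemma uniform_slices:
  assumes drift: "symmetric_drift f X d T a1 b rbar" and \<delta>: "0 < \<delta>" "\<delta> \<le> d"
    and sgn: "\<forall>r\<in>{0<..rbar}. \<forall>x t. \<bar>x\<bar> \<le> \<delta> \<and> \<bar>t\<bar> \<le> T \<longrightarrow> x * (ddx d ^^ 2) (f r) x t \<le> 0"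
  obtains B \<tau> x1 c A m k C where "0 < B" "0 < \<tau>" "0 < x1" "0 < c" "0 < A" "0 < m" "0 < k"
    "2 * A \<le> C" "m \<le> C" "C * \<tau> \<le> x1" "A + 2 \<le> c * C\<^sup>2"
    "\<forall>r\<in>{0<..rbar}. sqrt r \<le> \<tau> \<longrightarrow> (\<exists>ft. slice (f r) ft (X r) d T r \<delta> B \<tau> x1 c A m k)"
proof -
  interpret symmetric_drift f X d T a1 b rbar by (rule drift)
  obtain B where B: "\<And>r. r \<in> {0<..rbar} \<Longrightarrow> Ck_bounded 4 B ({-d..d} \<times> UNIV) (\<lambda>(x, t). f r x t)"
    using C4 by blast
  have rb: "rbar \<in> {0<..rbar}" using rbar_pos by simp
  have B0: "0 < B"
  proof -
    have z: "(0::real) \<in> {-d..d}" using d_pos by simp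
    have "\<bar>(ddx d ^^ 3) (f rbar) 0 0\<bar> \<le> B"
      by (rule smooth_partials[OF d_pos B[OF rb]]) (use z in blast)
    then show ?thesis using third_derivative rb b_neg by auto
  qed
  obtain m1 p1 where in1: "0 < m1" "0 < p1" and inner: "\<And>r t. r \<in> {0<..rbar} \<Longrightarrow> \<bar>t\<bar> \<le> sqrt r \<Longrightarrow>
      asymp_between m1 p1 (X r t) (sqrt r) \<and> asymp_between m1 p1 (ddx d (f r) 0 t) r"
    using asymp_inner by blast
  obtain m2 p2 where mi: "0 < m2" "0 < p2" and middle: "\<And>r t. r \<in> {0<..rbar} \<Longrightarrow> sqrt r \<le> \<bar>t\<bar> \<and> \<bar>t\<bar> \<le> T \<Longrightarrow>
      asymp_between m2 p2 (X r t) \<bar>t\<bar> \<and> asymp_between m2 p2 (ddx d (f r) 0 t) (t\<^sup>2)"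
    using asymp_middle by blast
  obtain m3 p3 where st: "0 < m3" "0 < p3" and star: "\<And>r t. r \<in> {0<..rbar} \<Longrightarrow>
      asymp_between m3 p3 (- ddx d (f r) (X r t) t) (ddx d (f r) 0 t)"
    using asymp_astar by blast
  define \<rho> where "\<rho> = - b / (8 * B)"
  define x1 where "x1 = min \<delta> \<rho>"
  define c where "c = - b / 12 * (x1 / \<delta>)\<^sup>2"
  define A where "A = max p1 p2"
  define k where "k = m3 * m2"
  define C where "C = max (max (2 * A) m2) ((A + 2) / c + 1)"
  define \<tau> where "\<tau> = min (min \<rho> (T / 2)) (x1 / C)"
  have \<rho>: "0 < \<rho>" unfolding \<rho>_def using b_neg B0 by (intro divide_pos_pos) auto
  have x1: "0 < x1" "x1 \<le> \<delta>" "x1 \<le> \<rho>" unfolding x1_def using \<rho> \<delta> by auto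
  have c: "0 < c" unfolding c_def using b_neg x1 \<delta> by (intro mult_pos_pos) auto
  have A: "0 < A" "p1 \<le> A" "p2 \<le> A" unfolding A_def using in1 by auto
  have k: "0 < k" unfolding k_def using st mi by simp
  have Cge: "2 * A \<le> C" "m2 \<le> C" "(A + 2) / c + 1 \<le> C" unfolding C_def by auto
  have C0: "0 < C" using Cge(1) A(1) by linarith
  have Cc: "A + 2 \<le> c * C\<^sup>2"
  proof -
    have "0 \<le> (A + 2) / c" using A c by simp
    then have "1 \<le> C" "(A + 2) / c \<le> C" using Cge(3) by linarith+
    then have "(A + 2) / c * 1 \<le> C * C" using C0 by (intro mult_mono) auto
    then show ?thesis using c by (simp add: divide_le_eq power2_eq_square mult_ac)
  qed
  have \<tau>: "0 < \<tau>" "\<tau> \<le> \<rho>" "\<tau> < T" unfolding \<tau>_def using \<rho> T_range x1 C0 by auto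
  have "\<tau> \<le> x1 / C" unfolding \<tau>_def by simp
  then have Ct: "C * \<tau> \<le> x1" using C0 by (simp add: le_divide_eq mult.commute)
  show thesis
  proof (rule that[of B \<tau> x1 c A m2 k C])
    show "\<forall>r\<in>{0<..rbar}. sqrt r \<le> \<tau> \<longrightarrow> (\<exists>ft. slice (f r) ft (X r) d T r \<delta> B \<tau> x1 c A m2 k)"
    proof (intro ballI impI)
    fix r assume r: "r \<in> {0<..rbar}" and rs: "sqrt r \<le> \<tau>"
    show "\<exists>ft. slice (f r) ft (X r) d T r \<delta> B \<tau> x1 c A m2 k"
    proof (rule slice_from_drift[OF d_pos B[OF r], where b=b])
      show "f r x t = - f r (- x) t" if "x \<in> {-d..d}" for x t using odd r that by blast
      show "continuous_on UNIV (X r)" using xstar_continuous r by blast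
      show "0 < X r t" "X r t \<le> d" for t using xstar_range r by blast+
      show "f r x t = 0 \<longleftrightarrow> x = 0 \<or> x = X r t \<or> x = - X r t" if "x \<in> {-d..d}" for x t using zeros r that by blast
      show "0 < ddx d (f r) 0 t" for t using a_pos r by blast
      show "(ddx d ^^ 3) (f r) 0 0 = b" using third_derivative r by blast
      show "x * (ddx d ^^ 2) (f r) x t \<le> 0" if "\<bar>x\<bar> \<le> \<delta>" "\<bar>t\<bar> \<le> T" for x t using sgn r that by blast
      show "0 < r" using r by simp
      show "x1 \<le> - b / (8 * B)" "\<tau> \<le> - b / (8 * B)" using x1 \<tau> unfolding \<rho>_def by auto
      show "ddx d (f r) 0 t \<le> A * max r (t\<^sup>2)" if t: "\<bar>t\<bar> \<le> T" for t
      proof (cases "\<bar>t\<bar> \<le> sqrt r")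
        case True
        have "ddx d (f r) 0 t \<le> p1 * r" using inner[OF r True] unfolding asymp_between_def by blast
        also have "\<dots> \<le> A * max r (t\<^sup>2)" using A r by (intro mult_mono) auto
        finally show ?thesis .
      next
        case False
        then have "ddx d (f r) 0 t \<le> p2 * t\<^sup>2" using middle[OF r, of t] t unfolding asymp_between_def by auto
        also have "\<dots> \<le> A * max r (t\<^sup>2)" using A by (intro mult_mono) auto
        finally show ?thesis .
      qed
      fix t assume t: "sqrt r \<le> \<bar>t\<bar>" "\<bar>t\<bar> \<le> T"
      note mid = middle[OF r conjI[OF t], unfolded asymp_between_def]
      show "m2 * \<bar>t\<bar> \<le> X r t" using mid by blast
      have "p2 * \<bar>t\<bar> \<le> A * \<bar>t\<bar>" using A by (intro mult_right_mono) auto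
      then show "X r t \<le> A * \<bar>t\<bar>" using mid by linarith
      have "m3 * (m2 * t\<^sup>2) \<le> m3 * ddx d (f r) 0 t" using mid st by (intro mult_left_mono) auto
      also have "\<dots> \<le> - ddx d (f r) (X r t) t" using star[OF r, of t] unfolding asymp_between_def by blast
      finally show "ddx d (f r) (X r t) t \<le> - k * t\<^sup>2" unfolding k_def by simp
    qed (use b_neg T_range \<delta> B0 \<tau> x1 A mi k rs c_def in auto)
    qed
  qed (use B0 \<tau> x1 c A mi k Cge Ct Cc in auto)
qed

theorem theorem2p3:
  fixes f :: "real \<Rightarrow> real \<Rightarrow> real \<Rightarrow> real"
    and xstar :: "real \<Rightarrow> real \<Rightarrow> real"
    and d T a1 b rbar \<delta> cm cp :: real
  assumes "symmetric_drift f xstar d T a1 b rbar"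
    and "0 < \<delta>" "\<delta> \<le> d"
    and "\<forall>r\<in>{0<..rbar}. \<forall>x t. \<bar>x\<bar> \<le> \<delta> \<and> \<bar>t\<bar> \<le> T \<longrightarrow> x * (ddx d ^^ 2) (f r) x t \<le> 0"
    and "0 < cm" "0 < cp"
  shows "\<exists>c1bar>0. \<exists>\<kappa>>0. \<forall>c1. 0 < c1 \<and> c1 \<le> c1bar \<longrightarrow>
    (\<forall>a0 :: real \<Rightarrow> real. (\<forall>\<epsilon>>0. 0 < a0 \<epsilon>) \<and> (a0 \<longlongrightarrow> 0) (at_right 0) \<longrightarrow>
    (\<exists>\<epsilon>0>0. \<forall>\<epsilon>. 0 < \<epsilon> \<and> \<epsilon> \<le> \<epsilon>0 \<longrightarrow>
      (\<forall>\<sigma> xdet t0 t1 h x0 (M :: 'w measure) W x.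
        0 < \<sigma> \<and> max (a0 \<epsilon>) (\<epsilon> powr (2/3)) \<le> c1\<^sup>2 * \<sigma> \<and>
        det_solution (f (a0 \<epsilon>)) d T \<epsilon> xdet \<and>
        asymp_between cm cp (xdet (- T) - xstar (a0 \<epsilon>) (- T)) \<epsilon> \<and>
        - T \<le> t0 \<and> t0 \<le> t1 \<and> t1 \<le> T \<and>
        - c1 * sqrt \<sigma> \<le> t1 \<and> t1 \<le> c1 * sqrt \<sigma> \<and>
        2 * \<sigma> < h \<and>
        (\<forall>s\<in>{t0..t1}. xdet s + h * sqrt (zeta d (f (a0 \<epsilon>)) T \<epsilon> xdet s) < \<delta>) \<and>
        0 < x0 \<and> x0 \<le> xdet t0 + 1/2 * h * sqrt (zeta d (f (a0 \<epsilon>)) T \<epsilon> xdet t0) \<and>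
        standard_wiener M t0 W \<and>
        sde_solution (f (a0 \<epsilon>)) \<epsilon> \<sigma> t0 t1 x0 M W x
        \<longrightarrow>
        measure M {\<omega> \<in> space M. \<forall>s\<in>{t0..t1}. 0 < x s \<omega>}
          \<le> 5/2 * (\<bar>alphabar d (f (a0 \<epsilon>)) xdet t1 t0\<bar> / \<epsilon> + 1) * exp (- \<kappa> * h\<^sup>2 / \<sigma>\<^sup>2)
            + 2 * exp (- \<kappa> * (1 / ln (h / \<sigma>))
                * (alpha d (f (a0 \<epsilon>)) t1 (max t0 (- c1 * sqrt \<sigma>)) / \<epsilon>)))))"
proof -
  interpret symmetric_drift f xstar d T a1 b rbar by (rule assms(1))
  obtain B \<tau> x1 c A m k C where ps: "0 < B" "0 < \<tau>" "0 < x1" "0 < c" "0 < A" "0 < m" "0 < k"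
    and C: "2 * A \<le> C" "m \<le> C" "C * \<tau> \<le> x1" "A + 2 \<le> c * C\<^sup>2"
    and sl: "\<forall>r\<in>{0<..rbar}. sqrt r \<le> \<tau> \<longrightarrow> (\<exists>ft. slice (f r) ft (xstar r) d T r \<delta> B \<tau> x1 c A m k)"
    by (rule uniform_slices[OF assms(1-4)])
  have C0: "0 < C" using C(1) ps(5) by linarith
  define \<mu> where "\<mu> = k * \<tau>\<^sup>2"
  have \<mu>: "0 < \<mu>" unfolding \<mu>_def using ps by simp
  define c3 where "c3 = min (\<mu> / (6 * T\<^sup>2)) (c * m\<^sup>2 / 12)"
  have c3: "0 < c3" "6 * c3 * T\<^sup>2 \<le> \<mu>" "12 * c3 \<le> c * m\<^sup>2"
  proof -
    show "0 < c3" unfolding c3_def using \<mu> T_range ps by simp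
    have "c3 \<le> \<mu> / (6 * T\<^sup>2)" unfolding c3_def by simp
    then show "6 * c3 * T\<^sup>2 \<le> \<mu>" using T_range by (simp add: le_divide_eq mult_ac)
    have "c3 \<le> c * m\<^sup>2 / 12" unfolding c3_def by simp
    then show "12 * c3 \<le> c * m\<^sup>2" by simp
  qed
  define K where "K = 4 * B / \<mu>\<^sup>2 + 2 * B * cp / \<mu> + 1"
  have K0: "0 < K" unfolding K_def using ps \<mu> assms(6) by (intro add_nonneg_pos add_nonneg_nonneg) auto
  have K: "K * \<mu> > 4 * B / \<mu>" "K * \<mu> \<ge> 2 * B * cp"
  proof -
    have e: "K * \<mu> = 4 * B / \<mu> + 2 * B * cp + \<mu>" unfolding K_def using \<mu> by (simp add: distrib_right power2_eq_square)
    have "0 < 4 * B / \<mu>" "0 < 2 * B * cp" using ps \<mu> assms(6) by auto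
    then show "K * \<mu> > 4 * B / \<mu>" "K * \<mu> \<ge> 2 * B * cp" using e \<mu> by linarith+
  qed
  define lam where "lam = 1 / (8 * A)"
  have lam: "0 < lam" "8 * A * lam \<le> 1" unfolding lam_def using ps by auto
  define Kb where "Kb = 6 * sqrt lam + 8 * A / c + 1"
  have Kb: "6 * sqrt lam \<le> Kb" "8 * A \<le> c * Kb\<^sup>2" "0 < Kb"
  proof -
    have nn: "0 \<le> 6 * sqrt lam" "0 \<le> 8 * A / c" using lam ps by auto
    then have b: "1 \<le> Kb" "8 * A / c \<le> Kb" "6 * sqrt lam \<le> Kb" unfolding Kb_def by linarith+
    then show "6 * sqrt lam \<le> Kb" "0 < Kb" by linarith+
    have "8 * A / c * 1 \<le> Kb * Kb" using b nn by (intro mult_mono) auto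
    then show "8 * A \<le> c * Kb\<^sup>2" using ps by (simp add: divide_le_eq power2_eq_square mult_ac)
  qed
  define kap where "kap = min (c / 16) (1 / (2 * lam * Kb\<^sup>2))"
  have kap: "0 < kap" "16 * kap \<le> c" "kap * lam * Kb\<^sup>2 \<le> 1/2"
  proof -
    show "0 < kap" unfolding kap_def using ps lam Kb by simp
    show "16 * kap \<le> c" unfolding kap_def by simp
    have "kap * (lam * Kb\<^sup>2) \<le> 1 / (2 * lam * Kb\<^sup>2) * (lam * Kb\<^sup>2)"
      unfolding kap_def using lam by (intro mult_right_mono) auto
    also have "\<dots> = 1/2" using lam Kb by simp
    finally show "kap * lam * Kb\<^sup>2 \<le> 1/2" by (simp add: mult.assoc)
  qed
  define \<sigma>1 where "\<sigma>1 = min (min (\<delta>\<^sup>2 / (2 * Kb\<^sup>2)) (c * \<delta>\<^sup>2 * lam / 4)) (min (\<tau>\<^sup>2) (min (c * \<delta>\<^sup>2 / (8 * A)) ((\<delta> / (8 * C))\<^sup>2)))"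
  have \<sigma>1: "0 < \<sigma>1" unfolding \<sigma>1_def using assms(2) ps lam Kb C0 by simp
  define zc where "zc = exp (- 2 * B) * min 1 (1 / (2 * B))"
  have zc: "0 < zc" unfolding zc_def using ps by simp
  define Y where "Y = 4 * d\<^sup>2 / (zc * \<sigma>1\<^sup>2)"
  have Y: "0 < Y" unfolding Y_def using d_pos zc \<sigma>1 by simp
  \<comment> \<open>The constant is positive only if the conditions of \<open>regime\<close> can be met at all, which
    is known only later; hence the case distinction in the definition of \<open>\<kappa>\<close>.\<close>
  define k0 where "k0 = regime.K0 T \<delta> B \<tau> A m C c3 lam kap"
  define \<kappa> where "\<kappa> = min (if 0 < k0 then k0 else 1) (1 / (2 * Y))"
  have \<kappa>: "0 < \<kappa>" "\<kappa> * Y \<le> 1/2" 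
  proof -
    show "0 < \<kappa>" unfolding \<kappa>_def using Y by simp
    have "\<kappa> * Y \<le> 1 / (2 * Y) * Y" unfolding \<kappa>_def using Y by (intro mult_right_mono) auto
    then show "\<kappa> * Y \<le> 1/2" using Y by simp
  qed
  show ?thesis
  proof (rule exI[of _ "1::real"], rule conjI[OF zero_less_one], rule exI[of _ \<kappa>],
      rule conjI[OF \<kappa>(1)], intro allI impI)
    fix c1 :: real and a0 :: "real \<Rightarrow> real"
    assume c1: "0 < c1 \<and> c1 \<le> 1" and a0: "(\<forall>\<epsilon>>0. 0 < a0 \<epsilon>) \<and> (a0 \<longlongrightarrow> 0) (at_right 0)"
    \<comment> \<open>\<open>a0 \<epsilon> < \<tau>\<^sup>2\<close> puts \<open>[-T,-\<tau>]\<close> into the range in which \<open>xstar\<close> is comparable to \<open>|t|\<close>.\<close>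
    define r0 where "r0 = min rbar (\<tau>\<^sup>2)"
    have r0: "0 < r0" unfolding r0_def using rbar_pos ps by simp
    have "eventually (\<lambda>\<epsilon>. a0 \<epsilon> < r0) (at_right 0)" using a0 r0 by (auto dest: order_tendstoD(2))
    then obtain e1 where e1: "0 < e1" "\<And>\<epsilon>. 0 < \<epsilon> \<Longrightarrow> \<epsilon> < e1 \<Longrightarrow> a0 \<epsilon> < r0"
      unfolding eventually_at_right_field by auto
    define e2 where "e2 = min (\<mu> / (8 * B * K)) (min (A * \<tau> / K) (m * \<tau> / (2 * K)))"
    have e2: "0 < e2" unfolding e2_def using \<mu> ps K0 by simp
    show "\<exists>\<epsilon>0>0. \<forall>\<epsilon>. 0 < \<epsilon> \<and> \<epsilon> \<le> \<epsilon>0 \<longrightarrow>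
      (\<forall>\<sigma> xdet t0 t1 h x0 (M :: 'w measure) W x.
        0 < \<sigma> \<and> max (a0 \<epsilon>) (\<epsilon> powr (2/3)) \<le> c1\<^sup>2 * \<sigma> \<and>
        det_solution (f (a0 \<epsilon>)) d T \<epsilon> xdet \<and>
        asymp_between cm cp (xdet (- T) - xstar (a0 \<epsilon>) (- T)) \<epsilon> \<and>
        - T \<le> t0 \<and> t0 \<le> t1 \<and> t1 \<le> T \<and>
        - c1 * sqrt \<sigma> \<le> t1 \<and> t1 \<le> c1 * sqrt \<sigma> \<and>
        2 * \<sigma> < h \<and>
        (\<forall>s\<in>{t0..t1}. xdet s + h * sqrt (zeta d (f (a0 \<epsilon>)) T \<epsilon> xdet s) < \<delta>) \<and>
        0 < x0 \<and> x0 \<le> xdet t0 + 1/2 * h * sqrt (zeta d (f (a0 \<epsilon>)) T \<epsilon> xdet t0) \<and>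
        standard_wiener M t0 W \<and>
        sde_solution (f (a0 \<epsilon>)) \<epsilon> \<sigma> t0 t1 x0 M W x
        \<longrightarrow>
        measure M {\<omega> \<in> space M. \<forall>s\<in>{t0..t1}. 0 < x s \<omega>}
          \<le> 5/2 * (\<bar>alphabar d (f (a0 \<epsilon>)) xdet t1 t0\<bar> / \<epsilon> + 1) * exp (- \<kappa> * h\<^sup>2 / \<sigma>\<^sup>2)
            + 2 * exp (- \<kappa> * (1 / ln (h / \<sigma>))
                * (alpha d (f (a0 \<epsilon>)) t1 (max t0 (- c1 * sqrt \<sigma>)) / \<epsilon>)))"
    proof (intro exI[of _ "min (e1 / 2) e2"] conjI allI impI)
      show "0 < min (e1 / 2) e2" using e1 e2 by simp
      fix \<epsilon> \<sigma> t0 t1 h x0 :: real and xdet :: "real \<Rightarrow> real" and M :: "'w measure" and W x :: "real \<Rightarrow> 'w \<Rightarrow> real"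
      assume eb: "0 < \<epsilon> \<and> \<epsilon> \<le> min (e1 / 2) e2"
      define r where "r = a0 \<epsilon>"
      assume "0 < \<sigma> \<and> max (a0 \<epsilon>) (\<epsilon> powr (2/3)) \<le> c1\<^sup>2 * \<sigma> \<and>
        det_solution (f (a0 \<epsilon>)) d T \<epsilon> xdet \<and>
        asymp_between cm cp (xdet (- T) - xstar (a0 \<epsilon>) (- T)) \<epsilon> \<and>
        - T \<le> t0 \<and> t0 \<le> t1 \<and> t1 \<le> T \<and>
        - c1 * sqrt \<sigma> \<le> t1 \<and> t1 \<le> c1 * sqrt \<sigma> \<and>
        2 * \<sigma> < h \<and>
        (\<forall>s\<in>{t0..t1}. xdet s + h * sqrt (zeta d (f (a0 \<epsilon>)) T \<epsilon> xdet s) < \<delta>) \<and>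
        0 < x0 \<and> x0 \<le> xdet t0 + 1/2 * h * sqrt (zeta d (f (a0 \<epsilon>)) T \<epsilon> xdet t0) \<and>
        standard_wiener M t0 W \<and>
        sde_solution (f (a0 \<epsilon>)) \<epsilon> \<sigma> t0 t1 x0 M W x"
      then have sig: "0 < \<sigma>" and large: "r \<le> c1\<^sup>2 * \<sigma>" "\<epsilon> powr (2/3) \<le> c1\<^sup>2 * \<sigma>"
        and det: "det_solution (f r) d T \<epsilon> xdet"
        and init: "asymp_between cm cp (xdet (- T) - xstar r (- T)) \<epsilon>"
        and t: "- T \<le> t0" "t0 \<le> t1" "t1 \<le> T" "- c1 * sqrt \<sigma> \<le> t1" "t1 \<le> c1 * sqrt \<sigma>"
        and h: "2 * \<sigma> < h"
        and envelope: "\<And>v. v \<in> {t0..t1} \<Longrightarrow> xdet v + h * sqrt (zeta d (f r) T \<epsilon> xdet v) < \<delta>"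
        and x0_le: "x0 \<le> xdet t0 + 1/2 * h * sqrt (zeta d (f r) T \<epsilon> xdet t0)"
        and W: "standard_wiener M t0 W"
        and sol: "sde_solution (f r) \<epsilon> \<sigma> t0 t1 x0 M W x"
        unfolding r_def by simp_all
      have eps: "0 < \<epsilon>" "\<epsilon> \<le> e2" using eb by auto
      have rr: "0 < r" "r < r0" unfolding r_def using a0 eb e1 by auto
      then have rin: "r \<in> {0<..rbar}" and rt: "r \<le> \<tau>\<^sup>2" unfolding r0_def by auto
      have rs: "sqrt r \<le> \<tau>" using real_sqrt_le_mono[OF rt] ps by simp
      obtain ft where slc: "slice (f r) ft (xstar r) d T r \<delta> B \<tau> x1 c A m k" using sl rin rs by blast
      have Ke: "2 * K * \<epsilon> < \<mu> / (2 * B)" "K * \<epsilon> \<le> A * \<tau>" "2 * K * \<epsilon> \<le> m * \<tau>"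
      proof -
        have e: "\<epsilon> \<le> \<mu> / (8 * B * K)" "\<epsilon> \<le> A * \<tau> / K" "\<epsilon> \<le> m * \<tau> / (2 * K)" using eps unfolding e2_def by auto
        have "2 * K * \<epsilon> \<le> 2 * K * (\<mu> / (8 * B * K))" using e(1) K0 by (intro mult_left_mono) auto
        also have "\<dots> = \<mu> / (4 * B)" using K0 by simp
        also have "\<dots> < \<mu> / (2 * B)" using \<mu> ps by (intro divide_strict_left_mono) auto
        finally show "2 * K * \<epsilon> < \<mu> / (2 * B)" .
        show "K * \<epsilon> \<le> A * \<tau>" "2 * K * \<epsilon> \<le> m * \<tau>" using e(2,3) K0 by (simp_all add: le_divide_eq mult_ac)
      qed
      have ini: "\<bar>xdet (- T) - xstar r (- T)\<bar> \<le> cp * \<epsilon>"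
      proof -
        have "0 < cm * \<epsilon>" using assms(5) eps by simp
        then show ?thesis using init unfolding asymp_between_def by linarith
      qed
      have ds: "det_slice (f r) ft (xstar r) d T r \<delta> B \<tau> x1 c A m k \<epsilon> xdet cp K"
        using slc eps(1) det ini assms(6) K Ke
        unfolding det_slice_def det_slice_axioms_def \<mu>_def by blast
      interpret det_slice "f r" ft "xstar r" d T r \<delta> B \<tau> x1 c A m k \<epsilon> xdet cp K by (rule ds)
      show "measure M {\<omega> \<in> space M. \<forall>s\<in>{t0..t1}. 0 < x s \<omega>}
          \<le> 5/2 * (\<bar>alphabar d (f (a0 \<epsilon>)) xdet t1 t0\<bar> / \<epsilon> + 1) * exp (- \<kappa> * h\<^sup>2 / \<sigma>\<^sup>2)
            + 2 * exp (- \<kappa> * (1 / ln (h / \<sigma>))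
                * (alpha d (f (a0 \<epsilon>)) t1 (max t0 (- c1 * sqrt \<sigma>)) / \<epsilon>))"
      \<comment> \<open>For larger \<open>\<sigma>\<close> the ratio \<open>h/\<sigma>\<close> is bounded and the right-hand side exceeds one.\<close>
      proof (cases "\<sigma> \<le> \<sigma>1")
        case False
        interpret prob_space M using W by (simp add: standard_wiener_def)
        have tT: "t1 \<in> {-T..T}" "t1 \<in> {t0..t1}" using t by auto
        have z: "zc \<le> zeta d (f r) T \<epsilon> xdet t1" unfolding zc_def by (rule zeta_lower_const[OF tT(1)])
        have h0: "0 < h" using h sig by linarith
        have "h * sqrt (zeta d (f r) T \<epsilon> xdet t1) \<le> 2 * d"
          using envelope[OF tT(2)] xdet_range[OF tT(1)] assms(3) by simp
        then have "(h * sqrt (zeta d (f r) T \<epsilon> xdet t1))\<^sup>2 \<le> (2 * d)\<^sup>2"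
          using h0 z zc by (intro power_mono) auto
        then have "h\<^sup>2 * zeta d (f r) T \<epsilon> xdet t1 \<le> 4 * d\<^sup>2" using z zc by (simp add: power_mult_distrib)
        moreover have "h\<^sup>2 * zc \<le> h\<^sup>2 * zeta d (f r) T \<epsilon> xdet t1" using z by (intro mult_left_mono) auto
        ultimately have hz: "h\<^sup>2 \<le> 4 * d\<^sup>2 / zc" using zc by (simp add: le_divide_eq)
        have "\<sigma>1\<^sup>2 \<le> \<sigma>\<^sup>2" using False \<sigma>1 by (intro power_mono) auto
        then have "h\<^sup>2 / \<sigma>\<^sup>2 \<le> (4 * d\<^sup>2 / zc) / \<sigma>1\<^sup>2" using hz \<sigma>1 zc by (intro frac_le) auto
        also have "\<dots> = Y" unfolding Y_def by simp
        finally have "\<kappa> * (h\<^sup>2 / \<sigma>\<^sup>2) \<le> \<kappa> * Y" using \<kappa> by (intro mult_left_mono) auto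
        then have "\<kappa> * (h\<^sup>2 / \<sigma>\<^sup>2) \<le> 1/2" using \<kappa>(2) by linarith
        moreover have "- \<kappa> * h\<^sup>2 / \<sigma>\<^sup>2 = - (\<kappa> * (h\<^sup>2 / \<sigma>\<^sup>2))" by simp
        ultimately have "- (1/2) \<le> - \<kappa> * h\<^sup>2 / \<sigma>\<^sup>2" by linarith
        then have "1 + - (1/2) \<le> exp (- \<kappa> * h\<^sup>2 / \<sigma>\<^sup>2)"
          using exp_ge_add_one_self[of "- \<kappa> * h\<^sup>2 / \<sigma>\<^sup>2"] by linarith
        then have ex: "1/2 \<le> exp (- \<kappa> * h\<^sup>2 / \<sigma>\<^sup>2)" by simp
        have "5/2 * 1 * (1/2) \<le> 5/2 * (\<bar>alphabar d (f (a0 \<epsilon>)) xdet t1 t0\<bar> / \<epsilon> + 1) * exp (- \<kappa> * h\<^sup>2 / \<sigma>\<^sup>2)"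
          using ex eps by (intro mult_mono) auto
        then have "1 \<le> 5/2 * (\<bar>alphabar d (f (a0 \<epsilon>)) xdet t1 t0\<bar> / \<epsilon> + 1) * exp (- \<kappa> * h\<^sup>2 / \<sigma>\<^sup>2)" by linarith
        moreover have "0 \<le> 2 * exp (- \<kappa> * (1 / ln (h / \<sigma>))
                * (alpha d (f (a0 \<epsilon>)) t1 (max t0 (- c1 * sqrt \<sigma>)) / \<epsilon>))" by simp
        moreover have "measure M {\<omega> \<in> space M. \<forall>s\<in>{t0..t1}. 0 < x s \<omega>} \<le> 1" by (rule prob_le_1)
        ultimately show ?thesis by linarith
      next
        case True
        define s where "s = c1 * sqrt \<sigma>"
        have sq: "s\<^sup>2 = c1\<^sup>2 * \<sigma>" unfolding s_def using sig by (simp add: power_mult_distrib)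
        have c1': "c1\<^sup>2 \<le> 1" using c1 by (simp add: power_le_one)
        have s2: "s\<^sup>2 \<le> \<sigma>" unfolding sq using mult_right_mono[OF c1', of \<sigma>] sig by simp
        have s0: "0 < s" unfolding s_def using c1 sig by simp
        have small: "\<sigma> \<le> \<delta>\<^sup>2 / (2 * Kb\<^sup>2)" "\<sigma> \<le> c * \<delta>\<^sup>2 * lam / 4" "\<sigma> \<le> \<tau>\<^sup>2" "\<sigma> \<le> c * \<delta>\<^sup>2 / (8 * A)" "\<sigma> \<le> (\<delta> / (8 * C))\<^sup>2"
          using True unfolding \<sigma>1_def by auto
        have st: "s \<le> \<tau>" using power2_le_imp_le[of s \<tau>] s2 small(3) ps by linarith
        have s8: "s \<le> \<delta> / (8 * C)" using power2_le_imp_le[of s "\<delta> / (8 * C)"] s2 small(5) assms(2) C0 by simp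
        have e3: "\<epsilon> \<le> s ^ 3"
        proof -
          have "(\<epsilon> powr (2/3)) ^ 3 = \<epsilon> powr (2/3 * 3)"
            using eps by (simp add: powr_power)
          then have "(\<epsilon> powr (2/3)) ^ 3 = \<epsilon>\<^sup>2" using eps by (simp add: powr_numeral)
          moreover have "(\<epsilon> powr (2/3)) ^ 3 \<le> (s\<^sup>2) ^ 3" using large(2) unfolding sq by (intro power_mono) auto
          ultimately have "\<epsilon>\<^sup>2 \<le> (s ^ 3)\<^sup>2" by (simp add: power_mult[symmetric] mult.commute)
          then show ?thesis by (rule power2_le_imp_le) (use s0 in simp)
        qed
        have wi: "window (f r) ft (xstar r) d T r \<delta> B \<tau> x1 c A m k \<epsilon> xdet cp K s C c3"
          using ds s0 st e3 large(1) C c3 unfolding window_def window_axioms_def sq[symmetric] \<mu>_def by blast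
        have re: "regime (f r) ft (xstar r) d T r \<delta> B \<tau> x1 c A m k \<epsilon> xdet cp K s C c3 \<sigma> lam kap Kb"
        proof -
          have "\<sigma> * Kb\<^sup>2 \<le> \<delta>\<^sup>2 / 2" using small(1) Kb by (simp add: le_divide_eq)
          moreover have "\<sigma> < c * \<delta>\<^sup>2 * lam / 2"
          proof -
            have "0 < c * \<delta>\<^sup>2 * lam" using ps assms(2) lam by simp
            then show ?thesis using small(2) by linarith
          qed
          moreover have "8 * A * s\<^sup>2 \<le> c * \<delta>\<^sup>2"
          proof -
            have "8 * A * s\<^sup>2 \<le> 8 * A * (c * \<delta>\<^sup>2 / (8 * A))" using s2 small(4) ps by (intro mult_left_mono) auto
            then show ?thesis using ps by simp
          qed
          moreover have "8 * C * s \<le> \<delta>" using s8 C0 by (simp add: le_divide_eq mult_ac)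
          ultimately show ?thesis using wi sig s2 lam Kb kap unfolding regime_def regime_axioms_def by blast
        qed
        interpret regime "f r" ft "xstar r" d T r \<delta> B \<tau> x1 c A m k \<epsilon> xdet cp K s C c3 \<sigma> lam kap Kb by (rule re)
        have "0 < k0" unfolding k0_def by (rule K0_pos)
        then have "\<kappa> \<le> regime.K0 T \<delta> B \<tau> A m C c3 lam kap" unfolding \<kappa>_def k0_def[symmetric] by simp
        note kk = K0_le[OF this]
        have ts: "- s \<le> t1" "t1 \<le> s" using t unfolding s_def by auto
        show ?thesis
          using survival_bound[OF t(1,2) ts h envelope x0_le W sol \<kappa>(1) kk]
          unfolding r_def s_def by simp
      qed
    qed
  qed
qed

end
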